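(* Let $m>1$ be an integer, let $\ell$ be an odd integer, and let $H$, $K$, $\nu$, $\Gamma$ be as defined in the context. Let $\lambda:H\to K$ be the projection $A\mapsto\rho$, $B\mapsto\eta$, let $\Lambda:\mathrm{Aut}(H)\to\mathrm{Aut}(K)$ be the corresponding homomorphism, and let $$\widehat{\Lambda}:\mathrm{Aut}_3(H)/(\mathrm{Inn}(H)\mathrm{Aut}_2(H))\hookrightarrow\mathrm{Aut}_2(K)/(\mathrm{Inn}(K)\mathrm{Aut}_1(K))$$ be the imbedding induced by $\Lambda$. Then $\mathrm{Im}(\widehat{\Lambda})=\langle\overline{\Gamma},\overline{\Gamma^\nu}\rangle^{\widehat{\Lambda}}$ is isomorphic to the Klein 4-group. Therefore, $|\mathrm{Aut}_3(H)|=2^{8m-4}$ and $\mathrm{Aut}_3(H)=\mathrm{Inn}(H)\mathrm{Aut}_2(H)\langle\Gamma,\Gamma^\nu\rangle$.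
   Context: Notation: $[a,b]=a^{-1}b^{-1}ab$, $b^a=a^{-1}ba$, $\alpha=1+2^m\ell$, $s=2^{m-1}$. Let $$J=\langle A,B\mid A^{[A,B]}=A^{\alpha},\ B^{[B,A]}=B^{\alpha},\ A^{2^{3m-1}}=B^{2^{3m-1}}=1\rangle,$$ let $H=J/Z(J)$, with presentation $$H=\langle A,B\mid A^{[A,B]}=A^{\alpha},\ B^{[B,A]}=B^{\alpha},\ A^{2^{2m-1}}=B^{2^{2m-1}}=1\rangle,$$ and let $K=H/Z(H)$, with presentation $$K=\langle\rho,\eta\mid\rho^{[\rho,\eta]}=\rho^\alpha,\ \eta^{[\eta,\rho]}=\eta^\alpha,\ \rho^{2^{2m-1}}=\eta^{2^{2m-1}}=[\rho,\eta]^{2^{m-1}}=1\rangle.$$ For a group $T$, $Z_0(T)=1, Z_1(T),Z_2(T),\dots$ denotes the upper central series, and $\mathrm{Aut}_i(T)$ is the kernel of the canonical map $\mathrm{Aut}(T)\to\mathrm{Aut}(T/Z_i(T))$. The map $\Lambda$ sends an automorphism of $H$ to the automorphism it induces on $K=H/Z(H)$; it maps $\mathrm{Aut}_3(H)$ into $\mathrm{Aut}_2(K)$ and the induced map $\widehat\Lambda$ is well defined and injective; here $\mathrm{Inn}(H)\subset\mathrm{Aut}_3(H)$ and $\mathrm{Inn}(K)\subset\mathrm{Aut}_2(K)$. The following automorphisms of $H$ exist: $\nu$, given by $A\mapsto B$, $B\mapsto A$; and $\Gamma\in\mathrm{Aut}_3(H)$, given by $A\mapsto A^{1+s}$, $B\mapsto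 BA^s$. We write $\Gamma^\nu=\nu^{-1}\Gamma\nu$, a bar denotes the coset in $\mathrm{Aut}_3(H)/(\mathrm{Inn}(H)\mathrm{Aut}_2(H))$, and $X^{\widehat\Lambda}$ denotes the image of $X$ under $\widehat\Lambda$. *)

theory Defs
  imports "HOL-Algebra.Algebra"
begin

section \<open>Groups given by generators and relations\<close>

text \<open>
  A word over the generators \<open>'g\<close> is a list of letters; \<open>(x, True)\<close> stands for the
  generator \<open>x\<close> and \<open>(x, False)\<close> for its inverse.
\<close>

type_synonym 'g word = "('g \<times> bool) list"

definition winv :: "'g word \<Rightarrow> 'g word" where
  "winv w = rev (map (\<lambda>(x, b). (x, \<not> b)) w)"

definition wpow :: "'g word \<Rightarrow> int \<Rightarrow> 'g word" where
  "wpow w k = concat (replicate (nat \<bar>k\<bar>) (if k < 0 then winv w else w))"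

definition wcomm :: "'g word \<Rightarrow> 'g word \<Rightarrow> 'g word" where
  "wcomm a b = winv a @ winv b @ a @ b"

definition wconj :: "'g word \<Rightarrow> 'g word \<Rightarrow> 'g word" where
  "wconj b a = winv a @ b @ a"

text \<open>
  A pair \<open>(u, v) \<in> R\<close> is the defining relation \<open>u = v\<close>.  Two words represent the same element
  of the presented group iff they are related by the congruence generated by \<open>R\<close> together
  with free cancellation.
\<close>

inductive pres_eq :: "('g word \<times> 'g word) set \<Rightarrow> 'g word \<Rightarrow> 'g word \<Rightarrow> bool"
  for R where
  refl: "pres_eq R w w"
| sym: "pres_eq R u v \<Longrightarrow> pres_eq R v u"
| trans: "pres_eq R u v \<Longrightarrow> pres_eq R v w \<Longrightarrow> pres_eq R u w"
| cancel: "pres_eq R (p @ [(x, b), (x, \<not> b)] @ q) (p @ q)"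
| rel: "(u, v) \<in> R \<Longrightarrow> pres_eq R (p @ u @ q) (p @ v @ q)"

definition pres_class :: "('g word \<times> 'g word) set \<Rightarrow> 'g word \<Rightarrow> 'g word set" where
  "pres_class R w = {v. pres_eq R w v}"

text \<open>All elements of the type \<open>'g\<close> are generators.\<close>

definition presented_group :: "('g word \<times> 'g word) set \<Rightarrow> 'g word set monoid" where
  "presented_group R =
     \<lparr>carrier = range (pres_class R),
      monoid.mult = (\<lambda>U V. \<Union>u\<in>U. \<Union>v\<in>V. pres_class R (u @ v)),
      one = pres_class R []\<rparr>"

definition pres_gen :: "('g word \<times> 'g word) set \<Rightarrow> 'g \<Rightarrow> 'g word set" where
  "pres_gen R x = pres_class R [(x, True)]"

lemma pres_class_eq_iff: "pres_class R u = pres_class R v \<longleftrightarrow> pres_eq R u v"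
  unfolding pres_class_def by (blast intro: pres_eq.refl pres_eq.sym pres_eq.trans)

lemma pres_eq_context: "pres_eq R u v \<Longrightarrow> pres_eq R (p @ u @ q) (p @ v @ q)"
proof (induction rule: pres_eq.induct)
  case (cancel p' x b q')
  show ?case using pres_eq.cancel[of R "p @ p'" x b "q' @ q"] by simp
next
  case (rel u v p' q')
  then show ?case using pres_eq.rel[of u v R "p @ p'" "q' @ q"] by simp
qed (blast intro: pres_eq.refl pres_eq.sym pres_eq.trans)+

lemma pres_eq_append:
  assumes "pres_eq R u u'" "pres_eq R v v'"
  shows "pres_eq R (u @ v) (u' @ v')"
  using pres_eq_context[OF assms(1), of "[]" v] pres_eq_context[OF assms(2), of u' "[]"]
  by (simp add: pres_eq.trans[of R "u @ v" "u' @ v"])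

lemma presented_group_mult [simp]:
  "pres_class R u \<otimes>\<^bsub>presented_group R\<^esub> pres_class R v = pres_class R (u @ v)"
proof -
  have 1: "pres_class R (u' @ v') = pres_class R (u @ v)"
    if "u' \<in> pres_class R u" "v' \<in> pres_class R v" for u' v'
    using pres_eq.sym[OF pres_eq_append[of R u u' v v']] that
    unfolding pres_class_eq_iff by (simp add: pres_class_def)
  have 2: "w \<in> pres_class R w" for w
    by (simp add: pres_class_def pres_eq.refl)
  have "(\<Union>u'\<in>pres_class R u. \<Union>v'\<in>pres_class R v. pres_class R (u' @ v')) =
      (\<Union>u'\<in>pres_class R u. \<Union>v'\<in>pres_class R v. pres_class R (u @ v))"
    using 1 by simp
  also have "\<dots> = pres_class R (u @ v)" using 2 by blast
  finally show ?thesis by (simp add: presented_group_def)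
qed

lemma winv_left: "pres_eq R (winv w @ w) []"
proof (induction w)
  case (Cons a w)
  obtain x b where a: "a = (x, b)" by (cases a)
  have "pres_eq R (winv (a # w) @ a # w) (winv w @ w)"
    using pres_eq.cancel[of R "winv w" x "\<not> b" w] by (simp add: winv_def a)
  then show ?case using Cons.IH by (rule pres_eq.trans)
qed (simp add: winv_def pres_eq.refl)

lemma group_presented_group: "group (presented_group R)"
proof (rule groupI)
  fix x assume "x \<in> carrier (presented_group R)"
  then obtain w where w: "x = pres_class R w" by (auto simp: presented_group_def)
  have "pres_class R (winv w) \<otimes>\<^bsub>presented_group R\<^esub> x = \<one>\<^bsub>presented_group R\<^esub>"
    unfolding w presented_group_mult
    by (simp add: presented_group_def pres_class_eq_iff winv_left)
  then show "\<exists>y\<in>carrier (presented_group R). y \<otimes>\<^bsub>presented_group R\<^esub> x = \<one>\<^bsub>presented_group R\<^esub>"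
    by (auto simp: presented_group_def)
next
  fix x assume "x \<in> carrier (presented_group R)"
  then obtain w where w: "x = pres_class R w" by (auto simp: presented_group_def)
  have "\<one>\<^bsub>presented_group R\<^esub> = pres_class R []" by (simp add: presented_group_def)
  then show "\<one>\<^bsub>presented_group R\<^esub> \<otimes>\<^bsub>presented_group R\<^esub> x = x" by (simp add: w)
next
  fix x y z
  assume "x \<in> carrier (presented_group R)" "y \<in> carrier (presented_group R)"
    "z \<in> carrier (presented_group R)"
  then obtain u v w where "x = pres_class R u" "y = pres_class R v" "z = pres_class R w"
    by (auto simp: presented_group_def)
  then show "x \<otimes>\<^bsub>presented_group R\<^esub> y \<otimes>\<^bsub>presented_group R\<^esub> z =
      x \<otimes>\<^bsub>presented_group R\<^esub> (y \<otimes>\<^bsub>presented_group R\<^esub> z)" by simp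
next
  fix x y
  assume "x \<in> carrier (presented_group R)" "y \<in> carrier (presented_group R)"
  then obtain u v where "x = pres_class R u" "y = pres_class R v"
    by (auto simp: presented_group_def)
  then have "x \<otimes>\<^bsub>presented_group R\<^esub> y = pres_class R (u @ v)" by simp
  then show "x \<otimes>\<^bsub>presented_group R\<^esub> y \<in> carrier (presented_group R)"
    by (simp add: presented_group_def)
qed (simp add: presented_group_def)


section \<open>Upper central series and automorphisms\<close>

definition center :: "('a, 'b) monoid_scheme \<Rightarrow> 'a set" where
  "center G = {x \<in> carrier G. \<forall>y\<in>carrier G. x \<otimes>\<^bsub>G\<^esub> y = y \<otimes>\<^bsub>G\<^esub> x}"

primrec upper_central :: "('a, 'b) monoid_scheme \<Rightarrow> nat \<Rightarrow> 'a set" where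
  "upper_central G 0 = {\<one>\<^bsub>G\<^esub>}"
| "upper_central G (Suc i) =
     {x \<in> carrier G. upper_central G i #>\<^bsub>G\<^esub> x \<in> center (G Mod upper_central G i)}"

text \<open>
  The automorphism of \<open>G / N\<close> induced by an automorphism \<open>f\<close> of \<open>G\<close> with \<open>f ` N = N\<close>; it
  sends the coset \<open>N x\<close> to \<open>f ` (N x) = N (f x)\<close>.
\<close>

definition induced_auto :: "('a, 'b) monoid_scheme \<Rightarrow> 'a set \<Rightarrow> ('a \<Rightarrow> 'a) \<Rightarrow> 'a set \<Rightarrow> 'a set" where
  "induced_auto G N f = (\<lambda>C\<in>carrier (G Mod N). f ` C)"

definition Aut_central :: "nat \<Rightarrow> ('a, 'b) monoid_scheme \<Rightarrow> ('a \<Rightarrow> 'a) set" where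
  "Aut_central i G =
     kernel (AutoGroup G) (AutoGroup (G Mod upper_central G i))
       (induced_auto G (upper_central G i))"

definition Inn :: "('a, 'b) monoid_scheme \<Rightarrow> ('a \<Rightarrow> 'a) set" where
  "Inn G = (\<lambda>g. \<lambda>x\<in>carrier G. inv\<^bsub>G\<^esub> g \<otimes>\<^bsub>G\<^esub> x \<otimes>\<^bsub>G\<^esub> g) ` carrier G"

text \<open>The product \<open>Inn(G) Aut\<^sub>i(G)\<close> and the quotient \<open>Aut\<^sub>i\<^sub>+\<^sub>1(G) / (Inn(G) Aut\<^sub>i(G))\<close>.\<close>

definition InnAut :: "nat \<Rightarrow> ('a, 'b) monoid_scheme \<Rightarrow> ('a \<Rightarrow> 'a) set" where
  "InnAut i G = Inn G <#>\<^bsub>AutoGroup G\<^esub> Aut_central i G"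

definition OutQuot :: "nat \<Rightarrow> ('a, 'b) monoid_scheme \<Rightarrow> ('a \<Rightarrow> 'a) set monoid" where
  "OutQuot i G = (AutoGroup G \<lparr>carrier := Aut_central (Suc i) G\<rparr>) Mod InnAut i G"


section \<open>The groups \<open>H\<close> and \<open>K\<close>\<close>

text \<open>
  \<open>H = J / Z(J)\<close>, where \<open>J\<close> has the same relations with \<open>2\<^sup>3\<^sup>m\<^sup>-\<^sup>1\<close> in place of
  \<open>2\<^sup>2\<^sup>m\<^sup>-\<^sup>1\<close>, is taken in its presentation; \<open>K = H / Z(H)\<close> is the literal quotient, so that
  \<open>\<rho>\<close> and \<open>\<eta>\<close> are the cosets of \<open>A\<close> and \<open>B\<close>.
\<close>

datatype gen = GenA | GenB

definition H_rels :: "nat \<Rightarrow> int \<Rightarrow> (gen word \<times> gen word) set" where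
  "H_rels m l =
     (let a = [(GenA, True)]; b = [(GenB, True)]; \<alpha> = 1 + 2 ^ m * l in
       {(wconj a (wcomm a b), wpow a \<alpha>),
        (wconj b (wcomm b a), wpow b \<alpha>),
        (wpow a (2 ^ (2 * m - 1)), []),
        (wpow b (2 ^ (2 * m - 1)), [])})"

definition H_grp :: "nat \<Rightarrow> int \<Rightarrow> gen word set monoid" where
  "H_grp m l = presented_group (H_rels m l)"

definition H_A :: "nat \<Rightarrow> int \<Rightarrow> gen word set" where
  "H_A m l = pres_gen (H_rels m l) GenA"

definition H_B :: "nat \<Rightarrow> int \<Rightarrow> gen word set" where
  "H_B m l = pres_gen (H_rels m l) GenB"

definition K_grp :: "nat \<Rightarrow> int \<Rightarrow> gen word set set monoid" where
  "K_grp m l = H_grp m l Mod center (H_grp m l)"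

text \<open>The automorphism of \<open>H\<close> given on the generators by \<open>A \<mapsto> a\<close>, \<open>B \<mapsto> b\<close>.\<close>

definition H_auto :: "nat \<Rightarrow> int \<Rightarrow> gen word set \<Rightarrow> gen word set \<Rightarrow> (gen word set \<Rightarrow> gen word set)" where
  "H_auto m l a b = (THE f. f \<in> auto (H_grp m l) \<and> f (H_A m l) = a \<and> f (H_B m l) = b)"

definition \<nu> :: "nat \<Rightarrow> int \<Rightarrow> (gen word set \<Rightarrow> gen word set)" where
  "\<nu> m l = H_auto m l (H_B m l) (H_A m l)"

definition \<Gamma> :: "nat \<Rightarrow> int \<Rightarrow> (gen word set \<Rightarrow> gen word set)" where
  "\<Gamma> m l =
     (let s = 2 ^ (m - 1) :: nat in
       H_auto m l (H_A m l [^]\<^bsub>H_grp m l\<^esub> (1 + s)) (H_B m l \<otimes>\<^bsub>H_grp m l\<^esub> (H_A m l [^]\<^bsub>H_grp m l\<^esub> s)))"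

text \<open>
  The product of \<open>AutoGroup\<close> is composition of functions written on the left, whereas
  \<open>\<nu>\<^sup>-\<^sup>1 \<Gamma> \<nu>\<close> is usually read with maps acting on the right.  As \<open>\<nu>\<close> is an involution, both
  readings give the same automorphism.
\<close>

definition \<Gamma>\<nu> :: "nat \<Rightarrow> int \<Rightarrow> (gen word set \<Rightarrow> gen word set)" where
  "\<Gamma>\<nu> m l =
     inv\<^bsub>AutoGroup (H_grp m l)\<^esub> (\<nu> m l) \<otimes>\<^bsub>AutoGroup (H_grp m l)\<^esub> \<Gamma> m l \<otimes>\<^bsub>AutoGroup (H_grp m l)\<^esub> \<nu> m l"

text \<open>
  The homomorphism \<open>Aut(H) \<rightarrow> Aut(K)\<close> belonging to the projection
  \<open>x \<mapsto> center (H_grp m l) #> x\<close> of \<open>H\<close> onto \<open>K\<close>.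
\<close>

definition \<Lambda> :: "nat \<Rightarrow> int \<Rightarrow> (gen word set \<Rightarrow> gen word set)
    \<Rightarrow> (gen word set set \<Rightarrow> gen word set set)" where
  "\<Lambda> m l = induced_auto (H_grp m l) (center (H_grp m l))"

text \<open>
  The map \<open>Aut\<^sub>3(H) / (Inn(H) Aut\<^sub>2(H)) \<rightarrow> Aut\<^sub>2(K) / (Inn(K) Aut\<^sub>1(K))\<close> induced by \<open>\<Lambda>\<close>: the
  coset of \<open>f\<close> goes to the coset of \<open>\<Lambda> f\<close>, the common value over all representatives.
\<close>

definition \<Lambda>_hat :: "nat \<Rightarrow> int \<Rightarrow> (gen word set \<Rightarrow> gen word set) set
    \<Rightarrow> (gen word set set \<Rightarrow> gen word set set) set" where
  "\<Lambda>_hat m l C =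
     the_elem ((\<lambda>f. InnAut 1 (K_grp m l) #>\<^bsub>AutoGroup (K_grp m l)\<^esub> \<Lambda> m l f) ` C)"

definition H_bar :: "nat \<Rightarrow> int \<Rightarrow> (gen word set \<Rightarrow> gen word set)
    \<Rightarrow> (gen word set \<Rightarrow> gen word set) set" where
  "H_bar m l f = InnAut 2 (H_grp m l) #>\<^bsub>AutoGroup (H_grp m l)\<^esub> f"

end

theory Submission
  imports Defs "HOL-Number_Theory.Cong"
begin

text \<open>
  Put \<open>s = 2\<^sup>m\<^sup>-\<^sup>1\<close>, \<open>h = s l\<close>, \<open>N = 2 s\<^sup>2\<close> and \<open>C = [A, B]\<close>, so that \<open>\<alpha> = 1 + 2 h\<close>, the generators
  have order \<open>N\<close>, and \<open>N\<close> divides \<open>2 h\<^sup>2\<close>.  Everything rests on coordinates on \<open>H\<close>.  Collection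
  shows that every element is of the form \<open>A\<^sup>i B\<^sup>j C\<^sup>k\<close> with exponents modulo \<open>N\<close>.  Conversely, the
  triples \<open>(i, j, k)\<close> modulo \<open>N\<close> carry a group structure satisfying the relations: its product is
  that of the integral Heisenberg group plus \<open>2 h\<close> times a correction, and because terms in
  \<open>2 h\<^sup>2\<close> vanish, associativity only asks the correction to satisfy the cocycle identity
  (\<open>corr_cocycle\<close>).  So the coordinates are unique and the multiplication of \<open>H\<close> is an explicit
  polynomial law (\<open>nf_mult_bin\<close>).

  Commutators with \<open>A\<close> and \<open>B\<close> then give the upper central series: \<open>Z\<^sub>1 = \<langle>C\<^sup>s\<rangle>\<close>,
  \<open>Z\<^sub>2 = \<langle>A\<^sup>2\<^sup>s, B\<^sup>2\<^sup>s, C\<^sup>s\<rangle>\<close> and \<open>Z\<^sub>3 = \<langle>A\<^sup>s, B\<^sup>s, C\<rangle>\<close>.  An automorphism \<open>f\<close> in \<open>Aut\<^sub>3(H)\<close> thus acts on the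
  abelianization, which is \<open>(\<int>/2s)\<^sup>2\<close>, by \<open>A \<mapsto> A\<^sup>1\<^sup>+\<^sup>s\<^sup>a B\<^sup>s\<^sup>b\<close>, \<open>B \<mapsto> A\<^sup>s\<^sup>d B\<^sup>1\<^sup>+\<^sup>s\<^sup>e\<close>.  As \<open>s\<close> is even, \<open>s\<^sup>2\<close>
  vanishes modulo \<open>2 s\<close>, and the parities of \<open>(a, b)\<close> define a homomorphism from \<open>Aut\<^sub>3(H)\<close> to the
  Klein group, which takes \<open>\<Gamma>\<close> and \<open>\<Gamma>\<^sup>\<nu>\<close> to the two standard generators.

  Its kernel is \<open>Inn(H) Aut\<^sub>2(H)\<close>.  If \<open>a\<close> and \<open>b\<close> are even, an inner automorphism removes the powers
  of \<open>C\<close> from the images modulo \<open>Z\<^sub>2\<close>.  For the resulting images \<open>A'\<close> and \<open>B'\<close>, the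
  commutator \<open>[A', B']\<close> contains \<open>B\<close> to the power \<open>s\<^sup>2 e\<close>, and \<open>B'\<close> to the power \<open>\<alpha>\<close> contains \<open>C\<close> to the
  power \<open>s\<^sup>2 d\<close>; the defining relations admit neither, so \<open>d\<close> and \<open>e\<close> are even (\<open>pair_parity\<close>) and the
  automorphism lies in \<open>Aut\<^sub>2(H)\<close>.  In the other direction, \<open>A z\<close> and \<open>B w\<close> satisfy the relations for
  all \<open>z, w\<close> in \<open>Z\<^sub>2\<close> (\<open>deep_pair\<close>).  Hence \<open>Inn(H) Aut\<^sub>2(H)\<close> corresponds to all pairs of
  elements of the cosets of \<open>A\<close> and \<open>B\<close> modulo \<open>H' = \<langle>A\<^sup>2\<^sup>s, B\<^sup>2\<^sup>s, C\<rangle>\<close>, of which there are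
  \<open>(2 s\<^sup>4)\<^sup>2 = 2\<^sup>8\<^sup>m\<^sup>-\<^sup>6\<close>; with index 4 this gives \<open>|Aut\<^sub>3(H)| = 2\<^sup>8\<^sup>m\<^sup>-\<^sup>4\<close>.

  The statement about the image in \<open>Aut\<^sub>2(K) / (Inn(K) Aut\<^sub>1(K))\<close> is formal from there: since
  \<open>Z\<^sub>1(K) = Z\<^sub>2(H) / Z\<^sub>1(H)\<close>, an automorphism of \<open>H\<close> induces an element of \<open>Inn(K) Aut\<^sub>1(K)\<close> exactly if it
  lies in \<open>Inn(H) Aut\<^sub>2(H)\<close> (\<open>on_quotient_InnAut_iff\<close>), and therefore the image is \<open>Aut\<^sub>3(H)\<close> modulo the
  kernel of the parity map.
\<close>

section \<open>Homomorphisms out of a presented group\<close>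

definition weval :: "('a, 'b) monoid_scheme \<Rightarrow> ('g \<Rightarrow> 'a) \<Rightarrow> 'g word \<Rightarrow> 'a" where
  "weval G \<phi> w =
     foldr (\<lambda>(x, b) y. (if b then \<phi> x else inv\<^bsub>G\<^esub> (\<phi> x)) \<otimes>\<^bsub>G\<^esub> y) w \<one>\<^bsub>G\<^esub>"

context group
begin

lemma weval_closed [simp]: "range \<phi> \<subseteq> carrier G \<Longrightarrow> weval G \<phi> w \<in> carrier G"
  by (induction w) (auto simp: weval_def image_subset_iff)

lemma weval_append:
  "range \<phi> \<subseteq> carrier G \<Longrightarrow> weval G \<phi> (u @ v) = weval G \<phi> u \<otimes> weval G \<phi> v"
proof (induction u)
  case Nil
  then show ?case using weval_closed[of \<phi> v] by (simp add: weval_def)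
next
  case (Cons a u)
  obtain x b where a: "a = (x, b)" by (cases a)
  have "\<phi> x \<in> carrier G" using Cons.prems by auto
  then show ?case
    using Cons weval_closed[of \<phi> u] weval_closed[of \<phi> v]
    by (simp add: weval_def a m_assoc)
qed

lemma weval_single:
  "range \<phi> \<subseteq> carrier G \<Longrightarrow> weval G \<phi> [(x, b)] = (if b then \<phi> x else inv (\<phi> x))"
  by (auto simp: weval_def image_subset_iff)

lemma weval_winv:
  assumes "range \<phi> \<subseteq> carrier G"
  shows "weval G \<phi> (winv w) = inv (weval G \<phi> w)"
proof (induction w)
  case Nil
  then show ?case by (simp add: weval_def winv_def)
next
  case (Cons a w)
  obtain x b where a: "a = (x, b)" by (cases a)
  have x: "\<phi> x \<in> carrier G" using assms by auto
  have "weval G \<phi> (winv (a # w)) = weval G \<phi> (winv w) \<otimes> weval G \<phi> [(x, \<not> b)]"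
    using weval_append[OF assms, of "winv w" "[(x, \<not> b)]"] by (simp add: winv_def a)
  also have "\<dots> = inv (weval G \<phi> [(x, b)] \<otimes> weval G \<phi> w)"
    using x Cons.IH assms by (simp add: weval_single inv_mult_group)
  also have "\<dots> = inv (weval G \<phi> (a # w))"
    using weval_append[OF assms, of "[(x, b)]" w] by (simp add: a)
  finally show ?case .
qed

lemma weval_wpow:
  assumes "range \<phi> \<subseteq> carrier G"
  shows "weval G \<phi> (wpow w k) = weval G \<phi> w [^] k"
proof -
  have c: "weval G \<phi> (concat (replicate n v)) = weval G \<phi> v [^] n" for n v
  proof (induction n)
    case (Suc n)
    then show ?case
      using assms nat_pow_Suc2[of "weval G \<phi> v" n] by (simp add: weval_append)
  qed (simp add: weval_def)
  show ?thesis
  proof (cases "k < 0")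
    case True
    then have "weval G \<phi> (wpow w k) = inv (weval G \<phi> w) [^] nat (- k)"
      by (simp add: wpow_def c weval_winv assms)
    also have "\<dots> = inv (weval G \<phi> w [^] nat (- k))" by (rule nat_pow_inv) (simp add: assms)
    also have "\<dots> = weval G \<phi> w [^] k" using True by (simp only: int_pow_def2 if_True)
    finally show ?thesis .
  next
    case False
    then have "weval G \<phi> (wpow w k) = weval G \<phi> w [^] nat k" by (simp add: wpow_def c)
    then show ?thesis using False by (simp only: int_pow_def2 if_False)
  qed
qed

lemma weval_presented_eq:
  assumes "range \<phi> \<subseteq> carrier G" and rels: "\<And>u v. (u, v) \<in> R \<Longrightarrow> weval G \<phi> u = weval G \<phi> v"
    and "pres_eq R u v"
  shows "weval G \<phi> u = weval G \<phi> v"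
  using assms(3)
proof induction
  case (cancel p x b q)
  have "\<phi> x \<in> carrier G" using assms(1) by auto
  then have "weval G \<phi> [(x, b), (x, \<not> b)] = \<one>" by (simp add: weval_def)
  then show ?case
    using assms(1) weval_append[OF assms(1), of "[(x, b), (x, \<not> b)]" q]
    by (simp add: weval_append)
next
  case (rel u v p q)
  then show ?case using rels by (simp add: weval_append assms(1))
qed simp_all

text \<open>Von Dyck's theorem: by \<open>weval_presented_eq\<close>, the value of a word depends only on its class.\<close>

lemma presented_group_universal:
  assumes "range \<phi> \<subseteq> carrier G" and "\<And>u v. (u, v) \<in> R \<Longrightarrow> weval G \<phi> u = weval G \<phi> v"
  obtains f where "f \<in> hom (presented_group R) G" "\<And>x. f (pres_gen R x) = \<phi> x"
proof -
  define f where "f C = weval G \<phi> (SOME w. C = pres_class R w)" for C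
  have f: "f (pres_class R w) = weval G \<phi> w" for w
  proof -
    have "pres_class R w = pres_class R (SOME v. pres_class R w = pres_class R v)"
      by (rule someI[of _ w]) simp
    then have "pres_eq R w (SOME v. pres_class R w = pres_class R v)"
      by (simp only: pres_class_eq_iff)
    from weval_presented_eq[OF assms this] show ?thesis by (simp add: f_def)
  qed
  have "f \<in> hom (presented_group R) G"
  proof (rule homI)
    fix x assume "x \<in> carrier (presented_group R)"
    then show "f x \<in> carrier G" using assms(1) by (auto simp: presented_group_def f)
  next
    fix x y assume "x \<in> carrier (presented_group R)" "y \<in> carrier (presented_group R)"
    then obtain u v where "x = pres_class R u" "y = pres_class R v"
      by (auto simp: presented_group_def)
    then show "f (x \<otimes>\<^bsub>presented_group R\<^esub> y) = f x \<otimes> f y"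
      using assms(1) by (simp add: f weval_append)
  qed
  moreover have "f (pres_gen R x) = \<phi> x" for x
    using assms(1) by (simp add: pres_gen_def f weval_single)
  ultimately show thesis by (rule that)
qed

end

lemma pres_gen_closed: "range (pres_gen R) \<subseteq> carrier (presented_group R)"
  by (auto simp: pres_gen_def presented_group_def)

lemma weval_pres_gen: "weval (presented_group R) (pres_gen R) w = pres_class R w"
proof -
  interpret P: group "presented_group R" by (rule group_presented_group)
  show ?thesis
  proof (induction w)
    case Nil
    show ?case by (simp add: weval_def presented_group_def)
  next
    case (Cons a w)
    obtain x b where a: "a = (x, b)" by (cases a)
    have one: "\<one>\<^bsub>presented_group R\<^esub> = pres_class R []" by (simp add: presented_group_def)
    have "pres_eq R [(x, False), (x, True)] []"
      using pres_eq.cancel[of R "[]" x False "[]"] by simp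
    then have "pres_class R [(x, False)] \<otimes>\<^bsub>presented_group R\<^esub> pres_gen R x = \<one>\<^bsub>presented_group R\<^esub>"
      unfolding one pres_gen_def presented_group_mult pres_class_eq_iff by simp
    then have "inv\<^bsub>presented_group R\<^esub> (pres_gen R x) = pres_class R [(x, False)]"
      by (rule P.inv_equality) (auto simp: pres_gen_def presented_group_def)
    then have "weval (presented_group R) (pres_gen R) [a] = pres_class R [a]"
      using P.weval_single[OF pres_gen_closed, of x b] by (simp add: a pres_gen_def)
    then show ?case
      using P.weval_append[OF pres_gen_closed, of "[a]" w] Cons by simp
  qed
qed

lemma presented_group_rel:
  "(u, v) \<in> R \<Longrightarrow>
    weval (presented_group R) (pres_gen R) u = weval (presented_group R) (pres_gen R) v"
  using pres_eq.rel[of u v R "[]" "[]"] by (simp add: weval_pres_gen pres_class_eq_iff)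

lemma presented_group_subgroup_eq:
  assumes "subgroup S (presented_group R)" and "range (pres_gen R) \<subseteq> S"
  shows "S = carrier (presented_group R)"
proof -
  interpret P: group "presented_group R" by (rule group_presented_group)
  interpret S: subgroup S "presented_group R" by (rule assms(1))
  have "weval (presented_group R) (pres_gen R) w \<in> S" for w
    using assms(2) by (induction w) (auto simp: weval_def image_subset_iff)
  then have "pres_class R w \<in> S" for w by (simp add: weval_pres_gen)
  then have "carrier (presented_group R) \<subseteq> S"
    by (auto simp: presented_group_def)
  with S.subset show ?thesis by blast
qed

text \<open>
  Integer powers are computed throughout by guessing a closed form; this is the induction, in both
  directions, that confirms the guess.
\<close>

lemma (in group) int_pow_unique:
  fixes P :: "int \<Rightarrow> 'a"
  assumes "x \<in> carrier G" "\<And>n. P n \<in> carrier G" "P 0 = \<one>" "\<And>n. P (n + 1) = P n \<otimes> x"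
  shows "x [^] n = P n"
proof (induction n rule: int_induct[of _ 0])
  case base
  show ?case by (simp add: assms)
next
  case (step1 i)
  then show ?case by (simp add: int_pow_mult assms)
next
  case (step2 i)
  have "x [^] (i - 1) \<otimes> x = P (i - 1) \<otimes> x"
    using step2 assms(4)[of "i - 1"] int_pow_mult[OF assms(1), of "i - 1" 1] assms(1) by simp
  then show ?case using assms by simp
qed

lemma (in group) inv_mult_cancel [simp]:
  "x \<in> carrier G \<Longrightarrow> y \<in> carrier G \<Longrightarrow> inv x \<otimes> (x \<otimes> y) = y"
  "x \<in> carrier G \<Longrightarrow> y \<in> carrier G \<Longrightarrow> x \<otimes> (inv x \<otimes> y) = y"
  by (simp_all flip: m_assoc)

section \<open>Upper central series and automorphisms\<close>

context group
begin

lemma normal_coset_eq_iff: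
  assumes "M \<lhd> G" "x \<in> carrier G" "y \<in> carrier G"
  shows "M #> x = M #> y \<longleftrightarrow> (\<exists>z\<in>M. x = z \<otimes> y)"
proof -
  interpret M: normal M G by (rule assms(1))
  have "M #> x = M #> y \<longleftrightarrow> x \<in> M #> y"
    using assms(2,3) M.subgroup_axioms repr_independence[of x M y] repr_independenceD[of M y x] rcos_self[of x M]
    by metis
  then show ?thesis by (auto simp: r_coset_def)
qed

lemma center_Mod_iff:
  assumes "M \<lhd> G" "x \<in> carrier G"
  shows "M #> x \<in> center (G Mod M) \<longleftrightarrow> (\<forall>y\<in>carrier G. \<exists>z\<in>M. x \<otimes> y = z \<otimes> (y \<otimes> x))"
proof -
  interpret M: normal M G by (rule assms(1))
  have "M #> x \<in> center (G Mod M) \<longleftrightarrow> (\<forall>y\<in>carrier G. (M #> x) <#> (M #> y) = (M #> y) <#> (M #> x))"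
    using assms(2) by (auto simp: center_def carrier_FactGroup)
  also have "\<dots> \<longleftrightarrow> (\<forall>y\<in>carrier G. M #> (x \<otimes> y) = M #> (y \<otimes> x))"
    using assms(2) by (simp add: M.rcos_sum)
  finally show ?thesis using assms by (simp add: normal_coset_eq_iff)
qed

lemma upper_central_normal: "upper_central G i \<lhd> G"
proof (induction i)
  case 0
  show ?case using one_is_normal by simp
next
  case (Suc i)
  let ?M = "upper_central G i" and ?L = "upper_central G (Suc i)"
  interpret M: normal ?M G by (rule Suc)
  interpret Q: group "G Mod ?M" by (rule M.factorgroup_is_group)
  have L: "x \<in> ?L \<longleftrightarrow> x \<in> carrier G \<and> (\<forall>y\<in>carrier G. ?M #> (x \<otimes> y) = ?M #> (y \<otimes> x))" for x
  proof (cases "x \<in> carrier G")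
    case True
    then show ?thesis by (simp add: center_Mod_iff[OF Suc] normal_coset_eq_iff[OF Suc])
  qed simp
  have com: "\<And>y. y \<in> carrier G \<Longrightarrow> ?M #> (x \<otimes> y) = ?M #> (y \<otimes> x)" and cl: "x \<in> carrier G" if "x \<in> ?L" for x
    using that unfolding L by blast+
  have l: "?M #> (u \<otimes> v) = ?M #> (u \<otimes> w)" if "?M #> v = ?M #> w" "u \<in> carrier G" "v \<in> carrier G" "w \<in> carrier G" for u v w
    using that M.rcos_sum[of u v] M.rcos_sum[of u w] by simp
  have r: "?M #> (v \<otimes> u) = ?M #> (w \<otimes> u)" if "?M #> v = ?M #> w" "u \<in> carrier G" "v \<in> carrier G" "w \<in> carrier G" for u v w
    using that M.rcos_sum[of v u] M.rcos_sum[of w u] by simp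
  have sub: "subgroup ?L G"
  proof
    show "?L \<subseteq> carrier G" using cl by blast
    show "\<one> \<in> ?L" unfolding L by simp
    show "x \<otimes> y \<in> ?L" if x: "x \<in> ?L" and y: "y \<in> ?L" for x y
      unfolding L
    proof (intro conjI ballI)
      show "x \<otimes> y \<in> carrier G" using cl[OF x] cl[OF y] by simp
      fix z assume z: "z \<in> carrier G"
      note c = cl[OF x] cl[OF y] z
      have "?M #> (x \<otimes> (y \<otimes> z)) = ?M #> (x \<otimes> (z \<otimes> y))" using c by (intro l com[OF y]) auto
      also have "\<dots> = ?M #> (x \<otimes> z \<otimes> y)" using c by (simp add: m_assoc)
      also have "\<dots> = ?M #> (z \<otimes> x \<otimes> y)" using c by (intro r com[OF x]) auto
      finally show "?M #> (x \<otimes> y \<otimes> z) = ?M #> (z \<otimes> (x \<otimes> y))" using c by (simp add: m_assoc)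
    qed
    show "inv x \<in> ?L" if x: "x \<in> ?L" for x
      unfolding L
    proof (intro conjI ballI)
      show "inv x \<in> carrier G" using cl[OF x] by simp
      fix z assume z: "z \<in> carrier G"
      note c = cl[OF x] z
      have "?M #> (inv x \<otimes> ((z \<otimes> x) \<otimes> inv x)) = ?M #> (inv x \<otimes> ((x \<otimes> z) \<otimes> inv x))"
        using c by (intro l r com[OF x, symmetric]) auto
      then show "?M #> (inv x \<otimes> z) = ?M #> (z \<otimes> inv x)" using c by (simp add: m_assoc)
    qed
  qed
  show ?case
    unfolding normal_inv_iff
  proof (intro conjI sub ballI)
    fix x n assume x: "x \<in> carrier G" and n: "n \<in> ?L"
    note c = cl[OF n] x
    show "x \<otimes> n \<otimes> inv x \<in> ?L"
      unfolding L
    proof (intro conjI ballI)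
      show "x \<otimes> n \<otimes> inv x \<in> carrier G" using c by simp
      have 1: "?M #> (x \<otimes> n \<otimes> inv x) = ?M #> n"
      proof -
        have "?M #> ((x \<otimes> n) \<otimes> inv x) = ?M #> ((n \<otimes> x) \<otimes> inv x)"
          using c by (intro r com[OF n, symmetric]) auto
        then show ?thesis using c by (simp add: m_assoc)
      qed
      fix z assume z: "z \<in> carrier G"
      have "?M #> (x \<otimes> n \<otimes> inv x \<otimes> z) = ?M #> (n \<otimes> z)" using c z by (intro r 1) auto
      also have "\<dots> = ?M #> (z \<otimes> n)" using com[OF n z] .
      also have "\<dots> = ?M #> (z \<otimes> (x \<otimes> n \<otimes> inv x))" using c z by (intro l 1[symmetric]) auto
      finally show "?M #> (x \<otimes> n \<otimes> inv x \<otimes> z) = ?M #> (z \<otimes> (x \<otimes> n \<otimes> inv x))" .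
    qed
  qed
qed

text \<open>
  Cosets disappear from the definition of the series: \<open>x\<close> lies in the next term if it commutes with
  every element up to a factor in the current one.
\<close>

lemma upper_central_Suc_iff:
  "x \<in> upper_central G (Suc i) \<longleftrightarrow>
     x \<in> carrier G \<and> (\<forall>y\<in>carrier G. \<exists>z\<in>upper_central G i. x \<otimes> y = z \<otimes> (y \<otimes> x))"
  using center_Mod_iff[OF upper_central_normal, of x i] by auto

lemma upper_central_1: "upper_central G 1 = center G"
proof -
  have "x \<in> upper_central G (Suc 0) \<longleftrightarrow> x \<in> center G" for x
    unfolding upper_central_Suc_iff center_def upper_central.simps(1) by auto
  then show ?thesis by auto
qed

lemma center_normal: "center G \<lhd> G"
  using upper_central_normal[of 1] unfolding upper_central_1 .

lemma upper_central_2_iff: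
  "x \<in> upper_central G 2 \<longleftrightarrow> x \<in> carrier G \<and> center G #> x \<in> center (G Mod center G)"
  using upper_central_1 by (simp add: numeral_2_eq_2)

lemma auto_iff:
  "f \<in> auto G \<longleftrightarrow> f \<in> hom G G \<and> f \<in> extensional (carrier G) \<and> bij_betw f (carrier G) (carrier G)"
  by (auto simp: auto_def Bij_def)

lemma auto_hom: "f \<in> auto G \<Longrightarrow> group_hom G G f"
  by (simp add: auto_def group_hom_def group_hom_axioms_def)

lemma auto_closed [simp]: "f \<in> auto G \<Longrightarrow> x \<in> carrier G \<Longrightarrow> f x \<in> carrier G"
  by (meson auto_hom group_hom.hom_closed)

lemma auto_mult: "f \<in> auto G \<Longrightarrow> x \<in> carrier G \<Longrightarrow> y \<in> carrier G \<Longrightarrow> f (x \<otimes> y) = f x \<otimes> f y"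
  by (meson auto_hom group_hom.hom_mult)

lemma auto_surj: "f \<in> auto G \<Longrightarrow> y \<in> carrier G \<Longrightarrow> \<exists>x\<in>carrier G. y = f x"
  unfolding auto_iff bij_betw_def by blast

lemma auto_eqI:
  "f \<in> auto G \<Longrightarrow> g \<in> auto G \<Longrightarrow> (\<And>x. x \<in> carrier G \<Longrightarrow> f x = g x) \<Longrightarrow> f = g"
  unfolding auto_iff by (meson extensionalityI)

lemma AutoGroup_simps [simp]:
  "carrier (AutoGroup G) = auto G"
  "\<one>\<^bsub>AutoGroup G\<^esub> = (\<lambda>x\<in>carrier G. x)"
  by (simp_all add: AutoGroup_def BijGroup_def)

abbreviation auto_prod (infixl "\<star>" 70) where "f \<star> g \<equiv> f \<otimes>\<^bsub>AutoGroup G\<^esub> g"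

lemma AutoGroup_mult:
  "f \<in> auto G \<Longrightarrow> g \<in> auto G \<Longrightarrow> f \<star> g = compose (carrier G) f g"
  by (simp add: AutoGroup_def BijGroup_def auto_def)

lemma AutoGroup_mult_apply:
  "f \<in> auto G \<Longrightarrow> g \<in> auto G \<Longrightarrow> x \<in> carrier G \<Longrightarrow> (f \<star> g) x = f (g x)"
  by (simp add: AutoGroup_mult compose_eq)

lemma AutoGroup_mult_closed: "f \<in> auto G \<Longrightarrow> g \<in> auto G \<Longrightarrow> f \<star> g \<in> auto G"
  using group.is_monoid[OF AutoGroup] monoid.m_closed by fastforce

lemma AutoGroup_inv_closed: "f \<in> auto G \<Longrightarrow> inv\<^bsub>AutoGroup G\<^esub> f \<in> auto G"
  using group.inv_closed[OF AutoGroup] by simp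

lemma AutoGroup_inv_apply:
  assumes "f \<in> auto G" "x \<in> carrier G"
  shows "f ((inv\<^bsub>AutoGroup G\<^esub> f) x) = x" "(inv\<^bsub>AutoGroup G\<^esub> f) (f x) = x"
proof -
  interpret A: group "AutoGroup G" by (rule AutoGroup)
  have "f \<star> inv\<^bsub>AutoGroup G\<^esub> f = (\<lambda>x\<in>carrier G. x)"
    "inv\<^bsub>AutoGroup G\<^esub> f \<star> f = (\<lambda>x\<in>carrier G. x)"
    using assms(1) A.r_inv[of f] A.l_inv[of f] by simp_all
  note inverse = this[THEN fun_cong, of x]
  note inv = AutoGroup_inv_closed[OF assms(1)]
  show "f ((inv\<^bsub>AutoGroup G\<^esub> f) x) = x"
    using inverse(1) AutoGroup_mult_apply[OF assms(1) inv assms(2)] assms(2)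
    by (simp only: restrict_apply if_True)
  show "(inv\<^bsub>AutoGroup G\<^esub> f) (f x) = x"
    using inverse(2) AutoGroup_mult_apply[OF inv assms(1) assms(2)] assms(2)
    by (simp only: restrict_apply if_True)
qed

lemma upper_central_auto:
  assumes f: "f \<in> auto G"
  shows "x \<in> upper_central G i \<Longrightarrow> f x \<in> upper_central G i"
proof (induction i arbitrary: x)
  case 0
  interpret f: group_hom G G f by (rule auto_hom[OF f])
  show ?case using 0 by simp
next
  case (Suc i)
  interpret M: normal "upper_central G i" G by (rule upper_central_normal)
  have x: "x \<in> carrier G" using Suc.prems by (simp add: upper_central_Suc_iff)
  show ?case
    unfolding upper_central_Suc_iff
  proof (intro conjI ballI)
    show "f x \<in> carrier G" using f x by simp
    fix y assume "y \<in> carrier G"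
    then obtain y' where y: "y = f y'" "y' \<in> carrier G" using auto_surj[OF f] by blast
    then obtain z where z: "z \<in> upper_central G i" "x \<otimes> y' = z \<otimes> (y' \<otimes> x)"
      using Suc.prems unfolding upper_central_Suc_iff by blast
    have "f (x \<otimes> y') = f z \<otimes> (f y' \<otimes> f x)"
      unfolding z(2) using f x y(2) M.mem_carrier[OF z(1)] by (simp add: auto_mult)
    then show "\<exists>z\<in>upper_central G i. f x \<otimes> y = z \<otimes> (y \<otimes> f x)"
      using Suc.IH[OF z(1)] f x y by (auto simp: auto_mult)
  qed
qed

lemma upper_central_auto_iff:
  assumes f: "f \<in> auto G" and x: "x \<in> carrier G"
  shows "f x \<in> upper_central G i \<longleftrightarrow> x \<in> upper_central G i"
  using upper_central_auto[OF f] upper_central_auto[OF AutoGroup_inv_closed[OF f], of "f x" i]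
    AutoGroup_inv_apply(2)[OF f x] by auto

lemma image_upper_central_coset:
  assumes f: "f \<in> auto G" and x: "x \<in> carrier G"
  shows "f ` (upper_central G i #> x) = upper_central G i #> f x"
proof -
  interpret M: normal "upper_central G i" G by (rule upper_central_normal)
  have fM: "f ` upper_central G i = upper_central G i"
  proof
    show "f ` upper_central G i \<subseteq> upper_central G i" using upper_central_auto[OF f] by blast
    show "upper_central G i \<subseteq> f ` upper_central G i"
    proof
      fix z assume z: "z \<in> upper_central G i"
      then obtain y where "z = f y" "y \<in> carrier G" using auto_surj[OF f M.mem_carrier] by blast
      then show "z \<in> f ` upper_central G i" using upper_central_auto_iff[OF f] z by blast
    qed
  qed
  have "f ` (upper_central G i #> x) = (\<lambda>z. f z \<otimes> f x) ` upper_central G i"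
    using x f M.mem_carrier by (force simp: r_coset_def auto_mult image_iff)
  also have "\<dots> = (\<lambda>z. z \<otimes> f x) ` (f ` upper_central G i)" by (simp add: image_image)
  finally show ?thesis unfolding fM by (auto simp: r_coset_def)
qed

lemma Aut_central_iff:
  "f \<in> Aut_central i G \<longleftrightarrow>
     f \<in> auto G \<and> (\<forall>x\<in>carrier G. \<exists>z\<in>upper_central G i. f x = z \<otimes> x)"
proof (cases "f \<in> auto G")
  case True
  interpret M: normal "upper_central G i" G by (rule upper_central_normal)
  interpret Q: group "G Mod upper_central G i" by (rule M.factorgroup_is_group)
  have "f \<in> Aut_central i G \<longleftrightarrow>
     (\<lambda>C\<in>carrier (G Mod upper_central G i). f ` C) = (\<lambda>C\<in>carrier (G Mod upper_central G i). C)"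
    using True by (simp add: Aut_central_def kernel_def induced_auto_def Q.AutoGroup_simps)
  also have "\<dots> \<longleftrightarrow> (\<forall>C\<in>carrier (G Mod upper_central G i). f ` C = C)"
    by (auto simp: restrict_def fun_eq_iff)
  also have "\<dots> \<longleftrightarrow> (\<forall>x\<in>carrier G. upper_central G i #> f x = upper_central G i #> x)"
    by (simp add: carrier_FactGroup image_upper_central_coset[OF True])
  also have "\<dots> \<longleftrightarrow> (\<forall>x\<in>carrier G. \<exists>z\<in>upper_central G i. f x = z \<otimes> x)"
    using True by (simp add: normal_coset_eq_iff[OF upper_central_normal])
  finally show ?thesis using True by simp
qed (simp add: Aut_central_def kernel_def)

lemma Aut_central_normal: "Aut_central i G \<lhd> AutoGroup G"
proof -
  interpret A: group "AutoGroup G" by (rule AutoGroup)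
  interpret M: normal "upper_central G i" G by (rule upper_central_normal)
  have cl: "f \<in> auto G" if "f \<in> Aut_central i G" for f using that by (simp add: Aut_central_iff)
  have sub: "subgroup (Aut_central i G) (AutoGroup G)"
  proof
    show "Aut_central i G \<subseteq> carrier (AutoGroup G)" using cl by auto
    show "\<one>\<^bsub>AutoGroup G\<^esub> \<in> Aut_central i G"
      using M.one_closed by (auto simp: Aut_central_iff id_in_auto intro!: bexI[of _ \<one>])
    fix f assume f: "f \<in> Aut_central i G"
    show "f \<star> g \<in> Aut_central i G" if g: "g \<in> Aut_central i G" for g
      unfolding Aut_central_iff
    proof (intro conjI ballI)
      show "f \<star> g \<in> auto G" using f g cl by (simp add: AutoGroup_mult_closed)
      fix x assume x: "x \<in> carrier G"
      obtain z where z: "z \<in> upper_central G i" "g x = z \<otimes> x" using g x by (auto simp: Aut_central_iff)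
      obtain z' where z': "z' \<in> upper_central G i" "f x = z' \<otimes> x" using f x by (auto simp: Aut_central_iff)
      have "(f \<star> g) x = (f z \<otimes> z') \<otimes> x"
        using cl[OF f] cl[OF g] x z z' M.mem_carrier by (simp add: AutoGroup_mult_apply auto_mult m_assoc)
      then show "\<exists>w\<in>upper_central G i. (f \<star> g) x = w \<otimes> x"
        using upper_central_auto[OF cl[OF f] z(1)] z'(1) M.m_closed by blast
    qed
    show "inv\<^bsub>AutoGroup G\<^esub> f \<in> Aut_central i G"
      unfolding Aut_central_iff
    proof (intro conjI ballI)
      show "inv\<^bsub>AutoGroup G\<^esub> f \<in> auto G" by (rule AutoGroup_inv_closed[OF cl[OF f]])
      fix x assume x: "x \<in> carrier G"
      define y where "y = (inv\<^bsub>AutoGroup G\<^esub> f) x"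
      have y: "y \<in> carrier G" "f y = x"
        using x AutoGroup_inv_closed[OF cl[OF f]] AutoGroup_inv_apply[OF cl[OF f] x] by (simp_all add: y_def)
      obtain z where z: "z \<in> upper_central G i" "f y = z \<otimes> y" using f y by (auto simp: Aut_central_iff)
      have "y = inv z \<otimes> x" using y z(2) M.mem_carrier[OF z(1)] by (metis inv_mult_cancel(1))
      then show "\<exists>w\<in>upper_central G i. (inv\<^bsub>AutoGroup G\<^esub> f) x = w \<otimes> x"
        using z(1) M.m_inv_closed unfolding y_def by blast
    qed
  qed
  show ?thesis
    unfolding A.normal_inv_iff
  proof (intro conjI sub ballI)
    fix f g assume f: "f \<in> carrier (AutoGroup G)" and g: "g \<in> Aut_central i G"
    let ?f' = "inv\<^bsub>AutoGroup G\<^esub> f"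
    have f: "f \<in> auto G" using f by simp
    note c = f cl[OF g] AutoGroup_inv_closed[OF f]
    show "f \<star> g \<star> ?f' \<in> Aut_central i G"
      unfolding Aut_central_iff
    proof (intro conjI ballI)
      show "f \<star> g \<star> ?f' \<in> auto G" using c by (simp add: AutoGroup_mult_closed)
      fix x assume x: "x \<in> carrier G"
      have "?f' x \<in> carrier G" using c(3) x by simp
      then obtain z where z: "z \<in> upper_central G i" "g (?f' x) = z \<otimes> ?f' x"
        using g unfolding Aut_central_iff by blast
      have "(f \<star> g \<star> ?f') x = f z \<otimes> x"
        using c x z M.mem_carrier by (simp add: AutoGroup_mult_apply AutoGroup_mult_closed auto_mult AutoGroup_inv_apply)
      then show "\<exists>w\<in>upper_central G i. (f \<star> g \<star> ?f') x = w \<otimes> x"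
        using upper_central_auto[OF f z(1)] by blast
    qed
  qed
qed

definition inner :: "'a \<Rightarrow> 'a \<Rightarrow> 'a" where
  "inner g = (\<lambda>x\<in>carrier G. inv g \<otimes> x \<otimes> g)"

lemma inner_apply: "x \<in> carrier G \<Longrightarrow> inner g x = inv g \<otimes> x \<otimes> g"
  by (simp add: inner_def)

lemma Inn_eq: "Inn G = inner ` carrier G"
  by (simp add: Inn_def inner_def)

lemma inner_auto: "g \<in> carrier G \<Longrightarrow> inner g \<in> auto G"
  unfolding auto_iff
proof (intro conjI)
  assume g: "g \<in> carrier G"
  show "inner g \<in> hom G G"
    by (rule homI) (simp_all add: inner_apply g m_assoc)
  show "inner g \<in> extensional (carrier G)" by (simp add: inner_def)
  show "bij_betw (inner g) (carrier G) (carrier G)"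
    by (rule bij_betw_byWitness[where f' = "inner (inv g)"])
       (use g in \<open>auto simp: inner_apply m_assoc\<close>)
qed

lemma Inn_normal: "Inn G \<lhd> AutoGroup G"
proof -
  interpret A: group "AutoGroup G" by (rule AutoGroup)
  have mult: "inner g \<star> inner g' = inner (g' \<otimes> g)" if "g \<in> carrier G" "g' \<in> carrier G" for g g'
    by (rule auto_eqI)
       (use that in \<open>simp_all add: AutoGroup_mult_closed inner_auto AutoGroup_mult_apply inner_apply inv_mult_group m_assoc\<close>)
  have one: "inner \<one> = \<one>\<^bsub>AutoGroup G\<^esub>"
    by (rule auto_eqI) (simp_all add: inner_auto id_in_auto inner_apply)
  have sub: "subgroup (Inn G) (AutoGroup G)"
  proof
    show "Inn G \<subseteq> carrier (AutoGroup G)" by (auto simp: Inn_eq inner_auto)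
    show "\<one>\<^bsub>AutoGroup G\<^esub> \<in> Inn G" unfolding Inn_eq one[symmetric] by blast
    show "f \<star> g \<in> Inn G" if "f \<in> Inn G" "g \<in> Inn G" for f g
      using that by (auto simp: Inn_eq mult)
    show "inv\<^bsub>AutoGroup G\<^esub> f \<in> Inn G" if f: "f \<in> Inn G" for f
    proof -
      obtain g where g: "f = inner g" "g \<in> carrier G" using f by (auto simp: Inn_eq)
      have "inv\<^bsub>AutoGroup G\<^esub> f = inner (inv g)"
        by (rule A.inv_equality) (use g mult[of "inv g" g] one in \<open>simp_all add: inner_auto\<close>)
      then show ?thesis using g by (simp add: Inn_eq)
    qed
  qed
  show ?thesis
    unfolding A.normal_inv_iff
  proof (intro conjI sub ballI)
    fix f n assume "f \<in> carrier (AutoGroup G)" "n \<in> Inn G"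
    then obtain g where f: "f \<in> auto G" and g: "n = inner g" "g \<in> carrier G" by (auto simp: Inn_eq)
    interpret f: group_hom G G f by (rule auto_hom[OF f])
    have "f \<star> n \<star> inv\<^bsub>AutoGroup G\<^esub> f = inner (f g)"
      by (rule auto_eqI)
         (use f g in \<open>simp_all add: AutoGroup_mult_closed inner_auto AutoGroup_mult_apply inner_apply
            AutoGroup_inv_closed AutoGroup_inv_apply\<close>)
    then show "f \<star> n \<star> inv\<^bsub>AutoGroup G\<^esub> f \<in> Inn G"
      using g f by (simp add: Inn_eq)
  qed
qed

lemma InnAut_normal: "InnAut i G \<lhd> AutoGroup G"
proof -
  interpret A: group "AutoGroup G" by (rule AutoGroup)
  interpret I: normal "Inn G" "AutoGroup G" by (rule Inn_normal)
  interpret C: normal "Aut_central i G" "AutoGroup G" by (rule Aut_central_normal)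
  have "subgroup (InnAut i G) (AutoGroup G)"
    unfolding InnAut_def by (rule A.mult_norm_subgroup[OF Inn_normal C.subgroup_axioms])
  moreover have "x \<star> n \<star> inv\<^bsub>AutoGroup G\<^esub> x \<in> InnAut i G"
    if x: "x \<in> carrier (AutoGroup G)" and n: "n \<in> InnAut i G" for x n
  proof -
    obtain u v where uv: "n = u \<star> v" "u \<in> Inn G" "v \<in> Aut_central i G"
      using n by (auto simp: InnAut_def set_mult_def)
    note c = x I.mem_carrier[OF uv(2)] C.mem_carrier[OF uv(3)]
    let ?c = "\<lambda>y. x \<star> y \<star> inv\<^bsub>AutoGroup G\<^esub> x"
    have "?c n = ?c u \<star> ?c v" unfolding uv(1) using c by (simp add: A.m_assoc del: AutoGroup_simps)
    moreover have "?c u \<in> Inn G" "?c v \<in> Aut_central i G"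
      using Inn_normal Aut_central_normal x uv unfolding A.normal_inv_iff by blast+
    ultimately show ?thesis by (auto simp: InnAut_def set_mult_def)
  qed
  ultimately show ?thesis unfolding A.normal_inv_iff by blast
qed

text \<open>
  An automorphism is in \<open>Inn(G) Aut\<^sub>i(G)\<close> if it agrees with some conjugation up to factors in \<open>Z\<^sub>i\<close>;
  undoing the conjugation leaves a factor in \<open>Z\<^sub>i\<close>, as \<open>Z\<^sub>i\<close> is characteristic.  In this form the
  condition passes easily between \<open>G\<close> and its quotients.
\<close>

lemma InnAut_iff:
  "f \<in> InnAut i G \<longleftrightarrow> f \<in> auto G \<and>
     (\<exists>g\<in>carrier G. \<forall>x\<in>carrier G. \<exists>z\<in>upper_central G i. f x = z \<otimes> (inv g \<otimes> x \<otimes> g))"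
proof
  interpret M: normal "upper_central G i" G by (rule upper_central_normal)
  assume "f \<in> InnAut i G"
  then obtain g t where g: "g \<in> carrier G" and t: "t \<in> Aut_central i G" and f: "f = inner g \<star> t"
    by (auto simp: InnAut_def set_mult_def Inn_eq)
  have ta: "t \<in> auto G" using t by (simp add: Aut_central_iff)
  have "\<exists>z\<in>upper_central G i. f x = z \<otimes> (inv g \<otimes> x \<otimes> g)" if x: "x \<in> carrier G" for x
  proof -
    obtain z where z: "z \<in> upper_central G i" "t x = z \<otimes> x" using t x by (auto simp: Aut_central_iff)
    have "f x = inner g z \<otimes> inner g x"
      using x g ta z M.mem_carrier by (simp add: f AutoGroup_mult_apply inner_auto auto_mult)
    then show ?thesis
      using upper_central_auto[OF inner_auto[OF g] z(1)] x by (auto simp: inner_apply)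
  qed
  then show "f \<in> auto G \<and> (\<exists>g\<in>carrier G. \<forall>x\<in>carrier G. \<exists>z\<in>upper_central G i. f x = z \<otimes> (inv g \<otimes> x \<otimes> g))"
    using f g ta by (auto simp: AutoGroup_mult_closed inner_auto)
next
  interpret M: normal "upper_central G i" G by (rule upper_central_normal)
  interpret A: group "AutoGroup G" by (rule AutoGroup)
  assume "f \<in> auto G \<and> (\<exists>g\<in>carrier G. \<forall>x\<in>carrier G. \<exists>z\<in>upper_central G i. f x = z \<otimes> (inv g \<otimes> x \<otimes> g))"
  then obtain g where f: "f \<in> auto G" and g: "g \<in> carrier G"
    and fg: "\<And>x. x \<in> carrier G \<Longrightarrow> \<exists>z\<in>upper_central G i. f x = z \<otimes> (inv g \<otimes> x \<otimes> g)" by blast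
  let ?i = "inv\<^bsub>AutoGroup G\<^esub> (inner g)"
  define t where "t = ?i \<star> f"
  have ia: "inner g \<in> auto G" "?i \<in> auto G" using g by (simp_all add: inner_auto AutoGroup_inv_closed)
  have "t \<in> Aut_central i G"
    unfolding Aut_central_iff
  proof (intro conjI ballI)
    show "t \<in> auto G" using f ia by (simp add: t_def AutoGroup_mult_closed)
    fix x assume x: "x \<in> carrier G"
    obtain z where z: "z \<in> upper_central G i" "f x = z \<otimes> inner g x"
      using fg[OF x] x by (auto simp: inner_apply)
    have "t x = ?i z \<otimes> x"
      using x z f ia M.mem_carrier by (simp add: t_def AutoGroup_mult_apply auto_mult AutoGroup_inv_apply)
    then show "\<exists>z\<in>upper_central G i. t x = z \<otimes> x" using upper_central_auto[OF ia(2) z(1)] by blast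
  qed
  moreover have "f = inner g \<star> t"
    using f ia A.m_assoc[of "inner g" ?i f] A.r_inv[of "inner g"] A.l_one[of f]
    by (simp add: t_def del: AutoGroup_simps(2))
  ultimately show "f \<in> InnAut i G" using g by (auto simp: InnAut_def set_mult_def Inn_eq)
qed

lemma one_upper_central: "\<one> \<in> upper_central G i"
  by (rule subgroup.one_closed[OF normal_imp_subgroup[OF upper_central_normal]])

lemma inner_InnAut:
  assumes "g \<in> carrier G"
  shows "inner g \<in> InnAut i G"
proof -
  have "inner g x = \<one> \<otimes> (inv g \<otimes> x \<otimes> g)" if "x \<in> carrier G" for x
    using that assms by (simp add: inner_apply)
  then show ?thesis unfolding InnAut_iff using assms one_upper_central inner_auto by blast
qed

lemma Aut_central_InnAut:
  assumes "f \<in> Aut_central i G"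
  shows "f \<in> InnAut i G"
proof -
  have "\<exists>z\<in>upper_central G i. f x = z \<otimes> (inv \<one> \<otimes> x \<otimes> \<one>)" if "x \<in> carrier G" for x
    using assms that unfolding Aut_central_iff by simp
  then show ?thesis using assms unfolding InnAut_iff Aut_central_iff by blast
qed

lemma InnAut_cancel_inner:
  assumes "f \<in> auto G" "g \<in> carrier G" "inner g \<star> f \<in> InnAut i G"
  shows "f \<in> InnAut i G"
proof -
  interpret A: group "AutoGroup G" by (rule AutoGroup)
  interpret I: normal "InnAut i G" "AutoGroup G" by (rule InnAut_normal)
  have "f = inv\<^bsub>AutoGroup G\<^esub> (inner g) \<star> (inner g \<star> f)"
    using assms inner_auto by (simp del: AutoGroup_simps(2))
  then show ?thesis
    using I.m_closed[OF I.m_inv_closed[OF inner_InnAut[OF assms(2)]] assms(3)] by simp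
qed

end

section \<open>Automorphisms induced on the central quotient\<close>

text \<open>
  Two multiplicative maps on the same set with the same fibres have isomorphic images.  The image of
  \<open>\<psi>\<close> is not known beforehand to be a group, which is why this is not phrased with the
  homomorphism theorem.
\<close>

lemma is_iso_common_kernel:
  assumes eq: "\<And>f g. f \<in> S \<Longrightarrow> g \<in> S \<Longrightarrow> \<psi> f = \<psi> g \<longleftrightarrow> \<phi> f = \<phi> g"
    and img: "\<phi> ` S = carrier L"
    and closed: "\<And>f g. f \<in> S \<Longrightarrow> g \<in> S \<Longrightarrow> f \<otimes>\<^bsub>M\<^esub> g \<in> S"
    and \<phi>: "\<And>f g. f \<in> S \<Longrightarrow> g \<in> S \<Longrightarrow> \<phi> (f \<otimes>\<^bsub>M\<^esub> g) = \<phi> f \<otimes>\<^bsub>L\<^esub> \<phi> g"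
    and \<psi>: "\<And>f g. f \<in> S \<Longrightarrow> g \<in> S \<Longrightarrow> \<psi> (f \<otimes>\<^bsub>M\<^esub> g) = \<psi> f \<otimes>\<^bsub>P\<^esub> \<psi> g"
  shows "P \<lparr>carrier := \<psi> ` S\<rparr> \<cong> L"
proof -
  define k where "k y = \<phi> (inv_into S \<psi> y)" for y
  have k: "k (\<psi> f) = \<phi> f" if "f \<in> S" for f
  proof -
    have "inv_into S \<psi> (\<psi> f) \<in> S" "\<psi> (inv_into S \<psi> (\<psi> f)) = \<psi> f"
      using that by (simp_all add: inv_into_into f_inv_into_f)
    then show ?thesis unfolding k_def using eq that by metis
  qed
  have "k \<in> hom (P \<lparr>carrier := \<psi> ` S\<rparr>) L"
  proof (rule homI)
    fix x assume "x \<in> carrier (P \<lparr>carrier := \<psi> ` S\<rparr>)"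
    then show "k x \<in> carrier L" using img by (auto simp: k)
  next
    fix x y assume "x \<in> carrier (P \<lparr>carrier := \<psi> ` S\<rparr>)" "y \<in> carrier (P \<lparr>carrier := \<psi> ` S\<rparr>)"
    then obtain f g where fg: "f \<in> S" "g \<in> S" "x = \<psi> f" "y = \<psi> g" by auto
    then have "x \<otimes>\<^bsub>P\<^esub> y = \<psi> (f \<otimes>\<^bsub>M\<^esub> g)" by (simp add: \<psi>)
    then show "k (x \<otimes>\<^bsub>P \<lparr>carrier := \<psi> ` S\<rparr>\<^esub> y) = k x \<otimes>\<^bsub>L\<^esub> k y"
      using fg by (simp add: k closed \<phi>)
  qed
  moreover have "bij_betw k (\<psi> ` S) (carrier L)"
  proof (rule bij_betwI')
    show "k x = k y \<longleftrightarrow> x = y" if "x \<in> \<psi> ` S" "y \<in> \<psi> ` S" for x y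
      using that eq by (auto simp: k)
    show "k x \<in> carrier L" if "x \<in> \<psi> ` S" for x using that img by (auto simp: k)
    show "\<exists>x\<in>\<psi> ` S. y = k x" if "y \<in> carrier L" for y
      using that img k by (metis imageE imageI)
  qed
  ultimately have "k \<in> iso (P \<lparr>carrier := \<psi> ` S\<rparr>) L" by (simp add: iso_def)
  then show ?thesis by (auto simp: is_iso_def)
qed

context group
begin

abbreviation center_quotient where "center_quotient \<equiv> G Mod center G"
abbreviation on_quotient where "on_quotient \<equiv> induced_auto G (center G)"

lemma group_center_quotient: "group center_quotient"
  using normal.factorgroup_is_group[OF center_normal] .

lemma center_quotient_mult:
  "x \<in> carrier G \<Longrightarrow> y \<in> carrier G \<Longrightarrow>
    (center G #> x) \<otimes>\<^bsub>center_quotient\<^esub> (center G #> y) = center G #> (x \<otimes> y)"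
  using normal.rcos_sum[OF center_normal] by simp

lemma on_quotient_coset:
  "f \<in> auto G \<Longrightarrow> x \<in> carrier G \<Longrightarrow> on_quotient f (center G #> x) = center G #> f x"
  using image_upper_central_coset[of f x 1] unfolding upper_central_1
  by (auto simp: induced_auto_def carrier_FactGroup)

lemma on_quotient_auto:
  assumes f: "f \<in> auto G"
  shows "on_quotient f \<in> auto center_quotient"
proof -
  interpret Q: group center_quotient by (rule group_center_quotient)
  show ?thesis
    unfolding Q.auto_iff
  proof (intro conjI)
    show "on_quotient f \<in> hom center_quotient center_quotient"
    proof (rule homI)
      fix U V assume "U \<in> carrier center_quotient" "V \<in> carrier center_quotient"
      then obtain x y where xy: "U = center G #> x" "V = center G #> y" "x \<in> carrier G" "y \<in> carrier G"
        by (auto simp: carrier_FactGroup)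
      show "on_quotient f U \<in> carrier center_quotient"
        using xy f by (simp add: on_quotient_coset carrier_FactGroup)
      show "on_quotient f (U \<otimes>\<^bsub>center_quotient\<^esub> V)
          = on_quotient f U \<otimes>\<^bsub>center_quotient\<^esub> on_quotient f V"
        unfolding xy(1,2) using xy f
        by (simp add: center_quotient_mult on_quotient_coset auto_mult del: mult_FactGroup)
    qed
    show "on_quotient f \<in> extensional (carrier center_quotient)"
      by (simp add: induced_auto_def)
    show "bij_betw (on_quotient f) (carrier center_quotient) (carrier center_quotient)"
      by (rule bij_betw_byWitness[where f' = "on_quotient (inv\<^bsub>AutoGroup G\<^esub> f)"])
         (use f in \<open>auto simp: carrier_FactGroup on_quotient_coset AutoGroup_inv_closed AutoGroup_inv_apply\<close>)
  qed
qed

lemma on_quotient_mult: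
  assumes "f \<in> auto G" "g \<in> auto G"
  shows "on_quotient (f \<star> g)
     = on_quotient f \<otimes>\<^bsub>AutoGroup center_quotient\<^esub> on_quotient g"
proof -
  interpret Q: group center_quotient by (rule group_center_quotient)
  show ?thesis
    by (rule Q.auto_eqI)
       (use assms in \<open>auto simp: on_quotient_auto AutoGroup_mult_closed Q.AutoGroup_mult_closed
          Q.AutoGroup_mult_apply carrier_FactGroup on_quotient_coset AutoGroup_mult_apply\<close>)
qed

text \<open>
  The reason is \<open>Z\<^sub>1(G / Z\<^sub>1) = Z\<^sub>2 / Z\<^sub>1\<close>: a factor in the centre of \<open>G / Z\<^sub>1\<close> lifts to a factor in \<open>Z\<^sub>2\<close>,
  and the ambiguity in \<open>Z\<^sub>1\<close> of an equation between cosets is absorbed by that factor.  This is the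
  injectivity of the map induced by \<open>Aut(G) \<rightarrow> Aut(G / Z\<^sub>1)\<close>.
\<close>

lemma on_quotient_InnAut_iff:
  assumes f: "f \<in> auto G"
  shows "on_quotient f \<in> InnAut 1 center_quotient \<longleftrightarrow> f \<in> InnAut 2 G"
proof -
  interpret Q: group center_quotient by (rule group_center_quotient)
  interpret Z: normal "center G" G by (rule center_normal)
  have coset: "(\<exists>Y\<in>center center_quotient. center G #> u = Y \<otimes>\<^bsub>center_quotient\<^esub> (center G #> v))
      \<longleftrightarrow> (\<exists>z\<in>upper_central G 2. u = z \<otimes> v)" (is "?L \<longleftrightarrow> ?R")
    if uv: "u \<in> carrier G" "v \<in> carrier G" for u v
  proof
    assume ?L
    then obtain Y where Y: "Y \<in> center center_quotient"
      "center G #> u = Y \<otimes>\<^bsub>center_quotient\<^esub> (center G #> v)" by blast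
    then obtain y where y: "Y = center G #> y" "y \<in> carrier G"
      by (auto simp: center_def[of center_quotient] carrier_FactGroup)
    have "center G #> u = center G #> (y \<otimes> v)"
      using Y(2) y uv by (simp only: y center_quotient_mult)
    then obtain z where z: "z \<in> center G" "u = z \<otimes> (y \<otimes> v)"
      using normal_coset_eq_iff[OF center_normal, of u "y \<otimes> v"] uv y by auto
    have zc: "z \<in> carrier G" using z(1) by (rule Z.mem_carrier)
    have "center G #> (z \<otimes> y) = Y"
      unfolding y(1) using normal_coset_eq_iff[OF center_normal, of "z \<otimes> y" y] z zc y by auto
    then have "z \<otimes> y \<in> upper_central G 2"
      using Y(1) zc y by (simp add: upper_central_2_iff)
    moreover have "u = z \<otimes> y \<otimes> v" using z zc y uv by (simp add: m_assoc)
    ultimately show ?R by blast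
  next
    assume ?R
    then obtain z where z: "z \<in> upper_central G 2" "u = z \<otimes> v" by blast
    then have "center G #> u = (center G #> z) \<otimes>\<^bsub>center_quotient\<^esub> (center G #> v)"
      using uv by (simp add: center_quotient_mult upper_central_2_iff del: mult_FactGroup)
    then show ?L using z(1) by (auto simp: upper_central_2_iff)
  qed
  have conj: "inv\<^bsub>center_quotient\<^esub> (center G #> g) \<otimes>\<^bsub>center_quotient\<^esub> (center G #> x)
      \<otimes>\<^bsub>center_quotient\<^esub> (center G #> g) = center G #> (inv g \<otimes> x \<otimes> g)"
    if "g \<in> carrier G" "x \<in> carrier G" for g x
    using that by (simp add: Z.inv_FactGroup carrier_FactGroup Z.rcos_inv center_quotient_mult del: mult_FactGroup)
  have "on_quotient f \<in> InnAut 1 center_quotient \<longleftrightarrow>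
    (\<exists>g\<in>carrier G. \<forall>x\<in>carrier G. \<exists>Y\<in>center center_quotient.
       center G #> f x = Y \<otimes>\<^bsub>center_quotient\<^esub> (center G #> (inv g \<otimes> x \<otimes> g)))"
    unfolding Q.InnAut_iff Q.upper_central_1
    using f by (simp add: on_quotient_auto carrier_FactGroup on_quotient_coset conj del: mult_FactGroup)
  also have "\<dots> \<longleftrightarrow> (\<exists>g\<in>carrier G. \<forall>x\<in>carrier G. \<exists>z\<in>upper_central G 2. f x = z \<otimes> (inv g \<otimes> x \<otimes> g))"
    using f by (simp add: coset del: mult_FactGroup)
  also have "\<dots> \<longleftrightarrow> f \<in> InnAut 2 G" using f by (simp add: InnAut_iff)
  finally show ?thesis .
qed

definition quotient_class where
  "quotient_class f = InnAut 1 center_quotient #>\<^bsub>AutoGroup center_quotient\<^esub> on_quotient f"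

lemma InnAut_coset_eq_iff:
  assumes "f \<in> auto G" "g \<in> auto G"
  shows "InnAut i G #>\<^bsub>AutoGroup G\<^esub> f = InnAut i G #>\<^bsub>AutoGroup G\<^esub> g
     \<longleftrightarrow> f \<star> inv\<^bsub>AutoGroup G\<^esub> g \<in> InnAut i G"
proof -
  interpret A: group "AutoGroup G" by (rule AutoGroup)
  have fg: "f \<in> carrier (AutoGroup G)" "g \<in> carrier (AutoGroup G)" using assms by simp_all
  interpret I: normal "InnAut i G" "AutoGroup G" by (rule InnAut_normal)
  have "(\<exists>z\<in>InnAut i G. f = z \<star> g) \<longleftrightarrow> f \<star> inv\<^bsub>AutoGroup G\<^esub> g \<in> InnAut i G"
    using fg by (metis A.inv_solve_right A.inv_closed A.m_closed I.mem_carrier)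
  then show ?thesis using A.normal_coset_eq_iff[OF InnAut_normal fg] by simp
qed

lemma quotient_class_mult:
  assumes "f \<in> auto G" "g \<in> auto G"
  shows "quotient_class (f \<star> g)
     = quotient_class f \<otimes>\<^bsub>OutQuot 1 center_quotient\<^esub> quotient_class g"
proof -
  interpret Q: group center_quotient by (rule group_center_quotient)
  interpret I: normal "InnAut 1 center_quotient" "AutoGroup center_quotient" by (rule Q.InnAut_normal)
  have "quotient_class f <#>\<^bsub>AutoGroup center_quotient\<^esub> quotient_class g
     = quotient_class (f \<star> g)"
    using I.rcos_sum[of "on_quotient f" "on_quotient g"] assms
    by (simp add: quotient_class_def on_quotient_mult on_quotient_auto Q.AutoGroup_simps)
  then show ?thesis by (simp add: OutQuot_def set_mult_def)
qed

lemma quotient_class_eq_iff: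
  assumes "f \<in> auto G" "g \<in> auto G"
  shows "quotient_class f = quotient_class g \<longleftrightarrow>
     InnAut 2 G #>\<^bsub>AutoGroup G\<^esub> f = InnAut 2 G #>\<^bsub>AutoGroup G\<^esub> g"
proof -
  interpret Q: group center_quotient by (rule group_center_quotient)
  interpret A: group "AutoGroup G" by (rule AutoGroup)
  interpret AQ: group "AutoGroup center_quotient" by (rule Q.AutoGroup)
  have one: "on_quotient \<one>\<^bsub>AutoGroup G\<^esub> = \<one>\<^bsub>AutoGroup center_quotient\<^esub>"
  proof (rule Q.auto_eqI)
    show "on_quotient \<one>\<^bsub>AutoGroup G\<^esub> \<in> auto center_quotient"
      by (simp add: on_quotient_auto id_in_auto)
    show "\<one>\<^bsub>AutoGroup center_quotient\<^esub> \<in> auto center_quotient"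
      unfolding Q.AutoGroup_simps by (rule Q.id_in_auto)
    fix x assume "x \<in> carrier center_quotient"
    then show "on_quotient \<one>\<^bsub>AutoGroup G\<^esub> x = \<one>\<^bsub>AutoGroup center_quotient\<^esub> x"
      using id_in_auto unfolding Q.AutoGroup_simps by (auto simp: carrier_FactGroup on_quotient_coset)
  qed
  have "on_quotient (inv\<^bsub>AutoGroup G\<^esub> g) \<otimes>\<^bsub>AutoGroup center_quotient\<^esub> on_quotient g
      = \<one>\<^bsub>AutoGroup center_quotient\<^esub>"
    unfolding one[symmetric] using assms A.l_inv[of g]
    by (simp add: AutoGroup_inv_closed del: AutoGroup_simps(2) flip: on_quotient_mult)
  then have "on_quotient (inv\<^bsub>AutoGroup G\<^esub> g) = inv\<^bsub>AutoGroup center_quotient\<^esub> on_quotient g"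
    using assms by (intro AQ.inv_equality[symmetric]) (simp_all add: on_quotient_auto AutoGroup_inv_closed Q.AutoGroup_simps)
  then have "on_quotient f \<otimes>\<^bsub>AutoGroup center_quotient\<^esub> inv\<^bsub>AutoGroup center_quotient\<^esub> on_quotient g
     = on_quotient (f \<star> inv\<^bsub>AutoGroup G\<^esub> g)"
    using assms by (simp add: on_quotient_mult AutoGroup_inv_closed)
  then show ?thesis
    unfolding quotient_class_def
    using assms Q.InnAut_coset_eq_iff[of "on_quotient f" "on_quotient g" 1]
      on_quotient_InnAut_iff[of "f \<star> inv\<^bsub>AutoGroup G\<^esub> g"]
    by (simp add: InnAut_coset_eq_iff on_quotient_auto AutoGroup_mult_closed AutoGroup_inv_closed)
qed

text \<open>
  All representatives of a coset of \<open>Inn(G) Aut\<^sub>2(G)\<close> give the same class, so that the map induced on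
  cosets, which is defined by picking the common value, is well defined.
\<close>

lemma quotient_class_image:
  assumes f: "f \<in> auto G"
  shows "quotient_class ` (InnAut 2 G #>\<^bsub>AutoGroup G\<^esub> f) = {quotient_class f}"
proof -
  interpret A: group "AutoGroup G" by (rule AutoGroup)
  interpret I: normal "InnAut 2 G" "AutoGroup G" by (rule InnAut_normal)
  have "quotient_class g = quotient_class f" if "g \<in> InnAut 2 G #>\<^bsub>AutoGroup G\<^esub> f" for g
  proof -
    have "g \<in> auto G"
      using that f I.subset A.r_coset_subset_G[of "InnAut 2 G" f] by auto
    moreover have "InnAut 2 G #>\<^bsub>AutoGroup G\<^esub> g = InnAut 2 G #>\<^bsub>AutoGroup G\<^esub> f"
      using A.repr_independence[OF that] f I.subgroup_axioms by simp
    ultimately show ?thesis using f by (simp add: quotient_class_eq_iff)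
  qed
  moreover have "f \<in> InnAut 2 G #>\<^bsub>AutoGroup G\<^esub> f"
    using A.rcos_self[OF _ I.subgroup_axioms] f by simp
  ultimately show ?thesis by blast
qed

text \<open>
  The formal part of the result.  All that is asked of the group is a homomorphism \<open>\<phi>\<close> from \<open>Aut\<^sub>3(G)\<close>
  to the Klein group with kernel \<open>Inn(G) Aut\<^sub>2(G)\<close> and two automorphisms hitting its generators.
  The four products of these represent all cosets, and the class in \<open>Aut(G / Z\<^sub>1)\<close> has the same
  fibres as \<open>\<phi>\<close> because both are governed by \<open>Inn(G) Aut\<^sub>2(G)\<close>.
\<close>

theorem Aut3_Klein:
  fixes \<phi> :: "('a \<Rightarrow> 'a) \<Rightarrow> int \<times> int"
  defines "V \<equiv> integer_mod_group 2 \<times>\<times> integer_mod_group 2"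
  assumes range: "\<And>f. f \<in> Aut_central 3 G \<Longrightarrow> \<phi> f \<in> carrier V"
    and mult: "\<And>f g. f \<in> Aut_central 3 G \<Longrightarrow> g \<in> Aut_central 3 G \<Longrightarrow>
        \<phi> (f \<star> g) = \<phi> f \<otimes>\<^bsub>V\<^esub> \<phi> g"
    and kernel: "\<And>f. f \<in> Aut_central 3 G \<Longrightarrow> \<phi> f = (0, 0) \<longleftrightarrow> f \<in> InnAut 2 G"
    and sub: "InnAut 2 G \<subseteq> Aut_central 3 G"
    and gens: "x \<in> Aut_central 3 G" "y \<in> Aut_central 3 G" "\<phi> x = (1, 0)" "\<phi> y = (0, 1)"
  shows "carrier (OutQuot 2 G) =
       generate (OutQuot 2 G) {InnAut 2 G #>\<^bsub>AutoGroup G\<^esub> x, InnAut 2 G #>\<^bsub>AutoGroup G\<^esub> y}"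
    and "(OutQuot 1 center_quotient) \<lparr>carrier :=
         (\<lambda>C. the_elem (quotient_class ` C)) ` carrier (OutQuot 2 G)\<rparr> \<cong> V"
    and "card (Aut_central 3 G) = 4 * card (InnAut 2 G)"
    and "Aut_central 3 G = InnAut 2 G <#>\<^bsub>AutoGroup G\<^esub> generate (AutoGroup G) {x, y}"
proof -
  let ?S = "Aut_central 3 G" and ?I = "InnAut 2 G" and ?A = "AutoGroup G"
  let ?M = "?A \<lparr>carrier := ?S\<rparr>"
  define bar where "bar f = ?I #>\<^bsub>?A\<^esub> f" for f
  interpret A: group ?A by (rule AutoGroup)
  interpret S: normal ?S ?A by (rule Aut_central_normal)
  interpret I: normal ?I ?A by (rule InnAut_normal)
  interpret M: group ?M by (rule S.subgroup_is_group[OF A.group_axioms])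
  have IM: "?I \<lhd> ?M"
    by (rule A.normal_restrict_supergroup[OF S.subgroup_axioms InnAut_normal sub])
  interpret Q: group "OutQuot 2 G"
    unfolding OutQuot_def using normal.factorgroup_is_group[OF IM] by (simp add: numeral_3_eq_3 numeral_2_eq_2)
  have V: "carrier V = {0..<2} \<times> {0..<2}"
    "\<And>u v. u \<otimes>\<^bsub>V\<^esub> v = ((fst u + fst v) mod 2, (snd u + snd v) mod 2)"
    by (auto simp: V_def carrier_integer_mod_group DirProd_def split: prod.splits)
  have aut: "f \<in> auto G" if "f \<in> ?S" for f using S.mem_carrier[OF that] by simp
  have carrier_Q: "carrier (OutQuot 2 G) = bar ` ?S"
    by (auto simp: OutQuot_def carrier_FactGroup bar_def r_coset_def numeral_3_eq_3 numeral_2_eq_2)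
  have mult_Q: "bar (f \<otimes>\<^bsub>?A\<^esub> g) = bar f \<otimes>\<^bsub>OutQuot 2 G\<^esub> bar g" if "f \<in> ?S" "g \<in> ?S" for f g
    using I.rcos_sum[of f g] that aut by (simp add: bar_def OutQuot_def set_mult_def)
  have one_Q: "bar \<one>\<^bsub>?A\<^esub> = \<one>\<^bsub>OutQuot 2 G\<^esub>"
    using I.subset by (simp add: bar_def OutQuot_def A.coset_mult_one del: AutoGroup_simps)
  have \<phi>_inv: "\<phi> (f \<otimes>\<^bsub>?A\<^esub> inv\<^bsub>?A\<^esub> g) = (0, 0) \<longleftrightarrow> \<phi> f = \<phi> g" if "f \<in> ?S" "g \<in> ?S" for f g
  proof -
    have g': "inv\<^bsub>?A\<^esub> g \<in> ?S" using that by simp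
    have p: "f \<otimes>\<^bsub>?A\<^esub> inv\<^bsub>?A\<^esub> g \<in> ?S" using that g' by simp
    have "f = (f \<otimes>\<^bsub>?A\<^esub> inv\<^bsub>?A\<^esub> g) \<otimes>\<^bsub>?A\<^esub> g"
      using that S.mem_carrier by (simp add: A.m_assoc del: AutoGroup_simps)
    then have "\<phi> f = \<phi> (f \<otimes>\<^bsub>?A\<^esub> inv\<^bsub>?A\<^esub> g) \<otimes>\<^bsub>V\<^esub> \<phi> g" using mult[OF p that(2)] by simp
    then show ?thesis
      using range[OF that(1)] range[OF that(2)] range[OF p]
      by (cases "\<phi> f"; cases "\<phi> g"; cases "\<phi> (f \<otimes>\<^bsub>?A\<^esub> inv\<^bsub>?A\<^esub> g)") (auto simp: V; presburger)
  qed
  have bar_eq: "bar f = bar g \<longleftrightarrow> \<phi> f = \<phi> g" if "f \<in> ?S" "g \<in> ?S" for f g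
    using that \<phi>_inv[OF that] kernel[of "f \<otimes>\<^bsub>?A\<^esub> inv\<^bsub>?A\<^esub> g"] aut
    by (simp add: bar_def InnAut_coset_eq_iff)
  have rep: "\<exists>g\<in>{\<one>\<^bsub>?A\<^esub>, x, y, x \<otimes>\<^bsub>?A\<^esub> y}. \<phi> g = v" if "v \<in> carrier V" for v
  proof -
    have "\<phi> \<one>\<^bsub>?A\<^esub> = (0, 0)" using kernel[OF S.one_closed] I.one_closed by blast
    moreover have "\<phi> (x \<otimes>\<^bsub>?A\<^esub> y) = (1, 1)" using mult[OF gens(1,2)] gens(3,4) by (simp add: V)
    moreover have "v = (0, 0) \<or> v = (1, 0) \<or> v = (0, 1) \<or> v = (1, 1)" using that by (auto simp: V)
    ultimately show ?thesis using gens(3,4) by blast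
  qed
  have four: "{\<one>\<^bsub>?A\<^esub>, x, y, x \<otimes>\<^bsub>?A\<^esub> y} \<subseteq> ?S" using gens(1,2) S.one_closed S.m_closed by blast
  have img: "\<phi> ` ?S = carrier V"
    using range rep four by blast
  show "carrier (OutQuot 2 G) = generate (OutQuot 2 G) {?I #>\<^bsub>?A\<^esub> x, ?I #>\<^bsub>?A\<^esub> y}"
  proof
    let ?g = "generate (OutQuot 2 G) {bar x, bar y}"
    have g: "bar x \<in> ?g" "bar y \<in> ?g" by (auto intro: generate.incl)
    then have "bar (x \<otimes>\<^bsub>?A\<^esub> y) \<in> ?g" unfolding mult_Q[OF gens(1,2)] by (rule generate.eng)
    moreover have "bar \<one>\<^bsub>?A\<^esub> \<in> ?g" unfolding one_Q by (rule generate.one)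
    ultimately have all: "bar g \<in> ?g" if "g \<in> {\<one>\<^bsub>?A\<^esub>, x, y, x \<otimes>\<^bsub>?A\<^esub> y}" for g using that g by blast
    have "bar f \<in> ?g" if f: "f \<in> ?S" for f
    proof -
      obtain g where "g \<in> {\<one>\<^bsub>?A\<^esub>, x, y, x \<otimes>\<^bsub>?A\<^esub> y}" "\<phi> g = \<phi> f" using rep[OF range[OF f]] by blast
      then show ?thesis using bar_eq[OF f, of g] four all[of g] by auto
    qed
    then show "carrier (OutQuot 2 G) \<subseteq> generate (OutQuot 2 G) {?I #>\<^bsub>?A\<^esub> x, ?I #>\<^bsub>?A\<^esub> y}"
      unfolding carrier_Q bar_def by blast
    show "generate (OutQuot 2 G) {?I #>\<^bsub>?A\<^esub> x, ?I #>\<^bsub>?A\<^esub> y} \<subseteq> carrier (OutQuot 2 G)"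
      by (rule Q.generate_incl) (use gens carrier_Q in \<open>auto simp: bar_def\<close>)
  qed
  have "(\<lambda>C. the_elem (quotient_class ` C)) ` carrier (OutQuot 2 G) = quotient_class ` ?S"
    unfolding carrier_Q image_image using aut by (auto simp: bar_def quotient_class_image)
  moreover have "(OutQuot 1 center_quotient) \<lparr>carrier := quotient_class ` ?S\<rparr> \<cong> V"
  proof (rule is_iso_common_kernel[where \<phi> = \<phi> and M = ?A])
    show "quotient_class f = quotient_class g \<longleftrightarrow> \<phi> f = \<phi> g" if "f \<in> ?S" "g \<in> ?S" for f g
      using bar_eq[OF that] quotient_class_eq_iff[OF aut aut, OF that] by (simp add: bar_def)
  qed (use img mult aut in \<open>auto simp: quotient_class_mult\<close>)
  ultimately show "(OutQuot 1 center_quotient) \<lparr>carrier :=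
         (\<lambda>C. the_elem (quotient_class ` C)) ` carrier (OutQuot 2 G)\<rparr> \<cong> V" by simp
  have "(OutQuot 2 G) \<lparr>carrier := bar ` ?S\<rparr> \<cong> V"
    by (rule is_iso_common_kernel[where \<phi> = \<phi> and M = ?A])
       (use img mult aut bar_eq in \<open>auto simp: mult_Q\<close>)
  then have "card (carrier (OutQuot 2 G)) = card (carrier V)"
    unfolding is_iso_def iso_def carrier_Q[symmetric] by (auto dest: bij_betw_same_card)
  also have "\<dots> = 4" by (simp add: V)
  finally have "card (carrier (OutQuot 2 G)) = 4" .
  moreover have "carrier (OutQuot 2 G) = rcosets\<^bsub>?M\<^esub> ?I"
    by (simp add: OutQuot_def FactGroup_def numeral_3_eq_3 numeral_2_eq_2)
  moreover have "card (rcosets\<^bsub>?M\<^esub> ?I) * card ?I = order ?M"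
    by (rule M.lagrange) (rule normal_imp_subgroup[OF IM])
  ultimately show "card ?S = 4 * card ?I" by (simp add: order_def)
  show "?S = ?I <#>\<^bsub>?A\<^esub> generate ?A {x, y}"
  proof
    have "generate ?A {x, y} \<subseteq> ?S"
      by (rule A.generate_subgroup_incl[OF _ S.subgroup_axioms]) (use gens in blast)
    then show "?I <#>\<^bsub>?A\<^esub> generate ?A {x, y} \<subseteq> ?S"
      using sub by (auto simp: set_mult_def)
    show "?S \<subseteq> ?I <#>\<^bsub>?A\<^esub> generate ?A {x, y}"
    proof
      fix f assume f: "f \<in> ?S"
      obtain g where g: "g \<in> {\<one>\<^bsub>?A\<^esub>, x, y, x \<otimes>\<^bsub>?A\<^esub> y}" "\<phi> g = \<phi> f" using rep[OF range[OF f]] by blast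
      have gS: "g \<in> ?S" using g(1) four by blast
      have "g \<in> generate ?A {x, y}"
        using g(1) generate.incl[of x "{x, y}" ?A] generate.incl[of y "{x, y}" ?A]
          generate.eng[of x ?A "{x, y}" y] generate.one[of ?A "{x, y}"] by blast
      moreover have "f \<otimes>\<^bsub>?A\<^esub> inv\<^bsub>?A\<^esub> g \<in> ?I"
        using \<phi>_inv[OF f gS] kernel[of "f \<otimes>\<^bsub>?A\<^esub> inv\<^bsub>?A\<^esub> g"] f gS g(2) by simp
      moreover have "f = (f \<otimes>\<^bsub>?A\<^esub> inv\<^bsub>?A\<^esub> g) \<otimes>\<^bsub>?A\<^esub> g"
        using f gS S.mem_carrier by (simp add: A.m_assoc del: AutoGroup_simps)
      ultimately show "f \<in> ?I <#>\<^bsub>?A\<^esub> generate ?A {x, y}" unfolding set_mult_def by blast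
    qed
  qed
qed

end

section \<open>Collection in a group with the relations\<close>

text \<open>
  The defining relations of \<open>H\<close>, with \<open>\<alpha> = 1 + 2 h\<close> and with the commutator \<open>c = [a, b]\<close> named, so
  that no inverses occur.  The condition \<open>N dvd 2 * h * h\<close> makes the powers of \<open>\<alpha>\<close> linear in
  the exponent: \<open>\<alpha>\<^sup>k = 1 + 2 h k\<close> modulo \<open>N\<close>.
\<close>

locale rel_pair = group +
  fixes h N :: int and a b c :: 'a
  assumes ac [simp]: "a \<in> carrier G" "b \<in> carrier G" "c \<in> carrier G"
    and ab: "a \<otimes> b = b \<otimes> a \<otimes> c"
    and a_c: "a \<otimes> c = c \<otimes> a [^] (1 + 2 * h)"
    and c_b: "c \<otimes> b = b [^] (1 + 2 * h) \<otimes> c"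
    and aN: "a [^] N = \<one>" and bN: "b [^] N = \<one>"
    and N: "N > 0" "N dvd 2 * h * h"
begin

lemma pow_cong:
  assumes "x \<in> carrier G" "x [^] N = \<one>" "N dvd i - j"
  shows "x [^] i = x [^] j"
proof -
  obtain t where "i = j + N * t" using assms(3) by (metis diff_eq_eq add.commute dvdE)
  then have "x [^] i = x [^] j \<otimes> (x [^] N) [^] t"
    using assms(1) by (simp add: int_pow_mult int_pow_pow)
  then show ?thesis using assms by simp
qed

text \<open>
  Iterating \<open>x \<mapsto> x\<^sup>1\<^sup>+\<^sup>2\<^sup>t\<close> multiplies the coefficient of \<open>t\<close> by the number of steps, since
  \<open>4 t\<^sup>2\<close> vanishes modulo the order of \<open>x\<close>; for the same reason \<open>1 - 2 t\<close> inverts \<open>1 + 2 t\<close>.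
\<close>

lemma scaled_commute:
  assumes xz: "x \<in> carrier G" "z \<in> carrier G" "x [^] N = \<one>"
    and r: "z \<otimes> x = x [^] (1 + 2 * t) \<otimes> z" and t: "N dvd 2 * t * t"
  shows "z [^] (k::int) \<otimes> x [^] (n::int) = x [^] (n * (1 + 2 * t * k)) \<otimes> z [^] k"
proof -
  have zn: "z \<otimes> x [^] n \<otimes> inv z = x [^] (n * (1 + 2 * t))" for n :: int
  proof -
    have "x [^] (1 + 2 * t) = z \<otimes> x \<otimes> inv z"
      using r xz by (metis inv_solve_right int_pow_closed m_closed)
    moreover have "(z \<otimes> x \<otimes> inv z) [^] n = z \<otimes> x [^] n \<otimes> inv z"
      by (rule int_pow_unique) (use xz in \<open>simp_all add: int_pow_mult m_assoc\<close>)
    moreover have "x [^] (n * (1 + 2 * t)) = (x [^] (1 + 2 * t)) [^] n"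
      using xz(1) by (simp add: int_pow_pow mult.commute)
    ultimately show ?thesis by simp
  qed
  have up: "z \<otimes> x [^] n = x [^] (n * (1 + 2 * t)) \<otimes> z" for n :: int
    using zn[of n] xz by (metis inv_solve_right' int_pow_closed m_closed)
  have tt: "N dvd 2 * t * t * w" for w using t by (rule dvd_mult2)
  have down: "inv z \<otimes> x [^] n = x [^] (n * (1 - 2 * t)) \<otimes> inv z" for n :: int
  proof -
    have "z \<otimes> x [^] (n * (1 - 2 * t)) = x [^] (n * (1 - 2 * t) * (1 + 2 * t)) \<otimes> z"
      by (rule up)
    also have "x [^] (n * (1 - 2 * t) * (1 + 2 * t)) = x [^] n"
      using tt[of "- 2 * n"] by (intro pow_cong xz) (simp add: algebra_simps)
    finally show ?thesis using xz
      by (metis inv_solve_left inv_solve_right int_pow_closed m_assoc m_closed inv_closed)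
  qed
  have cg: "x [^] (n * (1 + 2 * t * e) * (1 + 2 * t * k)) = x [^] (n * (1 + 2 * t * (k + e)))" for n k e :: int
    using tt[of "2 * n * k * e"] by (intro pow_cong xz) (simp add: algebra_simps)
  show ?thesis
  proof (induction k arbitrary: n rule: int_induct[of _ 0])
    case base
    show ?case using xz by simp
  next
    case (step1 k)
    have "z [^] (k + 1) \<otimes> x [^] n = z [^] k \<otimes> (z \<otimes> x [^] n)"
      using xz by (simp add: int_pow_mult m_assoc)
    also have "\<dots> = z [^] k \<otimes> x [^] (n * (1 + 2 * t * 1)) \<otimes> z"
      using xz by (simp add: up m_assoc)
    also have "\<dots> = x [^] (n * (1 + 2 * t * (k + 1))) \<otimes> z [^] (k + 1)"
      using xz by (simp only: step1 cg) (simp add: int_pow_mult m_assoc)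
    finally show ?case .
  next
    case (step2 k)
    have zk: "z [^] (k - 1) = z [^] k \<otimes> inv z"
      using xz int_pow_mult[of z k "-1"] by (simp add: int_pow_neg)
    have "z [^] (k - 1) \<otimes> x [^] n = z [^] k \<otimes> (inv z \<otimes> x [^] n)"
      using xz by (simp add: zk m_assoc)
    also have "\<dots> = z [^] k \<otimes> x [^] (n * (1 + 2 * t * (-1))) \<otimes> inv z"
      using xz by (simp add: down m_assoc)
    also have "\<dots> = x [^] (n * (1 + 2 * t * (k + (-1)))) \<otimes> z [^] (k - 1)"
      using xz by (simp only: step2 cg zk) (simp add: m_assoc)
    finally show ?case by simp
  qed
qed

lemma cb: "c [^] (k::int) \<otimes> b [^] (n::int) = b [^] (n * (1 + 2 * h * k)) \<otimes> c [^] k"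
  by (rule scaled_commute) (simp_all add: bN c_b N)

lemma ca: "c [^] (k::int) \<otimes> a [^] (n::int) = a [^] (n * (1 - 2 * h * k)) \<otimes> c [^] k"
proof -
  have "inv c \<otimes> a = a [^] (1 + 2 * h) \<otimes> inv c"
    using a_c by (metis ac inv_solve_left inv_solve_right int_pow_closed m_assoc m_closed inv_closed)
  from scaled_commute[OF _ _ aN this N(2), of "- k" n]
  show ?thesis by (simp add: int_pow_inv int_pow_neg)
qed

lemma conj_int_pow:
  assumes "x \<in> carrier G" "y \<in> carrier G" "z \<in> carrier G" "x \<otimes> z = z \<otimes> y"
  shows "x [^] (n::int) \<otimes> z = z \<otimes> y [^] n"
proof -
  have y: "y = inv z \<otimes> x \<otimes> z" using assms by (metis inv_solve_left m_assoc inv_closed m_closed)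
  have "y [^] n = inv z \<otimes> x [^] n \<otimes> z"
    unfolding y by (rule int_pow_unique) (use assms in \<open>simp_all add: int_pow_mult m_assoc\<close>)
  then show ?thesis using assms by (simp add: m_assoc)
qed

text \<open>
  Conjugation by \<open>b\<close> sends \<open>a\<close> to \<open>a c\<close>, so powers of \<open>a c\<close> are what moving \<open>b\<close> past a power of \<open>a\<close>
  requires; summing the arithmetic progression \<open>1 - 2 h r\<close> over \<open>r < n\<close> gives the exponent of \<open>a\<close>.
\<close>

lemma pow_prod_ac: "(a \<otimes> c) [^] n = a [^] (n - h * n * (n - 1)) \<otimes> c [^] n" for n :: int
proof (rule int_pow_unique)
  fix n :: int
  have "a [^] (n - h * n * (n - 1)) \<otimes> c [^] n \<otimes> (a \<otimes> c)
      = a [^] (n - h * n * (n - 1)) \<otimes> (c [^] n \<otimes> a [^] (1::int)) \<otimes> c"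
    by (simp add: m_assoc)
  also have "\<dots> = a [^] (n - h * n * (n - 1)) \<otimes> a [^] (1 - 2 * h * n) \<otimes> (c [^] n \<otimes> c)"
    unfolding ca by (simp add: m_assoc)
  also have "\<dots> = a [^] (n + 1 - h * (n + 1) * n) \<otimes> c [^] (n + 1)"
    using int_pow_mult[of c n 1]
    by (simp add: algebra_simps flip: int_pow_mult)
  finally show "a [^] (n + 1 - h * (n + 1) * (n + 1 - 1)) \<otimes> c [^] (n + 1)
      = a [^] (n - h * n * (n - 1)) \<otimes> c [^] n \<otimes> (a \<otimes> c)" by simp
qed simp_all

lemma pow_prod_bc: "(b \<otimes> inv c) [^] n = b [^] (n - h * n * (n - 1)) \<otimes> c [^] (- n)" for n :: int
proof (rule int_pow_unique)
  fix n :: int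
  have "b [^] (n - h * n * (n - 1)) \<otimes> c [^] (- n) \<otimes> (b \<otimes> inv c)
      = b [^] (n - h * n * (n - 1)) \<otimes> (c [^] (- n) \<otimes> b [^] (1::int)) \<otimes> inv c"
    by (simp add: m_assoc)
  also have "\<dots> = b [^] (n - h * n * (n - 1)) \<otimes> b [^] (1 - 2 * h * n) \<otimes> (c [^] (- n) \<otimes> c [^] (-1::int))"
    unfolding cb by (simp add: m_assoc int_pow_neg)
  also have "\<dots> = b [^] (n + 1 - h * (n + 1) * n) \<otimes> c [^] (- (n + 1))"
    by (simp add: algebra_simps flip: int_pow_mult)
  finally show "b [^] (n + 1 - h * (n + 1) * (n + 1 - 1)) \<otimes> c [^] (- (n + 1))
      = b [^] (n - h * n * (n - 1)) \<otimes> c [^] (- n) \<otimes> (b \<otimes> inv c)" by simp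
qed simp_all

lemma a_pow_b: "a [^] n \<otimes> b = b \<otimes> (a [^] (n - h * n * (n - 1)) \<otimes> c [^] n)" for n :: int
  using conj_int_pow[of a "a \<otimes> c" b n] by (simp add: ab m_assoc pow_prod_ac)

lemma b_pow_a: "b [^] n \<otimes> a = a \<otimes> (b [^] (n - h * n * (n - 1)) \<otimes> c [^] (- n))" for n :: int
proof -
  have "b \<otimes> a = a \<otimes> (b \<otimes> inv c)"
    using ab by (metis ac inv_solve_right m_assoc m_closed inv_closed)
  then show ?thesis using conj_int_pow[of b "b \<otimes> inv c" a n] by (simp add: pow_prod_bc)
qed

text \<open>
  The order of \<open>c\<close> is a consequence of the other relations: conjugate \<open>a\<^sup>N = 1\<close> by \<open>b\<close>.
\<close>

lemma cN: "c [^] N = \<one>"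
proof -
  have "a [^] (N - h * N * (N - 1)) = a [^] (0::int)"
    by (intro pow_cong) (simp_all add: aN)
  then have "b = b \<otimes> c [^] N" using a_pow_b[of N] by (simp add: aN)
  then have "b \<otimes> c [^] N = b \<otimes> \<one>" by simp
  then show ?thesis by (rule l_cancel) simp_all
qed

text \<open>
  The powers of \<open>a\<close> with exponent divisible by \<open>2 h\<close> commute with \<open>c\<close> and move past \<open>b\<close> at the
  cost of a central power of \<open>c\<close>; these are the powers that appear when \<open>c\<close> is moved past \<open>a\<close>.
\<close>

lemma b_pow_a_deep:
  "b [^] x \<otimes> a [^] (2 * h * t) = a [^] (2 * h * t) \<otimes> (b [^] x \<otimes> c [^] (- (2 * h * t * x)))"
  for x t :: int
proof -
  have hh: "N dvd 2 * h * h * w" for w using N(2) by (rule dvd_mult2)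
  have "a [^] (2 * h * t - h * (2 * h * t) * (2 * h * t - 1)) = a [^] (2 * h * t)"
    using hh[of "- t * (2 * h * t - 1)"] by (intro pow_cong) (simp_all add: aN algebra_simps)
  with a_pow_b[of "2 * h * t"]
  have 1: "a [^] (2 * h * t) \<otimes> b = b \<otimes> (a [^] (2 * h * t) \<otimes> c [^] (2 * h * t))" by simp
  have bc: "c [^] (2 * h * t) \<otimes> b [^] x = b [^] x \<otimes> c [^] (2 * h * t)" for t x :: int
  proof -
    have "b [^] (x * (1 + 2 * h * (2 * h * t))) = b [^] x"
      using hh[of "2 * t * x"] by (intro pow_cong) (simp_all add: bN algebra_simps)
    then show ?thesis using cb[of "2 * h * t" x] by simp
  qed
  have "b \<otimes> a [^] (2 * h * t) = a [^] (2 * h * t) \<otimes> (b \<otimes> c [^] (- (2 * h * t)))"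
  proof -
    have "b \<otimes> a [^] (2 * h * t) = b \<otimes> (a [^] (2 * h * t) \<otimes> c [^] (2 * h * t)) \<otimes> c [^] (- (2 * h * t))"
      by (simp add: m_assoc flip: int_pow_mult)
    also have "\<dots> = a [^] (2 * h * t) \<otimes> (b \<otimes> c [^] (- (2 * h * t)))"
      by (simp add: m_assoc flip: 1)
    finally show ?thesis .
  qed
  from conj_int_pow[OF _ _ _ this, of x]
  have "b [^] x \<otimes> a [^] (2 * h * t) = a [^] (2 * h * t) \<otimes> (b \<otimes> c [^] (- (2 * h * t))) [^] x"
    by simp
  also have "(b \<otimes> c [^] (- (2 * h * t))) [^] x = b [^] x \<otimes> c [^] (- (2 * h * t * x))"
    using bc[of "- t" 1] by (subst int_pow_mult_distrib) (simp_all add: int_pow_pow)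
  finally show ?thesis .
qed

definition triple :: "int \<Rightarrow> int \<Rightarrow> int \<Rightarrow> 'a" where
  "triple i j k = a [^] i \<otimes> (b [^] j \<otimes> c [^] k)"

lemma triple_closed [simp]: "triple i j k \<in> carrier G"
  by (simp add: triple_def)

lemma triple_cong:
  assumes "N dvd i - i'" "N dvd j - j'" "N dvd k - k'"
  shows "triple i j k = triple i' j' k'"
  using pow_cong[OF ac(1) aN assms(1)] pow_cong[OF ac(2) bN assms(2)] pow_cong[OF ac(3) cN assms(3)]
  by (simp add: triple_def)

lemma triple_mult_b: "triple i j k \<otimes> b = triple i (j + (1 + 2 * h * k)) k"
proof -
  have "triple i j k \<otimes> b = a [^] i \<otimes> (b [^] j \<otimes> (c [^] k \<otimes> b [^] (1::int)))"
    by (simp add: triple_def m_assoc)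
  then show ?thesis unfolding cb by (simp add: triple_def m_assoc int_pow_mult)
qed

lemma triple_mult_a: "\<exists>i' j' k'. triple i j k \<otimes> a = triple i' j' k'"
proof -
  have hh: "N dvd 2 * h * h * w" for w using N(2) by (rule dvd_mult2)
  define x where "x = j - h * j * (j - 1)"
  define t where "t = 2 * h * - k"
  have "triple i j k \<otimes> a = a [^] i \<otimes> (b [^] j \<otimes> (c [^] k \<otimes> a [^] (1::int)))"
    by (simp add: triple_def m_assoc)
  also have "c [^] k \<otimes> a [^] (1::int) = a \<otimes> a [^] t \<otimes> c [^] k"
    unfolding ca t_def using int_pow_mult[of a 1 "2 * h * - k"] by simp
  also have "b [^] j \<otimes> (a \<otimes> a [^] t \<otimes> c [^] k) = b [^] j \<otimes> a \<otimes> (a [^] t \<otimes> c [^] k)"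
    by (simp add: m_assoc)
  also have "\<dots> = a \<otimes> (b [^] x \<otimes> (c [^] (- j) \<otimes> a [^] t) \<otimes> c [^] k)"
    unfolding b_pow_a x_def by (simp add: m_assoc)
  also have "c [^] (- j) \<otimes> a [^] t = a [^] t \<otimes> c [^] (- j)"
  proof -
    have "a [^] (t * (1 - 2 * h * - j)) = a [^] t"
      using hh[of "- 2 * k * j"] by (intro pow_cong) (simp_all add: aN t_def algebra_simps)
    then show ?thesis using ca[of "- j" t] by simp
  qed
  also have "b [^] x \<otimes> (a [^] t \<otimes> c [^] (- j)) \<otimes> c [^] k
      = (b [^] x \<otimes> a [^] t) \<otimes> (c [^] (- j) \<otimes> c [^] k)" by (simp add: m_assoc)
  also have "\<dots> = a [^] t \<otimes> (b [^] x \<otimes> (c [^] (- (t * x)) \<otimes> (c [^] (- j) \<otimes> c [^] k)))"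
    unfolding t_def b_pow_a_deep by (simp add: m_assoc)
  also have "a [^] i \<otimes> (a \<otimes> (a [^] t \<otimes> (b [^] x \<otimes> (c [^] (- (t * x)) \<otimes> (c [^] (- j) \<otimes> c [^] k)))))
     = triple (i + (1 + t)) x (- (t * x) + (- j + k))"
    by (simp only: triple_def int_pow_mult ac int_pow_1 m_assoc int_pow_closed m_closed)
  finally show ?thesis by blast
qed

text \<open>
  The elements \<open>a\<^sup>i b\<^sup>j c\<^sup>k\<close> are closed under right multiplication by \<open>a\<close> and \<open>b\<close>, hence, as these have
  finite order, by their inverses and by all words.  Only the existence of exponents is needed;
  their values come from the group of triples below.
\<close>

lemma triples_closed_word:
  assumes "\<phi> GenA = a" "\<phi> GenB = b"
  shows "\<exists>i' j' k'. triple i j k \<otimes> weval G \<phi> w = triple i' j' k'"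
proof -
  define S where "S = {triple i j k | i j k. True}"
  have Sc: "S \<subseteq> carrier G" by (auto simp: S_def)
  have a1: "y \<otimes> a \<in> S" and b1: "y \<otimes> b \<in> S" if "y \<in> S" for y
    using that triple_mult_a by (auto simp: S_def triple_mult_b) blast+
  have pow: "y \<otimes> x [^] n \<in> S" if "y \<in> S" and x: "\<And>y. y \<in> S \<Longrightarrow> y \<otimes> x \<in> S" "x \<in> carrier G" for y x and n :: nat
  proof (induction n)
    case (Suc n)
    then have "y \<otimes> x [^] n \<otimes> x \<in> S" by (intro x)
    then show ?case using that Sc by (simp add: m_assoc subset_iff)
  qed (use that Sc in auto)
  have inverse: "y \<otimes> inv x \<in> S" if y: "y \<in> S" and x: "\<And>y. y \<in> S \<Longrightarrow> y \<otimes> x \<in> S" "x \<in> carrier G" "x [^] N = \<one>" for y x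
  proof -
    have "inv x = x [^] (N - 1)"
      using int_pow_diff[OF x(2), of N 1] x(2,3) by simp
    also have "\<dots> = x [^] nat (N - 1)" using N(1) pow_nat[of "N - 1" _ x] by simp
    finally have "inv x = x [^] nat (N - 1)" .
    moreover have "y \<otimes> x [^] nat (N - 1) \<in> S" by (rule pow[OF y x(1,2)])
    ultimately show ?thesis by (simp only:)
  qed
  have gen: "range \<phi> \<subseteq> carrier G"
  proof -
    have "\<phi> x \<in> carrier G" for x using assms by (cases x) simp_all
    then show ?thesis by blast
  qed
  have "y \<in> S \<Longrightarrow> y \<otimes> weval G \<phi> w \<in> S" for y
  proof (induction w arbitrary: y)
    case Nil
    then show ?case using Sc by (auto simp: weval_def)
  next
    case (Cons p w)
    obtain x e where p: "p = (x, e)" by (cases p)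
    have y: "y \<in> carrier G" using Cons.prems Sc by blast
    have "y \<otimes> weval G \<phi> [p] \<in> S"
      using Cons.prems a1 b1 inverse[of y a] inverse[of y b]
      by (cases x; cases e) (simp_all add: p weval_single[OF gen] assms aN bN)
    from Cons.IH[OF this] show ?case
      using weval_append[OF gen, of "[p]" w] y weval_closed[OF gen, of w] weval_closed[OF gen, of "[p]"]
      by (simp add: m_assoc)
  qed
  moreover have "triple i j k \<in> S" by (auto simp: S_def)
  ultimately show ?thesis unfolding S_def by blast
qed

end

section \<open>A group on triples of residues\<close>

text \<open>
  The binomial coefficient \<open>x\<close> over 2, at all integers.
\<close>

definition bin :: "int \<Rightarrow> int" where
  "bin x = x * (x - 1) div 2"

lemma two_bin: "2 * bin x = x * (x - 1)"
proof -
  have "even (x * (x - 1))" by simp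
  then show ?thesis by (simp add: bin_def)
qed

lemma bin_0 [simp]: "bin 0 = 0" and bin_1 [simp]: "bin 1 = 0" and bin_2 [simp]: "bin 2 = 1"
  by (simp_all add: bin_def)

lemma bin_add: "bin (x + y) = bin x + bin y + x * y"
proof -
  have "2 * bin (x + y) = 2 * (bin x + bin y + x * y)"
    by (simp only: two_bin distrib_left) (simp add: two_bin algebra_simps)
  then show ?thesis by simp
qed

lemma bin_cong:
  assumes "[x = y] (mod 2 * M)"
  shows "[bin x = bin y] (mod M)"
proof -
  obtain t where t: "x = y + 2 * M * t"
    using assms by (metis cong_iff_lin cong_sym mult.commute)
  have "2 * bin x = 2 * (bin y + M * (t * (2 * y - 1 + 2 * M * t)))"
    unfolding two_bin distrib_left t by (simp add: algebra_simps)
  then have "bin x = bin y + M * (t * (2 * y - 1 + 2 * M * t))" by simp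
  then show ?thesis by (simp add: cong_def)
qed

text \<open>
  The first-order deformation of the Heisenberg product \<open>heis\<close>.  The three corrections are what
  collecting \<open>a\<^sup>i b\<^sup>j c\<^sup>k a\<^sup>i\<^sup>' b\<^sup>j\<^sup>' c\<^sup>k\<^sup>'\<close> produces in front of \<open>2 h\<close>.
\<close>

definition corr1 :: "int \<times> int \<times> int \<Rightarrow> int \<times> int \<times> int \<Rightarrow> int" where
  "corr1 = (\<lambda>(i, j, k) (i', j', k'). bin i' * j - i' * k)"

definition corr2 :: "int \<times> int \<times> int \<Rightarrow> int \<times> int \<times> int \<Rightarrow> int" where
  "corr2 = (\<lambda>(i, j, k) (i', j', k'). j' * (k - i' * j) - i' * bin j)"

definition corr3 :: "int \<times> int \<times> int \<Rightarrow> int \<times> int \<times> int \<Rightarrow> int" where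
  "corr3 = (\<lambda>(i, j, k) (i', j', k'). i' * j * k - bin i' * bin (j + 1))"

definition heis :: "int \<times> int \<times> int \<Rightarrow> int \<times> int \<times> int \<Rightarrow> int \<times> int \<times> int" where
  "heis = (\<lambda>(i, j, k) (i', j', k'). (i + i', j + j', k + k' - i' * j))"

definition tmul :: "int \<Rightarrow> int \<times> int \<times> int \<Rightarrow> int \<times> int \<times> int \<Rightarrow> int \<times> int \<times> int" where
  "tmul h x y = (case heis x y of (i, j, k) \<Rightarrow>
     (i + 2 * h * corr1 x y, j + 2 * h * corr2 x y, k + 2 * h * corr3 x y))"

fun tcong :: "int \<Rightarrow> int \<times> int \<times> int \<Rightarrow> int \<times> int \<times> int \<Rightarrow> bool" where
  "tcong M (i, j, k) (i', j', k') \<longleftrightarrow> [i = i'] (mod M) \<and> [j = j'] (mod M) \<and> [k = k'] (mod M)"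

lemma tcong_refl [simp]: "tcong M x x"
  by (cases x) simp

lemma tcong_trans [trans]: "tcong M x y \<Longrightarrow> tcong M y z \<Longrightarrow> tcong M x z"
  by (cases x; cases y; cases z) (auto intro: cong_trans)

text \<open>
  Binomial coefficients lose a factor 2 of the modulus.  This is harmless, because the corrections
  are multiplied by \<open>2 h\<close>: with \<open>M = h\<close> it shows that corrections of corrections vanish modulo
  \<open>2 h\<^sup>2\<close>, and with \<open>2 M = N\<close> that the law is well defined modulo \<open>N\<close>.
\<close>

lemma corr_cong:
  assumes "tcong (2 * M) x x'" "tcong (2 * M) y y'"
  shows "[corr1 x y = corr1 x' y'] (mod M)" "[corr2 x y = corr2 x' y'] (mod M)"
    "[corr3 x y = corr3 x' y'] (mod M)"
proof -
  have M: "[u = v] (mod M)" if "[u = v] (mod 2 * M)" for u v :: int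
    using that by (rule cong_dvd_modulus) simp
  have B: "[bin (u + 1) = bin (v + 1)] (mod M)" if "[u = v] (mod 2 * M)" for u v :: int
    using that by (intro bin_cong cong_add) simp_all
  obtain i j k i' j' k' where xy: "x = (i, j, k)" "y = (i', j', k')" by (cases x; cases y)
  obtain I J K I' J' K' where xy': "x' = (I, J, K)" "y' = (I', J', K')" by (cases x'; cases y')
  have c: "[i = I] (mod 2 * M)" "[j = J] (mod 2 * M)" "[k = K] (mod 2 * M)"
    "[i' = I'] (mod 2 * M)" "[j' = J'] (mod 2 * M)" "[k' = K'] (mod 2 * M)"
    using assms by (simp_all add: xy xy')
  note cong = M[OF c(1)] M[OF c(2)] M[OF c(3)] M[OF c(4)] M[OF c(5)] M[OF c(6)]
    bin_cong[OF c(2)] bin_cong[OF c(4)] B[OF c(2)]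
  show "[corr1 x y = corr1 x' y'] (mod M)"
    unfolding corr1_def xy xy' prod.case by (intro cong_diff cong_mult cong)
  show "[corr2 x y = corr2 x' y'] (mod M)"
    unfolding corr2_def xy xy' prod.case by (intro cong_diff cong_mult cong)
  show "[corr3 x y = corr3 x' y'] (mod M)"
    unfolding corr3_def xy xy' prod.case by (intro cong_diff cong_mult cong)
qed

lemma scaled_cong: "[u = v] (mod M) \<Longrightarrow> N dvd c * M \<Longrightarrow> [c * u = c * v] (mod N)" for u v :: int
  by (rule cong_dvd_modulus[of _ _ "c * M"]) (simp_all add: cong_cmult_leftI)

lemma heis_cong: "tcong M x x' \<Longrightarrow> tcong M y y' \<Longrightarrow> tcong M (heis x y) (heis x' y')"
  by (cases x; cases y; cases x'; cases y')
     (auto simp: heis_def intro!: cong_add cong_diff cong_mult)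

lemma tcong_tmulI:
  assumes "tcong N (heis x y) (heis x' y')" "N dvd 2 * h * M"
    "[corr1 x y = corr1 x' y'] (mod M)" "[corr2 x y = corr2 x' y'] (mod M)"
    "[corr3 x y = corr3 x' y'] (mod M)"
  shows "tcong N (tmul h x y) (tmul h x' y')"
  using assms scaled_cong[of _ _ M N "2 * h"]
  by (cases "heis x y"; cases "heis x' y'") (auto simp: tmul_def intro!: cong_add)

lemma tmul_cong:
  assumes "tcong (2 * M) x x'" "tcong (2 * M) y y'"
  shows "tcong (2 * M) (tmul h x y) (tmul h x' y')"
  using assms by (intro tcong_tmulI[where M = M] heis_cong corr_cong) simp_all

text \<open>
  Associativity of the deformed product to first order in \<open>h\<close>, as an identity between integers.  The
  extra terms in the third line come from the bilinear term of the Heisenberg product.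
\<close>

lemma corr_cocycle:
  assumes "x = (i1, j1, k1)" "y = (i2, j2, k2)" "z = (i3, j3, k3)"
  shows "corr1 x y + corr1 (heis x y) z = corr1 y z + corr1 x (heis y z)"
    and "corr2 x y + corr2 (heis x y) z = corr2 y z + corr2 x (heis y z)"
    and "corr3 x y - i3 * corr2 x y + corr3 (heis x y) z
       = corr3 y z - corr1 y z * j1 + corr3 x (heis y z)"
proof -
  have b: "u * u = 2 * bin u + u" for u using two_bin[of u] by (simp add: algebra_simps)
  show "corr1 x y + corr1 (heis x y) z = corr1 y z + corr1 x (heis y z)"
    unfolding assms heis_def corr1_def prod.case bin_add by (simp add: algebra_simps)
  show "corr2 x y + corr2 (heis x y) z = corr2 y z + corr2 x (heis y z)"
    unfolding assms heis_def corr2_def prod.case bin_add by (simp add: algebra_simps)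
  show "corr3 x y - i3 * corr2 x y + corr3 (heis x y) z
       = corr3 y z - corr1 y z * j1 + corr3 x (heis y z)"
    unfolding assms heis_def corr1_def corr2_def corr3_def prod.case bin_add
    using arg_cong[OF b[of j1], of "(*) (i2 * i3)"] by (simp add: algebra_simps)
qed

text \<open>
  In both bracketings the inner product may be replaced by the Heisenberg product inside the
  corrections; what remains is the associativity of \<open>heis\<close> and the cocycle identity.
\<close>

lemma tmul_assoc:
  assumes "N dvd 2 * h * h"
  shows "tcong N (tmul h (tmul h x y) z) (tmul h x (tmul h y z))"
proof -
  obtain i1 j1 k1 i2 j2 k2 i3 j3 k3
    where xyz: "x = (i1, j1, k1)" "y = (i2, j2, k2)" "z = (i3, j3, k3)"
    by (cases x; cases y; cases z)
  have base: "tcong (2 * h) (tmul h u v) (heis u v)" for u v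
    by (cases "heis u v") (simp add: tmul_def cong_def)
  note c1 = corr_cong[where M = h, OF base[of x y] tcong_refl[of _ z]]
  note c2 = corr_cong[where M = h, OF tcong_refl[of _ x] base[of y z]]
  note sc = scaled_cong[of _ _ h N "2 * h", OF _ assms]
  define L where "L = (case heis (tmul h x y) z of (i, j, k) \<Rightarrow>
     (i + 2 * h * corr1 (heis x y) z, j + 2 * h * corr2 (heis x y) z, k + 2 * h * corr3 (heis x y) z))"
  define R where "R = (case heis x (tmul h y z) of (i, j, k) \<Rightarrow>
     (i + 2 * h * corr1 x (heis y z), j + 2 * h * corr2 x (heis y z), k + 2 * h * corr3 x (heis y z)))"
  have "tcong N (tmul h (tmul h x y) z) L"
    unfolding tmul_def[of h "tmul h x y" z] L_def
    by (cases "heis (tmul h x y) z") (auto intro!: cong_add sc c1)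
  also have "L = R"
  proof -
    have lift: "2 * h * u + 2 * h * v = 2 * h * u' + 2 * h * v'" if "u + v = u' + v'" for u v u' v'
      using that by (metis distrib_left)
    note coc = corr_cocycle[OF xyz]
    show ?thesis
      unfolding L_def R_def
      using lift[OF coc(1)] lift[OF coc(2)] arg_cong[OF coc(3), of "(*) (2 * h)"]
      by (simp add: tmul_def heis_def xyz algebra_simps)
  qed
  also have "tcong N R (tmul h x (tmul h y z))"
    unfolding tmul_def[of h x "tmul h y z"] R_def
    by (cases "heis x (tmul h y z)") (auto intro!: cong_add sc cong_sym[OF c2(1)] cong_sym[OF c2(2)] cong_sym[OF c2(3)])
  finally show ?thesis .
qed

fun tred :: "int \<Rightarrow> int \<times> int \<times> int \<Rightarrow> int \<times> int \<times> int" where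
  "tred N (i, j, k) = (i mod N, j mod N, k mod N)"

definition triple_group :: "int \<Rightarrow> int \<Rightarrow> (int \<times> int \<times> int) monoid" where
  "triple_group h N =
     \<lparr>carrier = {0..<N} \<times> {0..<N} \<times> {0..<N}, monoid.mult = (\<lambda>x y. tred N (tmul h x y)),
      one = (0, 0, 0)\<rparr>"

lemma tred_eq_iff: "tred N x = tred N y \<longleftrightarrow> tcong N x y"
  by (cases x; cases y) (simp add: cong_def)

lemma tcong_tred: "tcong N (tred N x) x"
  by (cases x) (simp add: cong_def)

lemma tred_id: "x \<in> {0..<N} \<times> {0..<N} \<times> {0..<N} \<Longrightarrow> tred N x = x"
  by auto

declare tred.simps [simp del]

lemma tred_mult:
  "tred (2 * M) x \<otimes>\<^bsub>triple_group h (2 * M)\<^esub> tred (2 * M) y = tred (2 * M) (tmul h x y)"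
  by (simp add: triple_group_def tred_eq_iff tmul_cong tcong_tred)

lemma tmul_simps [simp]:
  "tmul h (0, 0, 0) y = y"
  "tmul h (i, 0, 0) (i', j, k) = (i + i', j, k)"
  "tmul h (0, j, 0) (0, j', k) = (0, j + j', k)"
  "tmul h (i, j, k) (0, 0, k') = (i, j, k + k')"
  "tmul h (i, j, k) (0, j', 0) = (i, j + j' + 2 * h * (j' * k), k)"
  by (cases y; simp add: tmul_def heis_def corr1_def corr2_def corr3_def)
     (simp_all add: tmul_def heis_def corr1_def corr2_def corr3_def)

lemma group_triple_group:
  assumes M: "M > 0" "2 * M dvd 2 * h * h"
  shows "group (triple_group h (2 * M))"
proof (rule groupI)
  let ?T = "triple_group h (2 * M)"
  let ?C = "carrier ?T"
  have C: "?C = range (tred (2 * M))"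
  proof
    show "?C \<subseteq> range (tred (2 * M))"
    proof
      fix x assume "x \<in> ?C"
      then have "x = tred (2 * M) x" by (intro tred_id[symmetric]) (simp add: triple_group_def)
      then show "x \<in> range (tred (2 * M))" by (rule range_eqI)
    qed
    show "range (tred (2 * M)) \<subseteq> ?C"
    proof
      fix x assume "x \<in> range (tred (2 * M))"
      then obtain i j k where "x = tred (2 * M) (i, j, k)" by (metis imageE prod_cases3)
      then show "x \<in> ?C" using M(1) by (simp add: triple_group_def tred.simps)
    qed
  qed
  have one: "\<one>\<^bsub>?T\<^esub> = tred (2 * M) (0, 0, 0)"
    by (simp add: triple_group_def tred.simps)
  show "x \<otimes>\<^bsub>?T\<^esub> y \<in> ?C" if "x \<in> ?C" "y \<in> ?C" for x y
    using that unfolding C by (auto simp: tred_mult)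
  show "\<one>\<^bsub>?T\<^esub> \<in> ?C" unfolding C one by blast
  show "x \<otimes>\<^bsub>?T\<^esub> y \<otimes>\<^bsub>?T\<^esub> z
     = x \<otimes>\<^bsub>?T\<^esub> (y \<otimes>\<^bsub>?T\<^esub> z)"
    if "x \<in> ?C" "y \<in> ?C" "z \<in> ?C" for x y z
  proof -
    from that obtain u v w where "x = tred (2 * M) u" "y = tred (2 * M) v" "z = tred (2 * M) w"
      unfolding C by blast
    then show ?thesis using tmul_assoc[OF M(2)] by (simp add: tred_mult tred_eq_iff)
  qed
  show "\<one>\<^bsub>?T\<^esub> \<otimes>\<^bsub>?T\<^esub> x = x" if "x \<in> ?C" for x
    using that unfolding C one by (auto simp: tred_mult)
  show "\<exists>y\<in>?C. y \<otimes>\<^bsub>?T\<^esub> x = \<one>\<^bsub>?T\<^esub>" if x: "x \<in> ?C" for x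
  proof -
    obtain i j k where ijk: "x = tred (2 * M) (i, j, k)" using x unfolding C by (metis imageE prod_cases3)
    let ?t = "tmul h" and ?a = "(- i, 0, 0)" and ?b = "(0, - j, 0)" and ?c = "(0, 0, - k)"
    have "tcong (2 * M) (?t (?t (?t ?c ?b) ?a) (i, j, k)) (?t (?t ?c ?b) (?t ?a (i, j, k)))"
      by (rule tmul_assoc[OF M(2)])
    also have "?t ?a (i, j, k) = (0, j, k)" by simp
    also have "tcong (2 * M) (?t (?t ?c ?b) (0, j, k)) (?t ?c (?t ?b (0, j, k)))"
      by (rule tmul_assoc[OF M(2)])
    also have "?t ?c (?t ?b (0, j, k)) = (0, 0, 0)" by simp
    finally have "tred (2 * M) (?t (?t ?c ?b) ?a) \<otimes>\<^bsub>?T\<^esub> x = \<one>\<^bsub>?T\<^esub>"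
      unfolding ijk tred_mult one tred_eq_iff .
    then show ?thesis unfolding C by blast
  qed
qed

lemma tred_closed: "M > 0 \<Longrightarrow> tred (2 * M) x \<in> carrier (triple_group h (2 * M))"
  by (cases x) (simp add: triple_group_def tred.simps)

lemma rel_pair_triple_group:
  assumes M: "M > 0" "2 * M dvd 2 * h * h"
  shows "rel_pair (triple_group h (2 * M)) h (2 * M)
    (tred (2 * M) (1, 0, 0)) (tred (2 * M) (0, 1, 0)) (tred (2 * M) (0, 0, 1))"
    and "rel_pair.triple (triple_group h (2 * M)) (tred (2 * M) (1, 0, 0)) (tred (2 * M) (0, 1, 0))
       (tred (2 * M) (0, 0, 1)) i j k = tred (2 * M) (i, j, k)"
proof -
  let ?T = "triple_group h (2 * M)"
  interpret group ?T by (rule group_triple_group[OF M])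
  let ?a = "tred (2 * M) (1, 0, 0)" and ?b = "tred (2 * M) (0, 1, 0)" and ?c = "tred (2 * M) (0, 0, 1)"
  have one: "\<one>\<^bsub>?T\<^esub> = tred (2 * M) (0, 0, 0)"
    by (simp add: triple_group_def tred.simps)
  note closed = tred_closed[OF M(1)]
  have pa: "?a [^]\<^bsub>?T\<^esub> n = tred (2 * M) (n, 0, 0)" for n :: int
    by (rule int_pow_unique) (simp_all add: closed one tred_mult)
  have pb: "?b [^]\<^bsub>?T\<^esub> n = tred (2 * M) (0, n, 0)" for n :: int
    by (rule int_pow_unique) (simp_all add: closed one tred_mult)
  have pc: "?c [^]\<^bsub>?T\<^esub> n = tred (2 * M) (0, 0, n)" for n :: int
    by (rule int_pow_unique) (simp_all add: closed one tred_mult)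
  have m: "2 * M dvd 2 * h * h * w" for w using M(2) by (rule dvd_mult2)
  show R: "rel_pair (?T) h (2 * M) ?a ?b ?c"
  proof unfold_locales
    show "?a \<otimes>\<^bsub>?T\<^esub> ?c
       = ?c \<otimes>\<^bsub>?T\<^esub> ?a [^]\<^bsub>?T\<^esub> (1 + 2 * h)"
      unfolding pa tred_mult tred_eq_iff
      using m[of 2] by (simp add: tmul_def heis_def corr1_def corr2_def corr3_def cong_iff_dvd_diff algebra_simps)
    show "?c \<otimes>\<^bsub>?T\<^esub> ?b
       = ?b [^]\<^bsub>?T\<^esub> (1 + 2 * h) \<otimes>\<^bsub>?T\<^esub> ?c"
      unfolding pb tred_mult tred_eq_iff by simp
    show "?a \<otimes>\<^bsub>?T\<^esub> ?b
       = ?b \<otimes>\<^bsub>?T\<^esub> ?a \<otimes>\<^bsub>?T\<^esub> ?c"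
      unfolding tred_mult tred_eq_iff
      by (simp add: tmul_def heis_def corr1_def corr2_def corr3_def)
  qed (use M in \<open>simp_all add: closed pa pb one tred_eq_iff cong_def\<close>)
  interpret R: rel_pair "?T" h "2 * M" ?a ?b ?c by (rule R)
  show "R.triple i j k = tred (2 * M) (i, j, k)"
    unfolding R.triple_def pa pb pc tred_mult by simp
qed

section \<open>Coordinates on \<open>H\<close>\<close>

text \<open>
  The defining relations evaluated in a group, rewritten without inverses by means of \<open>c = [a, b]\<close>.
\<close>

lemma (in group) H_rels_iff:
  assumes "range \<phi> \<subseteq> carrier G" "c \<in> carrier G"
    and "\<phi> GenA \<otimes> \<phi> GenB = \<phi> GenB \<otimes> \<phi> GenA \<otimes> c"
  shows "(\<forall>(u, v)\<in>H_rels m l. weval G \<phi> u = weval G \<phi> v) \<longleftrightarrow>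
     \<phi> GenA \<otimes> c = c \<otimes> \<phi> GenA [^] (1 + 2 ^ m * l) \<and>
     c \<otimes> \<phi> GenB = \<phi> GenB [^] (1 + 2 ^ m * l) \<otimes> c \<and>
     \<phi> GenA [^] (2 ^ (2 * m - 1) :: int) = \<one> \<and> \<phi> GenB [^] (2 ^ (2 * m - 1) :: int) = \<one>"
proof -
  have ab [simp]: "\<phi> GenA \<in> carrier G" "\<phi> GenB \<in> carrier G" using assms(1) by auto
  have c: "c = inv (\<phi> GenA) \<otimes> inv (\<phi> GenB) \<otimes> \<phi> GenA \<otimes> \<phi> GenB"
    using assms(2,3) by (simp add: m_assoc)
  have wa: "weval G \<phi> [(GenA, True)] = \<phi> GenA" and wb: "weval G \<phi> [(GenB, True)] = \<phi> GenB"
    by (simp_all add: weval_single assms(1))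
  have wc: "weval G \<phi> (wcomm [(GenA, True)] [(GenB, True)]) = c"
    unfolding c wcomm_def weval_append[OF assms(1)] weval_winv[OF assms(1)] wa wb by (simp add: m_assoc)
  have wc': "weval G \<phi> (wcomm [(GenB, True)] [(GenA, True)]) = inv c"
    unfolding c wcomm_def weval_append[OF assms(1)] weval_winv[OF assms(1)] wa wb
    by (simp add: m_assoc inv_mult_group)
  have A: "inv c \<otimes> (\<phi> GenA \<otimes> c) = x \<longleftrightarrow> \<phi> GenA \<otimes> c = c \<otimes> x" if "x \<in> carrier G" for x
    using that assms(2) by (metis ab(1) inv_closed inv_mult_cancel m_closed)
  have B: "c \<otimes> (\<phi> GenB \<otimes> inv c) = x \<longleftrightarrow> c \<otimes> \<phi> GenB = x \<otimes> c" if "x \<in> carrier G" for x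
    using that assms(2) by (metis ab(2) inv_solve_right' m_assoc inv_closed m_closed)
  have nil: "weval G \<phi> [] = \<one>" by (simp add: weval_def)
  show ?thesis
    unfolding H_rels_def Let_def wconj_def ball_simps prod.case weval_append[OF assms(1)]
      weval_winv[OF assms(1)] weval_wpow[OF assms(1)] wa wb wc wc' nil
    using assms(2) by (simp add: A B)
qed

locale H_group =
  fixes m :: nat and l :: int
  assumes m: "m > 1" and l: "odd l"
begin

text \<open>
  In these terms \<open>2\<^sup>m = 2 s\<close>, \<open>\<alpha> = 1 + 2 h\<close> and \<open>2\<^sup>2\<^sup>m\<^sup>-\<^sup>1 = N\<close>.
\<close>

definition s :: int where "s = 2 ^ (m - 1)"
definition h :: int where "h = s * l"
definition N :: int where "N = 2 * (s * s)"

lemma s_pos [simp]: "s > 0" by (simp add: s_def)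

lemma s_nonzero [simp]: "s \<noteq> 0" by (simp add: s_def)

lemma s_even: "even s"
  using m by (simp add: s_def)

lemma two_s: "2 ^ m = 2 * s"
proof -
  have "m = Suc (m - 1)" using m by simp
  then have "(2::int) ^ m = 2 ^ Suc (m - 1)" by (rule arg_cong)
  then show ?thesis by (simp add: s_def)
qed

lemma N_eq: "N = 2 ^ (2 * m - 1)"
proof -
  have "2 * m - 1 = Suc ((m - 1) + (m - 1))" using m by simp
  then show ?thesis unfolding N_def s_def by (simp only: power_add power_Suc)
qed

lemma N_pos: "N > 0" by (simp add: N_def)

lemma N_dvd: "N dvd 2 * h * h"
  by (rule dvdI[of _ _ "l * l"]) (simp add: N_def h_def)

abbreviation H where "H \<equiv> H_grp m l"
abbreviation A where "A \<equiv> H_A m l"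
abbreviation B where "B \<equiv> H_B m l"

sublocale H: group H
  unfolding H_grp_def by (rule group_presented_group)

abbreviation H_mult (infixl "\<cdot>" 70) where "x \<cdot> y \<equiv> x \<otimes>\<^bsub>H\<^esub> y"

definition C where "C = inv\<^bsub>H\<^esub> A \<cdot> inv\<^bsub>H\<^esub> B \<cdot> A \<cdot> B"

lemma AB_closed [simp]: "A \<in> carrier H" "B \<in> carrier H"
  using pres_gen_closed[of "H_rels m l"] by (auto simp: H_A_def H_B_def H_grp_def)

sublocale R: rel_pair H h N A B C
proof -
  let ?g = "pres_gen (H_rels m l)"
  have g: "range ?g \<subseteq> carrier H" using pres_gen_closed unfolding H_grp_def .
  have C: "C \<in> carrier H" by (simp add: C_def)
  have ab: "A \<cdot> B = B \<cdot> A \<cdot> C" by (simp add: C_def H.m_assoc)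
  have rels: "weval H ?g u = weval H ?g v" if "(u, v) \<in> H_rels m l" for u v
    using presented_group_rel[OF that] by (simp add: H_grp_def)
  have "A \<cdot> C = C \<cdot> A [^]\<^bsub>H\<^esub> (1 + 2 ^ m * l) \<and>
     C \<cdot> B = B [^]\<^bsub>H\<^esub> (1 + 2 ^ m * l) \<cdot> C \<and>
     A [^]\<^bsub>H\<^esub> (2 ^ (2 * m - 1) :: int) = \<one>\<^bsub>H\<^esub> \<and> B [^]\<^bsub>H\<^esub> (2 ^ (2 * m - 1) :: int) = \<one>\<^bsub>H\<^esub>"
    using H.H_rels_iff[OF g C, of m l] ab rels unfolding H_A_def H_B_def by blast
  moreover have "1 + 2 ^ m * l = 1 + 2 * h" by (simp add: two_s h_def)
  ultimately show "rel_pair H h N A B C"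
    using C ab unfolding N_eq[symmetric] by unfold_locales (simp_all add: N_pos N_dvd)
qed

abbreviation nf where "nf \<equiv> R.triple"

lemma nf_A: "nf 1 0 0 = A" and nf_B: "nf 0 1 0 = B" and nf_C: "nf 0 0 1 = C"
  and nf_one: "\<one>\<^bsub>H\<^esub> = nf 0 0 0"
  by (simp_all add: R.triple_def)

lemma hom_from_pair:
  assumes "group G" "rel_pair G h N a b c"
  obtains f where "f \<in> hom H G" "f A = a" "f B = b" "f C = c"
proof -
  interpret R': rel_pair G h N a b c by (rule assms(2))
  define \<phi> where "\<phi> = case_gen a b"
  have \<phi>: "\<phi> GenA = a" "\<phi> GenB = b" by (simp_all add: \<phi>_def)
  have "\<phi> x \<in> carrier G" for x by (cases x) (simp_all add: \<phi>)
  then have g: "range \<phi> \<subseteq> carrier G" by blast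
  have "1 + 2 ^ m * l = 1 + 2 * h" by (simp add: two_s h_def)
  then have "\<forall>(u, v)\<in>H_rels m l. weval G \<phi> u = weval G \<phi> v"
    using R'.H_rels_iff[OF g R'.ac(3), of m l] R'.ab R'.a_c R'.c_b R'.aN R'.bN
    unfolding N_eq[symmetric] by (simp add: \<phi>)
  then have rels: "weval G \<phi> u = weval G \<phi> v" if "(u, v) \<in> H_rels m l" for u v
    using that by blast
  obtain f where f: "f \<in> hom (presented_group (H_rels m l)) G"
      "\<And>x. f (pres_gen (H_rels m l) x) = \<phi> x"
    by (rule R'.presented_group_universal[where R = "H_rels m l", OF g rels]) (assumption, rule that)
  then have "f \<in> hom H G" "f A = a" "f B = b" by (simp_all add: H_A_def H_B_def \<phi> H_grp_def)
  interpret f: group_hom H G f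
    using \<open>f \<in> hom H G\<close> by unfold_locales
  have "f (A \<cdot> B) = f (B \<cdot> A \<cdot> C)" by (simp only: R.ab)
  then have "a \<otimes>\<^bsub>G\<^esub> b = b \<otimes>\<^bsub>G\<^esub> a \<otimes>\<^bsub>G\<^esub> f C" by (simp add: \<open>f A = a\<close> \<open>f B = b\<close>)
  then have "f C = c" using R'.ab by (simp add: R'.m_assoc)
  show thesis by (rule that) fact+
qed

lemma hom_nf:
  assumes "group G" "f \<in> hom H G"
  shows "f (nf i j k) = f A [^]\<^bsub>G\<^esub> i \<otimes>\<^bsub>G\<^esub> (f B [^]\<^bsub>G\<^esub> j \<otimes>\<^bsub>G\<^esub> f C [^]\<^bsub>G\<^esub> k)"
proof -
  interpret f: group_hom H G f using assms by (intro group_hom.intro group_hom_axioms.intro H.group_axioms)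
  show ?thesis by (simp add: R.triple_def f.hom_int_pow)
qed

lemma nf_surj: "x \<in> carrier H \<Longrightarrow> \<exists>i j k. x = nf i j k"
proof -
  assume "x \<in> carrier H"
  then obtain w where "x = weval H (pres_gen (H_rels m l)) w"
    by (auto simp: H_grp_def weval_pres_gen) (auto simp: presented_group_def)
  then have "x = nf 0 0 0 \<cdot> weval H (pres_gen (H_rels m l)) w"
    using \<open>x \<in> carrier H\<close> by (simp flip: nf_one)
  then show ?thesis
    using R.triples_closed_word[of "pres_gen (H_rels m l)" 0 0 0 w] by (simp add: H_A_def H_B_def)
qed

text \<open>
  The homomorphism from \<open>H\<close> onto the group of triples; it reads off the exponents of a normal form and
  so shows that they are unique.
\<close>

lemma coordinates:
  obtains f where "f \<in> hom H (triple_group h N)" "\<And>i j k. f (nf i j k) = tred N (i, j, k)"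
proof -
  have M: "s * s > 0" "2 * (s * s) dvd 2 * h * h" using N_dvd by (simp_all add: N_def)
  note G = group_triple_group[OF M, folded N_def]
  interpret R': rel_pair "triple_group h N" h N "tred N (1, 0, 0)" "tred N (0, 1, 0)" "tred N (0, 0, 1)"
    using rel_pair_triple_group(1)[OF M] unfolding N_def .
  obtain f where f: "f \<in> hom H (triple_group h N)" "f A = tred N (1, 0, 0)"
    "f B = tred N (0, 1, 0)" "f C = tred N (0, 0, 1)"
    by (rule hom_from_pair[OF G R'.rel_pair_axioms]) (rule that)
  have T: "R'.triple i j k = tred N (i, j, k)" for i j k
    using rel_pair_triple_group(2)[OF M, of i j k] unfolding N_def .
  have "f (nf i j k) = tred N (i, j, k)" for i j k
    unfolding hom_nf[OF G f(1)] f(2-4) using T[of i j k] unfolding R'.triple_def .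
  with f(1) show thesis by (rule that)
qed

lemma nf_eq_iff: "nf i j k = nf i' j' k' \<longleftrightarrow> [i = i'] (mod N) \<and> [j = j'] (mod N) \<and> [k = k'] (mod N)"
proof
  assume eq: "nf i j k = nf i' j' k'"
  obtain f where f: "f \<in> hom H (triple_group h N)" "\<And>i j k. f (nf i j k) = tred N (i, j, k)"
    by (rule coordinates) (rule that)
  have "tred N (i, j, k) = tred N (i', j', k')"
    using arg_cong[OF eq, of f] by (simp only: f(2))
  then show "[i = i'] (mod N) \<and> [j = j'] (mod N) \<and> [k = k'] (mod N)"
    by (simp add: tred_eq_iff)
next
  assume "[i = i'] (mod N) \<and> [j = j'] (mod N) \<and> [k = k'] (mod N)"
  then show "nf i j k = nf i' j' k'" by (intro R.triple_cong) (simp_all add: cong_iff_dvd_diff)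
qed

text \<open>
  The multiplication is that of the triples, transported along \<open>coordinates\<close>.
\<close>

lemma nf_mult_bin:
  "nf i j k \<cdot> nf i' j' k' =
     nf (i + i' + 2 * h * (bin i' * j - i' * k))
        (j + j' + 2 * h * (j' * (k - i' * j) - i' * bin j))
        (k + k' - i' * j + 2 * h * (i' * j * k - bin i' * bin (j + 1)))"
proof -
  obtain f where f: "f \<in> hom H (triple_group h N)" "\<And>i j k. f (nf i j k) = tred N (i, j, k)"
    by (rule coordinates) (rule that)
  obtain I J K where IJK: "nf i j k \<cdot> nf i' j' k' = nf I J K"
    using nf_surj[of "nf i j k \<cdot> nf i' j' k'"] by auto
  have "tred N (I, J, K) = tred N (i, j, k) \<otimes>\<^bsub>triple_group h N\<^esub> tred N (i', j', k')"
    using hom_mult[OF f(1), of "nf i j k" "nf i' j' k'"] by (simp add: IJK f(2))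
  also have "\<dots> = tred N (tmul h (i, j, k) (i', j', k'))"
    unfolding N_def by (rule tred_mult)
  finally show ?thesis
    unfolding IJK tred_eq_iff nf_eq_iff
    by (simp add: tmul_def heis_def corr1_def corr2_def corr3_def)
qed

text \<open>
  The law with the factor 2 of \<open>2 h\<close> used up by the binomial coefficients in the correction terms.
\<close>

lemma nf_mult:
  "nf i j k \<cdot> nf i' j' k' =
     nf (i + i' + h * (i' * (i' - 1) * j) - 2 * h * (i' * k))
        (j + j' - h * (i' * (j * (j - 1))) + 2 * h * (j' * (k - i' * j)))
        (k + k' - i' * j - h * (i' * (i' - 1) * bin (j + 1)) + 2 * h * (i' * j * k))"
proof -
  have "2 * h * (bin i' * j - i' * k) = h * (i' * (i' - 1) * j) - 2 * h * (i' * k)"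
    unfolding two_bin[of i', symmetric] by (simp add: algebra_simps)
  moreover have "2 * h * (j' * (k - i' * j) - i' * bin j)
      = 2 * h * (j' * (k - i' * j)) - h * (i' * (j * (j - 1)))"
    unfolding two_bin[of j, symmetric] by (simp add: algebra_simps)
  moreover have "2 * h * (i' * j * k - bin i' * bin (j + 1))
      = 2 * h * (i' * j * k) - h * (i' * (i' - 1) * bin (j + 1))"
    unfolding two_bin[of i', symmetric] by (simp add: algebra_simps)
  ultimately show ?thesis unfolding nf_mult_bin by (simp add: add_diff_eq diff_add_eq)
qed

end

section \<open>The upper central series of \<open>H\<close>\<close>

lemma bin_double:
  "bin (2 * x) = x * (2 * x - 1)" "bin (2 * x + 1) = x * (2 * x + 1)"
  "bin (1 + 2 * x) = x * (1 + 2 * x)" "bin (1 + 2 * x + 1) = (x + 1) * (1 + 2 * x)"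
  using two_bin[of "2 * x"] two_bin[of "2 * x + 1"] two_bin[of "1 + 2 * x"] two_bin[of "1 + 2 * x + 1"]
  by (simp_all add: algebra_simps)

context H_group
begin

definition r where "r = s div 2"

lemma s_r: "s = 2 * r" using s_even by (simp add: r_def)

lemmas expand = N_def h_def s_r algebra_simps

lemma bin_s:
  "bin (s * x) = r * x * (s * x - 1)" "bin (s * x + 1) = r * x * (s * x + 1)"
  "bin (1 + s * x) = r * x * (1 + s * x)" "bin (1 + s * x + 1) = (r * x + 1) * (1 + s * x)"
  using bin_double[of "r * x"] by (simp_all add: s_r algebra_simps)

text \<open>
  Multiplication by elements of what turns out to be \<open>Z\<^sub>2\<close>.  Here and below, an equation of normal
  forms is checked by expanding the law: with \<open>s = 2 r\<close> the difference of the exponents becomes a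
  polynomial each of whose monomials is divisible by \<open>N = 8 r\<^sup>2\<close>.
\<close>

lemma deep_mult_left:
  "nf (2 * (s * a)) (2 * (s * b)) (s * c) \<cdot> nf i j k
     = nf (2 * (s * a) + i) (2 * (s * b) + j) (s * c + k - 2 * (s * b) * i)"
  unfolding nf_mult_bin bin_double
  by (rule R.triple_cong; simp add: expand; (intro dvd_add dvd_diff; simp)?)

lemma deep_mult_right:
  "nf i j k \<cdot> nf (2 * (s * a)) (2 * (s * b)) (s * c)
     = nf (2 * (s * a) + i) (2 * (s * b) + j) (s * c + k - 2 * (s * a) * j)"
  unfolding nf_mult_bin bin_double
  by (rule R.triple_cong; simp add: expand; (intro dvd_add dvd_diff; simp)?)

lemma nf_pow_left:
  "nf (2 * (s * u)) v (s * w) [^]\<^bsub>H\<^esub> n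
     = nf (n * (2 * (s * u))) (n * v) (n * (s * w) - 2 * (s * u) * v * bin n)" for n :: int
proof (rule H.int_pow_unique)
  fix n :: int
  show "nf ((n + 1) * (2 * (s * u))) ((n + 1) * v) ((n + 1) * (s * w) - 2 * (s * u) * v * bin (n + 1))
     = nf (n * (2 * (s * u))) (n * v) (n * (s * w) - 2 * (s * u) * v * bin n) \<cdot> nf (2 * (s * u)) v (s * w)"
    unfolding nf_mult_bin bin_double bin_add
    by (rule R.triple_cong; simp add: expand; (intro dvd_add dvd_diff; simp)?)
qed (simp_all add: nf_one)

lemma nf_pow_right:
  "nf u (2 * (s * v)) (s * w) [^]\<^bsub>H\<^esub> n
     = nf (n * u) (n * (2 * (s * v))) (n * (s * w) - u * (2 * (s * v)) * bin n)" for n :: int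
proof (rule H.int_pow_unique)
  fix n :: int
  have e: "n * (2 * (s * v)) = 2 * (s * (n * v))" by simp
  show "nf ((n + 1) * u) ((n + 1) * (2 * (s * v))) ((n + 1) * (s * w) - u * (2 * (s * v)) * bin (n + 1))
     = nf (n * u) (n * (2 * (s * v))) (n * (s * w) - u * (2 * (s * v)) * bin n) \<cdot> nf u (2 * (s * v)) (s * w)"
    unfolding nf_mult_bin bin_add e bin_double
    by (rule R.triple_cong; simp add: expand; (intro dvd_add dvd_diff; simp)?)
qed (simp_all add: nf_one)

text \<open>
  This formula carries the obstruction.  Since \<open>[A\<^sup>s\<^sup>d, B]\<close> contains \<open>C\<^sup>s\<^sup>d\<close>, the \<open>n\<close>-th power of \<open>A\<^sup>s\<^sup>d B\<close>
  contains \<open>C\<close> to the power of \<open>-s d\<close> times \<open>n\<close> over 2, and \<open>n = 2 s t\<close> turns this into \<open>s\<^sup>2 t d\<close> modulo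
  \<open>2 s\<^sup>2\<close>.  Squaring first makes the exponent of \<open>A\<close> divisible by \<open>2 s\<close>, after which the simpler law
  \<open>nf_pow_left\<close> applies.
\<close>

lemma nf_pow_s:
  assumes n: "n = 2 * (s * t)"
  shows "nf (s * d) (1 + 2 * (s * e)) (s * k) [^]\<^bsub>H\<^esub> n = nf 0 (2 * (s * t)) (s * (s * (t * d)))"
proof -
  let ?x = "nf (s * d) (1 + 2 * (s * e)) (s * k)"
  obtain q where h_def': "h = s * (2 * q + 1)" using l unfolding h_def by (elim oddE) simp
  have "?x \<cdot> ?x = nf (2 * (s * (d + r * d))) (2 * (1 + 2 * (s * e))) (s * (2 * k - d + s * d))"
    unfolding nf_mult_bin bin_double bin_s
    by (rule R.triple_cong; simp add: N_def h_def' s_r algebra_simps; (intro dvd_add dvd_diff; simp)?)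
  then have sq: "?x [^]\<^bsub>H\<^esub> (2::int) = nf (2 * (s * (d + r * d))) (2 * (1 + 2 * (s * e))) (s * (2 * k - d + s * d))"
    using H.int_pow_mult[of ?x 1 1] by simp
  have "?x [^]\<^bsub>H\<^esub> n = (?x [^]\<^bsub>H\<^esub> (2::int)) [^]\<^bsub>H\<^esub> (s * t)"
    by (simp add: H.int_pow_pow n)
  also have "\<dots> = nf 0 (2 * (s * t)) (s * (s * (t * d)))"
    unfolding sq nf_pow_left bin_s
    by (rule R.triple_cong; simp add: expand; (intro dvd_add dvd_diff; simp)?)
  finally show ?thesis .
qed

lemma coprime_l: "coprime l s" 
  using l by (simp add: s_def)

lemma s_dvdI: "N dvd 2 * (s * (l * x)) \<Longrightarrow> s dvd x"
proof -
  assume "N dvd 2 * (s * (l * x))"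
  then have "(2 * s) * s dvd (2 * s) * (l * x)" by (simp add: N_def mult.assoc)
  then have "s dvd l * x" by (simp only: dvd_mult_cancel_left) simp
  then show "s dvd x" using coprime_l by (metis coprime_commute coprime_dvd_mult_right_iff)
qed

lemma two_s_dvdI: "N dvd s * (l * (x * (x - 1))) \<Longrightarrow> even x \<Longrightarrow> 2 * s dvd x"
proof -
  assume "N dvd s * (l * (x * (x - 1)))" and x: "even x"
  then have "s * (2 * s) dvd s * (l * (x * (x - 1)))" by (simp add: N_def ac_simps)
  then have "2 * s dvd (l * (x - 1)) * x" by (simp only: dvd_mult_cancel_left) (simp add: ac_simps)
  moreover have "coprime (2 * s) (l * (x - 1))"
  proof -
    have "coprime (2 ^ m) (l * (x - 1))" using l x by simp
    then show ?thesis by (simp add: two_s)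
  qed
  ultimately show "2 * s dvd x" by (metis coprime_dvd_mult_right_iff)
qed

lemma nf_mult_A: "nf i j k \<cdot> A = nf (i + 1 - 2 * (s * (l * k))) (j - s * (l * (j * (j - 1)))) (k - j + 2 * h * j * k)"
  using nf_mult[of i j k 1 0 0] by (simp add: nf_A h_def algebra_simps)

lemma A_mult_nf: "A \<cdot> nf i j k = nf (i + 1) j k"
  using nf_mult_bin[of 1 0 0 i j k] by (simp add: nf_A algebra_simps)

lemma nf_mult_B: "nf i j k \<cdot> B = nf i (j + 1 + 2 * h * k) k"
  using nf_mult_bin[of i j k 0 1 0] by (simp add: nf_B algebra_simps)

lemma B_mult_nf: "B \<cdot> nf i j k
   = nf (i + s * (l * (i * (i - 1)))) (j + 1 - 2 * h * i * j) (k - i - s * (l * (i * (i - 1))))"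
  using nf_mult[of 0 1 0 i j k] by (simp add: nf_B h_def algebra_simps)

lemma center_commute: "nf 0 0 (s * t) \<cdot> nf i j k = nf i j (k + s * t)"
  "nf i j k \<cdot> nf 0 0 (s * t) = nf i j (k + s * t)"
  using deep_mult_left[of 0 0 t i j k] deep_mult_right[of i j k 0 0 t] by (simp_all add: add.commute)

lemma upper_central_1_commute:
  "x \<in> upper_central H 1 \<longleftrightarrow> x \<in> carrier H \<and> (\<forall>y\<in>carrier H. x \<cdot> y = y \<cdot> x)"
  unfolding H.upper_central_1 center_def by blast

lemma upper_central_2_commute:
  "x \<in> upper_central H 2 \<longleftrightarrow> x \<in> carrier H \<and>
     (\<forall>y\<in>carrier H. \<exists>z\<in>upper_central H 1. x \<cdot> y = z \<cdot> (y \<cdot> x))"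
  using H.upper_central_Suc_iff[of x 1] unfolding Suc_1 .

lemma upper_central_3_commute:
  "x \<in> upper_central H 3 \<longleftrightarrow> x \<in> carrier H \<and>
     (\<forall>y\<in>carrier H. \<exists>z\<in>upper_central H 2. x \<cdot> y = z \<cdot> (y \<cdot> x))"
proof -
  have "Suc 2 = 3" by simp
  then show ?thesis using H.upper_central_Suc_iff[of x 2] by (simp only:)
qed

text \<open>
  Comparing the products with \<open>A\<close> and \<open>B\<close> on either side gives the conditions; they suffice, because
  \<open>C\<^sup>s\<close> is central.
\<close>

lemma upper_central_1_iff:
  "nf i j k \<in> upper_central H 1 \<longleftrightarrow> N dvd i \<and> N dvd j \<and> s dvd k"
proof
  assume "nf i j k \<in> upper_central H 1"
  then have "nf i j k \<cdot> A = A \<cdot> nf i j k" "nf i j k \<cdot> B = B \<cdot> nf i j k"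
    unfolding upper_central_1_commute by (simp_all del: upper_central.simps)
  then have 1: "N dvd 2 * (s * (l * k))" "N dvd 2 * h * j * k - j"
    "N dvd s * (l * (i * (i - 1)))" "N dvd i + s * (l * (i * (i - 1)))"
    unfolding nf_mult_A A_mult_nf nf_mult_B B_mult_nf nf_eq_iff
    by (auto simp: cong_iff_dvd_diff dvd_diff_commute algebra_simps)
  have "N dvd j * (2 * (s * (l * k))) - (2 * h * j * k - j)"
    by (rule dvd_diff[OF dvd_mult[OF 1(1)] 1(2)])
  then have "N dvd j" by (simp add: h_def algebra_simps)
  moreover have "N dvd i" using 1(3,4) by (metis dvd_add_left_iff)
  ultimately show "N dvd i \<and> N dvd j \<and> s dvd k" using s_dvdI[OF 1(1)] by blast
next
  assume a: "N dvd i \<and> N dvd j \<and> s dvd k"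
  then obtain t where t: "k = s * t" by blast
  have "nf i j k = nf 0 0 (s * t)" using a by (intro R.triple_cong) (simp_all add: t)
  then show "nf i j k \<in> upper_central H 1"
    unfolding upper_central_1_commute using nf_surj center_commute by (metis R.triple_closed)
qed

lemma two_s_N: "2 * s dvd N" "s dvd N" "s dvd h"
  by (simp_all add: N_def h_def)

text \<open>
  Commuting with \<open>A\<close> and \<open>B\<close> up to a power of \<open>C\<^sup>s\<close> first makes \<open>i\<close> and \<open>j\<close> divisible by \<open>s\<close>, hence
  even; then \<open>N\<close> dividing \<open>h j (j - 1)\<close> forces \<open>2 s\<close> to divide \<open>j\<close>, as \<open>l (j - 1)\<close> is odd, and
  likewise for \<open>i\<close>.
\<close>

lemma upper_central_2_iff:
  "nf i j k \<in> upper_central H 2 \<longleftrightarrow> 2 * s dvd i \<and> 2 * s dvd j \<and> s dvd k"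
proof
  assume x: "nf i j k \<in> upper_central H 2"
  have com: "\<exists>t. nf i j k \<cdot> y = nf 0 0 (s * t) \<cdot> (y \<cdot> nf i j k)" if "y \<in> carrier H" for y
  proof -
    note x[unfolded upper_central_2_commute, THEN conjunct2]
    from bspec[OF this that] obtain z
      where z: "z \<in> upper_central H 1" "nf i j k \<cdot> y = z \<cdot> (y \<cdot> nf i j k)" ..
    have "z \<in> carrier H" using z(1) unfolding upper_central_1_commute by blast
    then obtain a b c where abc: "z = nf a b c" using nf_surj by blast
    have d: "N dvd a" "N dvd b" "s dvd c" using z(1) unfolding abc upper_central_1_iff by auto
    then obtain t where "c = s * t" by blast
    then have "z = nf 0 0 (s * t)" unfolding abc using d by (intro R.triple_cong) simp_all
    then show ?thesis using z(2) by blast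
  qed
  obtain t where "nf i j k \<cdot> A = nf 0 0 (s * t) \<cdot> (A \<cdot> nf i j k)" using com[of A] by auto
  then have 1: "N dvd 2 * (s * (l * k))" "N dvd s * (l * (j * (j - 1)))" "N dvd 2 * h * j * k - j - s * t"
    unfolding nf_mult_A A_mult_nf center_commute nf_eq_iff
    by (auto simp: cong_iff_dvd_diff dvd_diff_commute algebra_simps)
  obtain t' where "nf i j k \<cdot> B = nf 0 0 (s * t') \<cdot> (B \<cdot> nf i j k)" using com[of B] by auto
  then have 2: "N dvd s * (l * (i * (i - 1)))" "N dvd i + s * (l * (i * (i - 1))) - s * t'"
    unfolding nf_mult_B B_mult_nf center_commute nf_eq_iff
    by (auto simp: cong_iff_dvd_diff dvd_diff_commute algebra_simps)
  have "s dvd (s * (2 * l * j * k - t)) - (2 * h * j * k - j - s * t)"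
    by (rule dvd_diff[OF dvd_triv_left dvd_trans[OF two_s_N(2) 1(3)]])
  then have "s dvd j" by (simp add: h_def algebra_simps)
  then have j: "even j" using s_even by (meson dvd_trans)
  have "s dvd (i + s * (l * (i * (i - 1))) - s * t') - s * (l * (i * (i - 1)) - t')"
    by (rule dvd_diff[OF dvd_trans[OF two_s_N(2) 2(2)] dvd_triv_left])
  then have "s dvd i" by (simp add: algebra_simps)
  then have i: "even i" using s_even by (meson dvd_trans)
  show "2 * s dvd i \<and> 2 * s dvd j \<and> s dvd k"
    using s_dvdI[OF 1(1)] two_s_dvdI[OF 1(2) j] two_s_dvdI[OF 2(1) i] by blast
next
  assume "2 * s dvd i \<and> 2 * s dvd j \<and> s dvd k"
  then obtain a b c where abc: "i = 2 * (s * a)" "j = 2 * (s * b)" "k = s * c"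
    by (auto simp: dvd_def mult.assoc)
  have "\<exists>z\<in>upper_central H 1. nf i j k \<cdot> y = z \<cdot> (y \<cdot> nf i j k)" if "y \<in> carrier H" for y
  proof -
    obtain u v w where y: "y = nf u v w" using nf_surj[OF \<open>y \<in> carrier H\<close>] by blast
    have "nf i j k \<cdot> y = nf 0 0 (s * (2 * (a * v - b * u))) \<cdot> (y \<cdot> nf i j k)"
      unfolding y abc deep_mult_left deep_mult_right center_commute by (simp add: algebra_simps)
    moreover have "nf 0 0 (s * (2 * (a * v - b * u))) \<in> upper_central H 1"
      unfolding upper_central_1_iff by simp
    ultimately show ?thesis by blast
  qed
  then show "nf i j k \<in> upper_central H 2"
    unfolding upper_central_2_commute by (simp del: upper_central.simps)
qed

text \<open>
  Modulo \<open>Z\<^sub>2\<close> the corrections vanish and \<open>H\<close> is a Heisenberg group.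
\<close>

lemma mod_mult:
  assumes "nf i j k \<cdot> nf i' j' k' = nf I J K"
  shows "[I = i + i'] (mod 2 * s)" "[J = j + j'] (mod 2 * s)" "[K = k + k' - i' * j] (mod s)"
proof -
  have d: "[x + 2 * h * y = x] (mod 2 * s)" "[x + 2 * h * y = x] (mod s)" for x y
    by (simp_all add: cong_iff_dvd_diff h_def)
  have "[I = i + i' + 2 * h * (bin i' * j - i' * k)] (mod N)"
    "[J = j + j' + 2 * h * (j' * (k - i' * j) - i' * bin j)] (mod N)"
    "[K = k + k' - i' * j + 2 * h * (i' * j * k - bin i' * bin (j + 1))] (mod N)"
    using assms unfolding nf_mult_bin nf_eq_iff by (simp_all add: cong_sym)
  from cong_trans[OF cong_dvd_modulus[OF this(1) two_s_N(1)] d(1)]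
    cong_trans[OF cong_dvd_modulus[OF this(2) two_s_N(1)] d(1)]
    cong_trans[OF cong_dvd_modulus[OF this(3) two_s_N(2)] d(2)]
  show "[I = i + i'] (mod 2 * s)" "[J = j + j'] (mod 2 * s)" "[K = k + k' - i' * j] (mod s)" .
qed

lemma coset_2:
  assumes "[i = i'] (mod 2 * s)" "[j = j'] (mod 2 * s)" "[k = k'] (mod s)"
  shows "\<exists>z\<in>upper_central H 2. nf i j k = z \<cdot> nf i' j' k'"
proof -
  obtain a b c where "i = i' + 2 * s * a" "j = j' + 2 * s * b" "k = k' + s * c"
    using assms by (metis cong_iff_lin cong_sym)
  then have "nf i j k = nf (2 * (s * a)) (2 * (s * b)) (s * (c + 2 * b * i')) \<cdot> nf i' j' k'"
    unfolding deep_mult_left by (simp add: algebra_simps)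
  moreover have "nf (2 * (s * a)) (2 * (s * b)) (s * (c + 2 * b * i')) \<in> upper_central H 2"
    unfolding upper_central_2_iff by simp
  ultimately show ?thesis by blast
qed

lemma upper_central_closed: "z \<in> upper_central H i \<Longrightarrow> z \<in> carrier H"
  by (rule subgroup.mem_carrier[OF normal_imp_subgroup[OF H.upper_central_normal]])

text \<open>
  In the Heisenberg group \<open>H / Z\<^sub>2\<close>, the commutators of \<open>A\<^sup>i B\<^sup>j C\<^sup>k\<close> with \<open>A\<close> and \<open>B\<close> are the powers of \<open>C\<close>
  with exponents \<open>-j\<close> and \<open>i\<close>, and \<open>C\<close> has order \<open>s\<close>.
\<close>

lemma upper_central_3_iff: "nf i j k \<in> upper_central H 3 \<longleftrightarrow> s dvd i \<and> s dvd j"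
proof
  assume x: "nf i j k \<in> upper_central H 3"
  have com: "\<exists>a b c. nf i j k \<cdot> y = nf (2 * (s * a)) (2 * (s * b)) (s * c) \<cdot> (y \<cdot> nf i j k)"
    if "y \<in> carrier H" for y
  proof -
    note x[unfolded upper_central_3_commute, THEN conjunct2]
    from bspec[OF this that] obtain z
      where z: "z \<in> upper_central H 2" "nf i j k \<cdot> y = z \<cdot> (y \<cdot> nf i j k)" ..
    obtain u v w where uvw: "z = nf u v w" using nf_surj[OF upper_central_closed[OF z(1)]] by blast
    then obtain a b c where "u = 2 * s * a" "v = 2 * s * b" "w = s * c"
      using z(1) unfolding uvw upper_central_2_iff by (auto elim!: dvdE)
    then have "z = nf (2 * (s * a)) (2 * (s * b)) (s * c)" by (simp add: uvw mult.assoc)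
    then show ?thesis using z(2) by blast
  qed
  obtain a b c where 1: "nf i j k \<cdot> nf 1 0 0
      = nf (2 * (s * a)) (2 * (s * b)) (s * c) \<cdot> (nf 1 0 0 \<cdot> nf i j k)"
    using com[of "nf 1 0 0"] by auto
  obtain a' b' c' where 2: "nf i j k \<cdot> nf 0 1 0
      = nf (2 * (s * a')) (2 * (s * b')) (s * c') \<cdot> (nf 0 1 0 \<cdot> nf i j k)"
    using com[of "nf 0 1 0"] by auto
  have third: "[k - i' * j = k - i * j'] (mod s)"
    if eq: "nf i j k \<cdot> nf i' j' 0
      = nf (2 * (s * a)) (2 * (s * b)) (s * c) \<cdot> (nf i' j' 0 \<cdot> nf i j k)" for i' j' a b c
  proof -
    obtain I J K where IJK: "nf i' j' 0 \<cdot> nf i j k = nf I J K"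
      using nf_surj[of "nf i' j' 0 \<cdot> nf i j k"] by auto
    have "[s * c + K - 2 * (s * b) * I = k + 0 - i' * j] (mod s)"
      using mod_mult(3)[OF eq[unfolded IJK deep_mult_left]] .
    moreover have "[s * c + K - 2 * (s * b) * I = K] (mod s)"
      by (simp add: cong_iff_dvd_diff)
    moreover have "[K = 0 + k - i * j'] (mod s)" using mod_mult(3)[OF IJK] .
    ultimately show ?thesis by (metis cong_sym cong_trans add_0 add_0_right)
  qed
  have "s dvd j" using third[OF 1] by (simp add: cong_iff_dvd_diff)
  moreover have "s dvd i" using third[OF 2] by (simp add: cong_iff_dvd_diff)
  ultimately show "s dvd i \<and> s dvd j" by simp
next
  assume d: "s dvd i \<and> s dvd j"
  have "\<exists>z\<in>upper_central H 2. nf i j k \<cdot> y = z \<cdot> (y \<cdot> nf i j k)" if y: "y \<in> carrier H" for y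
  proof -
    obtain u v w where uvw: "y = nf u v w" using nf_surj[OF y] by blast
    obtain I J K where 1: "nf i j k \<cdot> nf u v w = nf I J K"
      using nf_surj[of "nf i j k \<cdot> nf u v w"] by auto
    obtain I' J' K' where 2: "nf u v w \<cdot> nf i j k = nf I' J' K'"
      using nf_surj[of "nf u v w \<cdot> nf i j k"] by auto
    have "[I = I'] (mod 2 * s)" "[J = J'] (mod 2 * s)"
      using mod_mult(1,2)[OF 1] mod_mult(1,2)[OF 2] by (metis cong_sym cong_trans add.commute)+
    moreover have "[K = K'] (mod s)"
    proof -
      have "[k + w - u * j = w + k - i * v] (mod s)"
        using d by (simp add: cong_iff_dvd_diff)
      then show ?thesis using mod_mult(3)[OF 1] mod_mult(3)[OF 2] by (metis cong_sym cong_trans)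
    qed
    ultimately show ?thesis unfolding uvw 1 2 by (rule coset_2)
  qed
  then show "nf i j k \<in> upper_central H 3" unfolding upper_central_3_commute by (simp del: upper_central.simps)
qed

lemma coset_3:
  assumes "[i = i'] (mod s)" "[j = j'] (mod s)"
  shows "\<exists>z\<in>upper_central H 3. nf i j k = z \<cdot> nf i' j' k'"
proof -
  obtain a b c where abc: "nf i j k \<cdot> inv\<^bsub>H\<^esub> nf i' j' k' = nf a b c"
    using nf_surj[of "nf i j k \<cdot> inv\<^bsub>H\<^esub> nf i' j' k'"] by auto
  then have eq: "nf a b c \<cdot> nf i' j' k' = nf i j k"
    by (simp add: H.inv_solve_right')
  have "[i = a + i'] (mod s)" "[j = b + j'] (mod s)"
    using mod_mult(1,2)[OF eq] by (auto elim: cong_dvd_modulus)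
  then have "s dvd a" "s dvd b"
    using assms by (metis cong_add_rcancel_0 cong_0_iff cong_sym cong_trans)+
  then have "nf a b c \<in> upper_central H 3" by (simp add: upper_central_3_iff)
  then show ?thesis using eq by metis
qed

section \<open>Pairs of generators\<close>

lemma rel_pairI:
  assumes "a \<in> carrier H" "b \<in> carrier H" "c \<in> carrier H"
    "a \<cdot> b = b \<cdot> a \<cdot> c" "a \<cdot> c = c \<cdot> a [^]\<^bsub>H\<^esub> (1 + 2 * h)"
    "c \<cdot> b = b [^]\<^bsub>H\<^esub> (1 + 2 * h) \<cdot> c" "a [^]\<^bsub>H\<^esub> N = \<one>\<^bsub>H\<^esub>" "b [^]\<^bsub>H\<^esub> N = \<one>\<^bsub>H\<^esub>"
  shows "rel_pair H h N a b c"
  using assms N_pos N_dvd by unfold_locales simp_all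

text \<open>
  Factors in \<open>Z\<^sub>2\<close> only change \<open>[A, B]\<close> by a central element, commute with \<open>C\<close>, and disappear in
  \<open>2 h\<close>-th powers; this is why all these pairs satisfy the relations.
\<close>

lemma deep_pair:
  "rel_pair H h N (nf (1 + 2 * (s * a)) (2 * (s * b)) (s * c)) (nf (2 * (s * d)) (1 + 2 * (s * e)) (s * f))
     (nf 0 0 (1 + 2 * (s * (a + e))))"
proof (rule rel_pairI)
  let ?A = "nf (1 + 2 * (s * a)) (2 * (s * b)) (s * c)"
    and ?B = "nf (2 * (s * d)) (1 + 2 * (s * e)) (s * f)" and ?C = "nf 0 0 (1 + 2 * (s * (a + e)))"
  have AB: "?A \<cdot> ?B = nf (1 + 2 * (s * a) + 2 * (s * d)) (1 + 2 * (s * b) + 2 * (s * e)) (s * (c + f))"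
    unfolding nf_mult_bin bin_double
    by (rule R.triple_cong; simp add: expand; (intro dvd_add dvd_diff; simp)?)
  have BA: "?B \<cdot> ?A = nf (1 + 2 * (s * a) + 2 * (s * d)) (1 + 2 * (s * b) + 2 * (s * e))
      (s * (c + f) - (1 + 2 * (s * (a + e))))"
    unfolding nf_mult_bin bin_double
    by (rule R.triple_cong; simp add: expand; (intro dvd_add dvd_diff; simp)?)
  show "?A \<cdot> ?B = ?B \<cdot> ?A \<cdot> ?C"
    unfolding AB BA unfolding nf_mult_bin by simp
  have pA: "?A [^]\<^bsub>H\<^esub> (1 + 2 * h) = nf (1 + 2 * (s * a) + 2 * h) (2 * (s * b)) (s * c)"
    unfolding nf_pow_right bin_double
    by (rule R.triple_cong; simp add: expand; (intro dvd_add dvd_diff; simp)?)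
  have pB: "?B [^]\<^bsub>H\<^esub> (1 + 2 * h) = nf (2 * (s * d)) (1 + 2 * (s * e) + 2 * h) (s * f)"
    unfolding nf_pow_left bin_double
    by (rule R.triple_cong; simp add: expand; (intro dvd_add dvd_diff; simp)?)
  show "?A \<cdot> ?C = ?C \<cdot> ?A [^]\<^bsub>H\<^esub> (1 + 2 * h)"
    unfolding pA nf_mult_bin bin_double
    by (rule R.triple_cong; simp add: expand; (intro dvd_add dvd_diff; simp)?)
  show "?C \<cdot> ?B = ?B [^]\<^bsub>H\<^esub> (1 + 2 * h) \<cdot> ?C"
    unfolding pB nf_mult_bin bin_double
    by (rule R.triple_cong; simp add: expand; (intro dvd_add dvd_diff; simp)?)
  have bN: "bin N = s * s * (N - 1)" using bin_double(1)[of "s * s"] by (simp add: N_def)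
  show "?A [^]\<^bsub>H\<^esub> N = \<one>\<^bsub>H\<^esub>" "?B [^]\<^bsub>H\<^esub> N = \<one>\<^bsub>H\<^esub>"
    unfolding nf_pow_right nf_pow_left bN nf_one
    by (rule R.triple_cong; simp add: expand; (intro dvd_add dvd_diff; simp)?)+
qed simp_all

lemma nf_pow_s_h:
  "nf (s * d) (1 + 2 * (s * e)) (s * k) [^]\<^bsub>H\<^esub> (1 + 2 * h)
     = nf (s * d) (1 + 2 * (s * e) + 2 * h) (s * k + s * (s * d))"
proof -
  let ?x = "nf (s * d) (1 + 2 * (s * e)) (s * k)"
  have "?x [^]\<^bsub>H\<^esub> (1 + 2 * h) = ?x \<cdot> ?x [^]\<^bsub>H\<^esub> (2 * (s * l))"
    using H.int_pow_mult[of ?x 1 "2 * h"] by (simp add: h_def)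
  also have "?x [^]\<^bsub>H\<^esub> (2 * (s * l)) = nf (2 * (s * 0)) (2 * (s * l)) (s * (s * (l * d)))"
    using nf_pow_s[of "2 * (s * l)" l d e k] by simp
  also have "?x \<cdot> \<dots> = nf (s * d) (1 + 2 * (s * e) + 2 * h) (s * k + s * (s * d))"
    unfolding deep_mult_right
  proof (rule R.triple_cong)
    obtain q where q: "l = 2 * q + 1" using l by (elim oddE)
    show "N dvd s * (s * (l * d)) + s * k - 2 * (s * 0) * (1 + 2 * (s * e)) - (s * k + s * (s * d))"
      by (rule dvdI[of _ _ "q * d"]) (simp add: N_def q algebra_simps)
  qed (simp_all add: h_def)
  finally show ?thesis .
qed

text \<open>
  The commutator \<open>w\<close> of the pair is \<open>B\<close> to the power \<open>s\<^sup>2 e\<close> times a power of \<open>C\<close>.  Conjugating the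
  first element of the pair by it produces \<open>C\<close> to the power \<open>s\<^sup>2 e\<close>, which the first relation does not
  permit unless \<open>e\<close> is even.  Then \<open>w\<close> is a power of \<open>C\<close>, and the second relation leaves the factor
  \<open>C\<close> to the power \<open>s\<^sup>2 d\<close> of \<open>nf_pow_s_h\<close> unmatched unless \<open>d\<close> is even.
\<close>

lemma pair_parity:
  assumes "rel_pair H h N (nf (1 + 2 * (s * a)) (2 * (s * b)) (s * c)) (nf (s * d) (1 + s * e) (s * f)) w"
  shows "even d" "even e"
proof -
  let ?A = "nf (1 + 2 * (s * a)) (2 * (s * b)) (s * c)" and ?B = "nf (s * d) (1 + s * e) (s * f)"
  let ?z = "1 + 2 * (s * a) + s * e"
  interpret P: rel_pair H h N ?A ?B w by (rule assms)
  obtain q where hq: "h = s * (2 * q + 1)" using l unfolding h_def by (elim oddE) simp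
  have AB: "?A \<cdot> ?B = nf (1 + 2 * (s * a) + s * d) (1 + 2 * (s * b) + s * e) (s * (c + f))"
    unfolding nf_mult_bin bin_double bin_s
    by (rule R.triple_cong; simp add: expand; (intro dvd_add dvd_diff; simp)?)
  have BA: "?B \<cdot> ?A = nf (1 + 2 * (s * a) + s * d) (1 + 2 * (s * b) + s * e - s * (s * e)) (s * (c + f) - ?z)"
    unfolding nf_mult_bin bin_double bin_s
    by (rule R.triple_cong; simp add: N_def hq s_r algebra_simps; (intro dvd_add dvd_diff; simp)?)
  have BAC: "?B \<cdot> ?A \<cdot> nf 0 (s * (s * e)) ?z = nf (1 + 2 * (s * a) + s * d) (1 + 2 * (s * b) + s * e) (s * (c + f))"
    unfolding BA unfolding nf_mult_bin
    by (rule R.triple_cong; simp add: expand; (intro dvd_add dvd_diff; simp)?)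
  have "?B \<cdot> ?A \<cdot> w = ?B \<cdot> ?A \<cdot> nf 0 (s * (s * e)) ?z"
    unfolding BAC AB[symmetric] by (rule P.ab[symmetric])
  then have w: "w = nf 0 (s * (s * e)) ?z"
    by (rule H.l_cancel) simp_all
  have pA: "?A [^]\<^bsub>H\<^esub> (1 + 2 * h) = nf (1 + 2 * (s * a) + 2 * h) (2 * (s * b)) (s * c)"
    unfolding nf_pow_right bin_double
    by (rule R.triple_cong; simp add: expand; (intro dvd_add dvd_diff; simp)?)
  have Aw: "?A \<cdot> nf 0 (s * (s * e)) ?z = nf (1 + 2 * (s * a)) (2 * (s * b) + s * (s * e)) (s * c + ?z)"
    unfolding nf_mult_bin
    by (rule R.triple_cong; simp add: expand; (intro dvd_add dvd_diff; simp)?)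
  have wA: "nf 0 (s * (s * e)) ?z \<cdot> nf (1 + 2 * (s * a) + 2 * h) (2 * (s * b)) (s * c)
     = nf (1 + 2 * (s * a)) (2 * (s * b) + s * (s * e)) (s * c + ?z - s * (s * e))"
  proof -
    have i: "1 + 2 * (s * a) + 2 * h = 1 + 2 * (s * (a + l))" by (simp add: h_def algebra_simps)
    show ?thesis unfolding i nf_mult_bin bin_s bin_double
      by (rule R.triple_cong; simp add: expand; (intro dvd_add dvd_diff; simp)?)
  qed
  have "nf (1 + 2 * (s * a)) (2 * (s * b) + s * (s * e)) (s * c + ?z)
     = nf (1 + 2 * (s * a)) (2 * (s * b) + s * (s * e)) (s * c + ?z - s * (s * e))"
    using P.a_c unfolding w pA Aw wA .
  then have "N dvd s * (s * e)" unfolding nf_eq_iff by (simp add: cong_iff_dvd_diff)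
  then have "(s * s) * 2 dvd (s * s) * e" by (simp add: N_def ac_simps)
  then show "even e" by (simp only: dvd_mult_cancel_left) simp
  then obtain e' where e: "e = 2 * e'" by blast
  have w': "w = nf 0 0 ?z"
    unfolding w by (rule R.triple_cong) (simp_all add: e N_def)
  have B: "?B = nf (s * d) (1 + 2 * (s * e')) (s * f)" by (simp add: e mult.left_commute)
  have wB: "nf 0 0 ?z \<cdot> nf (s * d) (1 + 2 * (s * e')) (s * f)
     = nf (s * d) (1 + 2 * (s * e') + 2 * h) (s * f + ?z)"
    unfolding nf_mult_bin bin_s e
    by (rule R.triple_cong; simp add: expand; (intro dvd_add dvd_diff; simp)?)
  have Bw: "nf (s * d) (1 + 2 * (s * e') + 2 * h) (s * f + s * (s * d)) \<cdot> nf 0 0 ?z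
     = nf (s * d) (1 + 2 * (s * e') + 2 * h) (s * f + s * (s * d) + ?z)"
    unfolding nf_mult_bin by simp
  have "nf (s * d) (1 + 2 * (s * e') + 2 * h) (s * f + ?z)
      = nf (s * d) (1 + 2 * (s * e') + 2 * h) (s * f + s * (s * d) + ?z)"
    using P.c_b unfolding w' unfolding B nf_pow_s_h wB Bw .
  then have "N dvd s * (s * d)" unfolding nf_eq_iff by (simp add: cong_iff_dvd_diff)
  then have "(s * s) * 2 dvd (s * s) * d" by (simp add: N_def ac_simps)
  then show "even d" by (simp only: dvd_mult_cancel_left) simp
qed

text \<open>
  The images of \<open>A\<close> and \<open>B\<close> under \<open>\<Gamma>\<close>, and their commutator.  Since the first is \<open>A\<^sup>1\<^sup>+\<^sup>s\<close>, the
  commutator contains \<open>A\<close> to the power \<open>s\<^sup>2\<close>; conjugating the second by it produces \<open>C\<close> to the power \<open>s\<^sup>2\<close>,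
  which matches the factor that \<open>nf_pow_s_h\<close> gives with \<open>d = 1 + s\<close>.
\<close>

lemma Gamma_pair:
  "rel_pair H h N (nf (1 + s) 0 0) (nf (s * (1 + s)) 1 (s * (s - 1))) (nf (s * s) 0 (1 + s))"
proof (rule rel_pairI)
  let ?A = "nf (1 + s) 0 0" and ?B = "nf (s * (1 + s)) 1 (s * (s - 1))" and ?C = "nf (s * s) 0 (1 + s)"
  obtain q where hq: "h = s * (2 * q + 1)" using l unfolding h_def by (elim oddE) simp
  note b1 = bin_s(3)[of 1, simplified]
  have BA: "?B \<cdot> ?A = nf (1 + 2 * s) 1 (- 1 - 2 * s)"
    unfolding nf_mult_bin b1
    by (rule R.triple_cong; simp add: N_def hq s_r algebra_simps; (intro dvd_add dvd_diff; simp)?)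
  have AB: "?A \<cdot> ?B = nf (1 + 2 * s + s * s) 1 (s * s - s)"
    unfolding nf_mult_bin by (simp add: algebra_simps)
  have BAC: "nf (1 + 2 * s) 1 (- 1 - 2 * s) \<cdot> ?C = nf (1 + 2 * s + s * s) 1 (s * s - s)"
    unfolding nf_mult_bin bin_s
    by (rule R.triple_cong; simp add: expand; (intro dvd_add dvd_diff; simp)?)
  show "?A \<cdot> ?B = ?B \<cdot> ?A \<cdot> ?C" unfolding AB BA BAC ..
  have pA: "?A [^]\<^bsub>H\<^esub> n = nf (n * (1 + s)) 0 0" for n :: int
    using nf_pow_right[of "1 + s" 0 0 n] by simp
  show "?A \<cdot> ?C = ?C \<cdot> ?A [^]\<^bsub>H\<^esub> (1 + 2 * h)"
    unfolding pA nf_mult_bin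
    by (rule R.triple_cong; simp add: expand; (intro dvd_add dvd_diff; simp)?)
  have pB: "?B [^]\<^bsub>H\<^esub> (1 + 2 * h) = nf (s * (1 + s)) (1 + 2 * h) (s * (s - 1) + s * (s * (1 + s)))"
    using nf_pow_s_h[of "1 + s" 0 "s - 1"] by simp
  show "?C \<cdot> ?B = ?B [^]\<^bsub>H\<^esub> (1 + 2 * h) \<cdot> ?C"
    unfolding pB nf_mult_bin bin_s bin_double
    by (rule R.triple_cong; simp add: expand; (intro dvd_add dvd_diff; simp)?)
  show "?A [^]\<^bsub>H\<^esub> N = \<one>\<^bsub>H\<^esub>" unfolding pA nf_one by (rule R.triple_cong) simp_all
  show "?B [^]\<^bsub>H\<^esub> N = \<one>\<^bsub>H\<^esub>"
    using nf_pow_s[of N s "1 + s" 0 "s - 1"] unfolding nf_one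
    by (simp add: N_def nf_eq_iff cong_iff_dvd_diff s_r algebra_simps)
qed simp_all

lemma swap_pair: "rel_pair H h N B A (inv\<^bsub>H\<^esub> C)"
proof (rule rel_pairI)
  have i: "inv\<^bsub>H\<^esub> C = C [^]\<^bsub>H\<^esub> (- 1 :: int)" by (simp add: H.int_pow_neg)
  show "B \<cdot> A = A \<cdot> B \<cdot> inv\<^bsub>H\<^esub> C" by (simp add: R.ab H.m_assoc)
  show "inv\<^bsub>H\<^esub> C \<cdot> A = A [^]\<^bsub>H\<^esub> (1 + 2 * h) \<cdot> inv\<^bsub>H\<^esub> C"
    using R.ca[of "- 1" 1] by (simp add: i)
  have "C \<cdot> (B \<cdot> inv\<^bsub>H\<^esub> C) = B [^]\<^bsub>H\<^esub> (1 + 2 * h)"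
    using H.m_assoc[of C B "inv\<^bsub>H\<^esub> C"] by (simp add: R.c_b H.m_assoc)
  then show "B \<cdot> inv\<^bsub>H\<^esub> C = inv\<^bsub>H\<^esub> C \<cdot> B [^]\<^bsub>H\<^esub> (1 + 2 * h)"
    by (metis H.inv_mult_cancel(1) H.inv_closed H.m_closed R.ac(2,3))
qed (simp_all add: R.aN R.bN)

section \<open>Automorphisms of \<open>H\<close>\<close>

lemma hom_group_hom: "f \<in> hom H H \<Longrightarrow> group_hom H H f"
  by (simp add: group_hom_def group_hom_axioms_def H.group_axioms)

lemma subgroup_H_eq:
  assumes "subgroup S H" "A \<in> S" "B \<in> S"
  shows "S = carrier H"
proof -
  have "range (pres_gen (H_rels m l)) \<subseteq> S"
  proof
    fix x assume "x \<in> range (pres_gen (H_rels m l))"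
    then obtain g where "x = pres_gen (H_rels m l) g" by blast
    then show "x \<in> S" using assms(2,3) by (cases g) (simp_all add: H_A_def H_B_def)
  qed
  then show ?thesis
    using presented_group_subgroup_eq[of S "H_rels m l"] assms(1) unfolding H_grp_def by blast
qed

lemma hom_coset:
  assumes f: "f \<in> hom H H" and M: "M \<lhd> H"
    and gen: "\<exists>z\<in>M. f A = z \<cdot> A" "\<exists>z\<in>M. f B = z \<cdot> B"
    and x: "x \<in> carrier H"
  shows "\<exists>z\<in>M. f x = z \<cdot> x"
proof -
  interpret f: group_hom H H f by (rule hom_group_hom[OF f])
  interpret M: normal M H by (rule M)
  define S where "S = {x \<in> carrier H. M #>\<^bsub>H\<^esub> f x = M #>\<^bsub>H\<^esub> x}"
  have "subgroup S H"
  proof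
    show "S \<subseteq> carrier H" "\<one>\<^bsub>H\<^esub> \<in> S" by (auto simp: S_def)
    show "u \<cdot> v \<in> S" if "u \<in> S" "v \<in> S" for u v
      using that M.rcos_sum[of "f u" "f v"] M.rcos_sum[of u v] by (simp add: S_def)
    show "inv\<^bsub>H\<^esub> u \<in> S" if "u \<in> S" for u
      using that M.rcos_inv[of "f u"] M.rcos_inv[of u] by (simp add: S_def)
  qed
  moreover have "A \<in> S" "B \<in> S" using gen by (simp_all add: S_def H.normal_coset_eq_iff[OF M])
  ultimately have "x \<in> S" using subgroup_H_eq x by blast
  then have "M #>\<^bsub>H\<^esub> f x = M #>\<^bsub>H\<^esub> x" by (simp add: S_def)
  then show ?thesis using H.normal_coset_eq_iff[OF M, of "f x" x] x by simp
qed

lemma hom_eq_on: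
  assumes f: "f \<in> hom H H" "g \<in> hom H H" "f A = g A" "f B = g B" and x: "x \<in> carrier H"
  shows "f x = g x"
proof -
  interpret f: group_hom H H f by (rule hom_group_hom[OF f(1)])
  interpret g: group_hom H H g by (rule hom_group_hom[OF f(2)])
  have "subgroup {x \<in> carrier H. f x = g x} H" by unfold_locales auto
  then have "{x \<in> carrier H. f x = g x} = carrier H" by (rule subgroup_H_eq) (simp_all add: f(3,4))
  then show ?thesis using x by blast
qed

lemma auto_eq:
  assumes "f \<in> auto H" "g \<in> auto H" "f A = g A" "f B = g B"
  shows "f = g"
  by (rule H.auto_eqI) (use assms hom_eq_on in \<open>auto simp: H.auto_iff\<close>)

lemma H_auto_eq: "f \<in> auto H \<Longrightarrow> f A = a \<Longrightarrow> f B = b \<Longrightarrow> H_auto m l a b = f"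
  unfolding H_auto_def by (rule the_equality) (auto intro: auto_eq)

lemma nf_mod: "nf i j k = nf (i mod N) (j mod N) (k mod N)"
  by (simp add: nf_eq_iff cong_def)

lemma finite_H: "finite (carrier H)"
proof (rule finite_subset)
  show "carrier H \<subseteq> (\<lambda>(i, j, k). nf i j k) ` ({0..<N} \<times> {0..<N} \<times> {0..<N})"
  proof
    fix x assume "x \<in> carrier H"
    then obtain i j k where "x = nf (i mod N) (j mod N) (k mod N)" using nf_surj nf_mod by metis
    then show "x \<in> (\<lambda>(i, j, k). nf i j k) ` ({0..<N} \<times> {0..<N} \<times> {0..<N})"
      using N_pos by (intro image_eqI[of _ _ "(i mod N, j mod N, k mod N)"]) auto
  qed
qed simp

lemma injective_hom_auto:
  assumes f: "f \<in> hom H H" "inj_on f (carrier H)"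
  shows "restrict f (carrier H) \<in> auto H"
  unfolding H.auto_iff
proof (intro conjI)
  have im: "f ` carrier H = carrier H"
    using f by (intro endo_inj_surj finite_H) (auto simp: hom_def)
  show "restrict f (carrier H) \<in> hom H H"
    using f(1) by (simp add: hom_def Pi_def)
  show "bij_betw (restrict f (carrier H)) (carrier H) (carrier H)"
    using f(2) im by (simp add: bij_betw_def inj_on_restrict_eq)
qed simp

lemmas coset_2_gen = coset_2[of _ 1 _ 0 _ 0, unfolded nf_A] coset_2[of _ 0 _ 1 _ 0, unfolded nf_B]
lemmas coset_3_gen = coset_3[of _ 1 _ 0 _ 0, unfolded nf_A] coset_3[of _ 0 _ 1 _ 0, unfolded nf_B]

lemma A_pow: "A [^]\<^bsub>H\<^esub> n = nf n 0 0" for n :: int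
  using nf_pow_right[of 1 0 0 n] by (simp add: nf_A)

lemma B_pow: "B [^]\<^bsub>H\<^esub> n = nf 0 n 0" for n :: int
  using nf_pow_left[of 0 1 0 n] by (simp add: nf_B)

text \<open>
  Such an endomorphism is trivial modulo \<open>Z\<^sub>2\<close>, so its kernel lies in \<open>Z\<^sub>2\<close>; and it fixes \<open>Z\<^sub>2\<close>, because
  the factors in \<open>Z\<^sub>2\<close> disappear in the powers \<open>A\<^sup>2\<^sup>s\<close>, \<open>B\<^sup>2\<^sup>s\<close> and \<open>C\<^sup>s\<close>.
\<close>

lemma deep_hom_injective:
  assumes f: "f \<in> hom H H"
    and A: "f A = nf (1 + 2 * (s * a)) (2 * (s * b)) (s * c)"
    and B: "f B = nf (2 * (s * d)) (1 + 2 * (s * e)) (s * g)"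
  shows "inj_on f (carrier H)"
proof -
  interpret f: group_hom H H f by (rule hom_group_hom[OF f])
  interpret P: rel_pair H h N "f A" "f B" "nf 0 0 (1 + 2 * (s * (a + e)))"
    unfolding A B by (rule deep_pair)
  have "f (A \<cdot> B) = f (B \<cdot> A \<cdot> C)" by (simp only: R.ab)
  then have "f B \<cdot> f A \<cdot> f C = f B \<cdot> f A \<cdot> nf 0 0 (1 + 2 * (s * (a + e)))"
    by (simp flip: P.ab)
  then have C: "f C = nf 0 0 (1 + 2 * (s * (a + e)))" by (rule H.l_cancel) simp_all
  have gen: "\<exists>z\<in>upper_central H 2. f A = z \<cdot> A" "\<exists>z\<in>upper_central H 2. f B = z \<cdot> B"
    unfolding A B by (rule coset_2_gen; simp add: cong_iff_dvd_diff)+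
  have fix2: "f z = z" if z: "z \<in> upper_central H 2" for z
  proof -
    obtain i j k where ijk: "z = nf i j k" using nf_surj[OF upper_central_closed[OF z]] by blast
    then obtain u v w where "i = 2 * s * u" "j = 2 * s * v" "k = s * w"
      using z unfolding ijk upper_central_2_iff by (auto elim!: dvdE)
    then have uvw: "i = 2 * (s * u)" "j = 2 * (s * v)" "k = s * w" by simp_all
    have "f A [^]\<^bsub>H\<^esub> i = nf i 0 0"
      unfolding A nf_pow_right uvw bin_double
      by (rule R.triple_cong; simp add: expand; (intro dvd_add dvd_diff; simp)?)
    moreover have "f B [^]\<^bsub>H\<^esub> j = nf 0 j 0"
      unfolding B nf_pow_left uvw bin_double
      by (rule R.triple_cong; simp add: expand; (intro dvd_add dvd_diff; simp)?)
    moreover have "f C [^]\<^bsub>H\<^esub> k = nf 0 0 k"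
    proof -
      have "nf 0 0 x [^]\<^bsub>H\<^esub> n = nf 0 0 (n * x)" for x n :: int
        by (rule H.int_pow_unique) (simp_all add: nf_one nf_mult_bin algebra_simps)
      then show ?thesis
        unfolding C uvw
        by (simp add: nf_eq_iff cong_iff_dvd_diff N_def algebra_simps)
    qed
    ultimately have "f z = nf i 0 0 \<cdot> (nf 0 j 0 \<cdot> nf 0 0 k)"
      unfolding ijk hom_nf[OF H.group_axioms f] by simp
    then show ?thesis unfolding ijk nf_mult_bin by simp
  qed
  have "x = \<one>\<^bsub>H\<^esub>" if x: "x \<in> carrier H" "f x = \<one>\<^bsub>H\<^esub>" for x
  proof -
    interpret Z: normal "upper_central H 2" H by (rule H.upper_central_normal)
    obtain z where z: "z \<in> upper_central H 2" "f x = z \<cdot> x"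
      using hom_coset[OF f H.upper_central_normal gen x(1)] by blast
    have "x = inv\<^bsub>H\<^esub> z" using z x Z.mem_carrier[OF z(1)]
      by (metis H.inv_equality H.inv_inv H.inv_closed)
    then have "x \<in> upper_central H 2" using z(1) Z.m_inv_closed by blast
    then show ?thesis using fix2 x(2) by simp
  qed
  then show ?thesis by (simp add: f.inj_on_one_iff)
qed

lemma deep_auto:
  obtains f where "f \<in> Aut_central 2 H" "f A = nf (1 + 2 * (s * a)) (2 * (s * b)) (s * c)"
    "f B = nf (2 * (s * d)) (1 + 2 * (s * e)) (s * g)"
proof -
  obtain f where f: "f \<in> hom H H" "f A = nf (1 + 2 * (s * a)) (2 * (s * b)) (s * c)"
    "f B = nf (2 * (s * d)) (1 + 2 * (s * e)) (s * g)"
    by (rule hom_from_pair[OF H.group_axioms deep_pair[of a b c d e g]]) (rule that)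
  have gen: "\<exists>z\<in>upper_central H 2. f A = z \<cdot> A" "\<exists>z\<in>upper_central H 2. f B = z \<cdot> B"
    unfolding f(2,3) by (rule coset_2_gen; simp add: cong_iff_dvd_diff)+
  show thesis
  proof (rule that)
    show "restrict f (carrier H) \<in> Aut_central 2 H"
      unfolding H.Aut_central_iff
      using injective_hom_auto[OF f(1) deep_hom_injective[OF f]] hom_coset[OF f(1) H.upper_central_normal gen]
      by (simp del: upper_central.simps)
  qed (simp_all add: f)
qed

lemma auto_central_3I:
  assumes f: "f \<in> auto H" and A: "f A = nf i j k" "s dvd i - 1" "s dvd j"
    and B: "f B = nf i' j' k'" "s dvd i'" "s dvd j' - 1"
  shows "f \<in> Aut_central 3 H"
proof -
  have gen: "\<exists>z\<in>upper_central H 3. f A = z \<cdot> A" "\<exists>z\<in>upper_central H 3. f B = z \<cdot> B"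
    unfolding A(1) B(1) by (rule coset_3_gen; use A B in \<open>simp add: cong_iff_dvd_diff\<close>)+
  have "f \<in> hom H H" using f by (simp add: H.auto_iff)
  from hom_coset[OF this H.upper_central_normal gen] f
  show ?thesis unfolding H.Aut_central_iff by blast
qed

text \<open>
  Injectivity of \<open>\<Gamma>\<close> follows from that of its square, which is trivial modulo \<open>Z\<^sub>2\<close>: the exponents
  \<open>s\<close> double to \<open>2 s\<close> up to a term \<open>s\<^sup>2\<close>, which is a multiple of \<open>2 s\<close>.
\<close>

lemma Gamma_auto:
  shows "\<Gamma> m l \<in> Aut_central 3 H" "\<Gamma> m l A = nf (1 + s) 0 0" "\<Gamma> m l B = B \<cdot> nf s 0 0"
proof -
  obtain q where hq: "h = s * (2 * q + 1)" using l unfolding h_def by (elim oddE) simp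
  have pow: "A [^]\<^bsub>H\<^esub> (1 + 2 ^ (m - 1) :: nat) = nf (1 + s) 0 0" "A [^]\<^bsub>H\<^esub> (2 ^ (m - 1) :: nat) = nf s 0 0"
    unfolding A_pow[symmetric] by (simp_all add: s_def flip: int_pow_int)
  have B: "B \<cdot> nf s 0 0 = nf (s * (1 + s)) 1 (s * (s - 1))"
    using nf_mult_bin[of 0 1 0 s 0 0] bin_s(1)[of 1]
    by (simp add: nf_B, intro R.triple_cong; simp add: N_def hq s_r algebra_simps; (intro dvd_add dvd_diff; simp)?)
  obtain f where f: "f \<in> hom H H" "f A = nf (1 + s) 0 0" "f B = nf (s * (1 + s)) 1 (s * (s - 1))"
    by (rule hom_from_pair[OF H.group_axioms Gamma_pair]) (rule that)
  interpret f: group_hom H H f by (rule hom_group_hom[OF f(1)])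
  have ff: "f \<circ> f \<in> hom H H" using f(1) by (auto simp: hom_def Pi_def)
  have pf: "nf (1 + s) 0 0 [^]\<^bsub>H\<^esub> n = nf (n * (1 + s)) 0 0" for n :: int
    using nf_pow_right[of "1 + s" 0 0 n] by simp
  have fA: "f (nf n 0 0) = nf (n * (1 + s)) 0 0" for n
    using f.hom_int_pow[of A n] by (simp add: A_pow f pf)
  have "(f \<circ> f) A = nf (1 + 2 * (s * (1 + r))) (2 * (s * 0)) (s * 0)"
    by (simp add: f fA s_r algebra_simps)
  moreover have "(f \<circ> f) B = nf (2 * (s * (1 + r))) (1 + 2 * (s * 0)) (s * (s - 2))"
  proof -
    have "(f \<circ> f) B = f (B \<cdot> nf s 0 0)" by (simp add: f B)
    also have "\<dots> = nf (s * (1 + s)) 1 (s * (s - 1)) \<cdot> nf (s * (1 + s)) 0 0"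
      by (simp add: f fA)
    also have "\<dots> = nf (2 * (s * (1 + r))) (1 + 2 * (s * 0)) (s * (s - 2))"
      unfolding nf_mult_bin bin_s
      by (simp, intro R.triple_cong; simp add: N_def hq s_r algebra_simps; (intro dvd_add dvd_diff; simp)?)
    finally show ?thesis .
  qed
  ultimately have "inj_on (f \<circ> f) (carrier H)" by (rule deep_hom_injective[OF ff])
  then have inj: "inj_on f (carrier H)" by (rule inj_on_imageI2)
  let ?f = "restrict f (carrier H)"
  have auto: "?f \<in> auto H" by (rule injective_hom_auto[OF f(1) inj])
  have "\<Gamma> m l = ?f"
    unfolding \<Gamma>_def Let_def pow by (rule H_auto_eq[OF auto]) (simp_all add: f B)
  moreover have "?f \<in> Aut_central 3 H"
    by (rule auto_central_3I[OF auto]) (simp_all add: f, simp_all)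
  ultimately show "\<Gamma> m l \<in> Aut_central 3 H" "\<Gamma> m l A = nf (1 + s) 0 0" "\<Gamma> m l B = B \<cdot> nf s 0 0"
    by (simp_all add: f B)
qed

lemma nu_auto:
  shows "\<nu> m l \<in> auto H" "\<nu> m l A = B" "\<nu> m l B = A"
proof -
  obtain f where f: "f \<in> hom H H" "f A = B" "f B = A"
    by (rule hom_from_pair[OF H.group_axioms swap_pair]) (rule that)
  have ff: "f \<circ> f \<in> hom H H" using f(1) by (auto simp: hom_def Pi_def)
  have id: "id \<in> hom H H" by (auto simp: hom_def)
  have "f (f x) = x" if "x \<in> carrier H" for x
    using hom_eq_on[OF ff id _ _ that] by (simp add: f)
  then have "inj_on f (carrier H)" by (metis inj_onI)
  from injective_hom_auto[OF f(1) this] have auto: "restrict f (carrier H) \<in> auto H" .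
  have "\<nu> m l = restrict f (carrier H)"
    unfolding \<nu>_def by (rule H_auto_eq[OF auto]) (simp_all add: f)
  then show "\<nu> m l \<in> auto H" "\<nu> m l A = B" "\<nu> m l B = A" using auto by (simp_all add: f)
qed

lemma Gamma_nu_auto:
  shows "\<Gamma>\<nu> m l \<in> Aut_central 3 H" "\<Gamma>\<nu> m l A = nf 1 s 0"
proof -
  let ?G = "AutoGroup H"
  interpret G: group ?G by (rule H.AutoGroup)
  interpret S: normal "Aut_central 3 H" ?G by (rule H.Aut_central_normal)
  let ?n = "inv\<^bsub>?G\<^esub> (\<nu> m l)"
  note n = nu_auto(1) H.AutoGroup_inv_closed[OF nu_auto(1)]
  have g: "\<Gamma> m l \<in> auto H" using Gamma_auto(1) by (simp add: H.Aut_central_iff)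
  show "\<Gamma>\<nu> m l \<in> Aut_central 3 H"
    unfolding \<Gamma>\<nu>_def
    using S.inv_op_closed1[of "\<nu> m l" "\<Gamma> m l"] nu_auto(1) Gamma_auto(1) by (simp add: H.AutoGroup_simps)
  have nA: "?n B = A" "?n A = B"
    using H.AutoGroup_inv_apply(2)[OF nu_auto(1), of A] H.AutoGroup_inv_apply(2)[OF nu_auto(1), of B]
    by (simp_all add: nu_auto)
  interpret N: group_hom H H ?n using n(2) by (rule H.auto_hom)
  have "\<Gamma>\<nu> m l A = ?n (\<Gamma> m l B)"
    unfolding \<Gamma>\<nu>_def using n g
    by (simp add: H.AutoGroup_mult_apply H.AutoGroup_mult_closed nu_auto)
  also have "\<dots> = A \<cdot> nf 0 s 0"
    unfolding Gamma_auto(3) A_pow[symmetric] B_pow[symmetric] by (simp add: N.hom_int_pow nA)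
  also have "\<dots> = nf 1 s 0" unfolding A_mult_nf by simp
  finally show "\<Gamma>\<nu> m l A = nf 1 s 0" .
qed

end

context H_group
begin

section \<open>The parity of an automorphism\<close>

text \<open>
  A choice of coordinates; \<open>cx\<close> and \<open>cy\<close> are determined modulo \<open>N\<close>, and modulo \<open>2 s\<close> they are the two
  components of the projection onto the abelianization.
\<close>

definition crd where
  "crd x = (SOME t. x = (case t of (i, j, k) \<Rightarrow> nf i j k))"
definition cx where "cx x = fst (crd x)"
definition cy where "cy x = fst (snd (crd x))"

lemma crd: "x \<in> carrier H \<Longrightarrow> \<exists>k. x = nf (cx x) (cy x) k"
proof -
  assume "x \<in> carrier H"
  then obtain i j k where "x = nf i j k" using nf_surj by blast
  then have "x = (case (i, j, k) of (i, j, k) \<Rightarrow> nf i j k)" by simp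
  then have "x = (case crd x of (i, j, k) \<Rightarrow> nf i j k)" unfolding crd_def by (rule someI)
  then show ?thesis by (auto simp: cx_def cy_def split: prod.splits)
qed

lemma cx_nf: "[cx (nf i j k) = i] (mod 2 * s)" "[cy (nf i j k) = j] (mod 2 * s)"
proof -
  obtain k' where "nf i j k = nf (cx (nf i j k)) (cy (nf i j k)) k'" using crd[of "nf i j k"] by auto
  then have "[cx (nf i j k) = i] (mod N)" "[cy (nf i j k) = j] (mod N)"
    unfolding nf_eq_iff by (simp_all add: cong_sym)
  then show "[cx (nf i j k) = i] (mod 2 * s)" "[cy (nf i j k) = j] (mod 2 * s)"
    using cong_dvd_modulus two_s_N(1) by blast+
qed

lemma cx_mult:
  assumes "x \<in> carrier H" "y \<in> carrier H"
  shows "[cx (x \<cdot> y) = cx x + cx y] (mod 2 * s)" "[cy (x \<cdot> y) = cy x + cy y] (mod 2 * s)"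
proof -
  obtain k where "x = nf (cx x) (cy x) k" using crd[OF assms(1)] ..
  moreover obtain k' where "y = nf (cx y) (cy y) k'" using crd[OF assms(2)] ..
  moreover obtain k'' where "x \<cdot> y = nf (cx (x \<cdot> y)) (cy (x \<cdot> y)) k''"
    using crd[of "x \<cdot> y"] assms by auto
  ultimately have "nf (cx x) (cy x) k \<cdot> nf (cx y) (cy y) k' = nf (cx (x \<cdot> y)) (cy (x \<cdot> y)) k''"
    by simp
  from mod_mult(1,2)[OF this]
  show "[cx (x \<cdot> y) = cx x + cx y] (mod 2 * s)" "[cy (x \<cdot> y) = cy x + cy y] (mod 2 * s)" .
qed

lemma additive_pow:
  fixes c :: "_ \<Rightarrow> int"
  assumes mult: "\<And>x y. x \<in> carrier H \<Longrightarrow> y \<in> carrier H \<Longrightarrow> [c (x \<cdot> y) = c x + c y] (mod M)"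
    and x: "x \<in> carrier H"
  shows "[c (x [^]\<^bsub>H\<^esub> (n::int)) = n * c x] (mod M)"
proof (induction n rule: int_induct[of _ 0])
  case base
  have "[c \<one>\<^bsub>H\<^esub> = c \<one>\<^bsub>H\<^esub> + c \<one>\<^bsub>H\<^esub>] (mod M)" using mult[of "\<one>\<^bsub>H\<^esub>" "\<one>\<^bsub>H\<^esub>"] by simp
  then show ?case by (simp add: cong_iff_dvd_diff)
next
  case (step1 n)
  have "[c (x [^]\<^bsub>H\<^esub> (n + 1)) = c (x [^]\<^bsub>H\<^esub> n) + c x] (mod M)"
    using mult[of "x [^]\<^bsub>H\<^esub> n" x] x by (simp add: H.int_pow_mult)
  also have "[c (x [^]\<^bsub>H\<^esub> n) + c x = n * c x + c x] (mod M)"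
    using step1 by (intro cong_add cong_refl)
  finally show ?case by (simp add: algebra_simps)
next
  case (step2 n)
  have "[c (x [^]\<^bsub>H\<^esub> n) = c (x [^]\<^bsub>H\<^esub> (n - 1)) + c x] (mod M)"
    using mult[of "x [^]\<^bsub>H\<^esub> (n - 1)" x] x H.int_pow_mult[OF x, of "n - 1" 1] by simp
  then have "[c (x [^]\<^bsub>H\<^esub> (n - 1)) + c x = n * c x] (mod M)"
    using step2 by (metis cong_sym cong_trans)
  then have "[c (x [^]\<^bsub>H\<^esub> (n - 1)) + c x - c x = n * c x - c x] (mod M)"
    by (intro cong_diff cong_refl)
  then show ?case by (simp add: algebra_simps)
qed

lemma cx_hom:
  assumes f: "f \<in> hom H H"
  shows "[cx (f (nf i j k)) = i * cx (f A) + j * cx (f B)] (mod 2 * s)"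
    "[cy (f (nf i j k)) = i * cy (f A) + j * cy (f B)] (mod 2 * s)"
proof -
  interpret f: group_hom H H f by (rule hom_group_hom[OF f])
  have gen: "[c (f (nf i j k)) = i * c (f A) + j * c (f B)] (mod M)"
    if mult: "\<And>x y. x \<in> carrier H \<Longrightarrow> y \<in> carrier H \<Longrightarrow> [c (x \<cdot> y) = c x + c y] (mod M)" for c :: "_ \<Rightarrow> int" and M
  proof -
    have "f A \<cdot> f B = f B \<cdot> f A \<cdot> f C"
      using arg_cong[OF R.ab, of f] by simp
    then have "[c (f A) + c (f B) = c (f B) + c (f A) + c (f C)] (mod M)"
      using mult[of "f A" "f B"] mult[of "f B \<cdot> f A" "f C"] mult[of "f B" "f A"]
      by (simp add: H.m_assoc cong_def) (metis mod_add_left_eq)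
    then have C: "[c (f C) = 0] (mod M)" by (simp add: cong_iff_dvd_diff)
    have "[c (f (nf i j k)) = c (f A [^]\<^bsub>H\<^esub> i) + (c (f B [^]\<^bsub>H\<^esub> j) + c (f C [^]\<^bsub>H\<^esub> k))] (mod M)"
      unfolding hom_nf[OF H.group_axioms f]
      by (rule cong_trans[OF mult cong_add[OF cong_refl mult]]) simp_all
    also have "[c (f A [^]\<^bsub>H\<^esub> i) + (c (f B [^]\<^bsub>H\<^esub> j) + c (f C [^]\<^bsub>H\<^esub> k))
        = i * c (f A) + (j * c (f B) + k * 0)] (mod M)"
      by (intro cong_add additive_pow[OF mult] cong_trans[OF additive_pow[OF mult] cong_mult[OF cong_refl C]]) simp_all
    finally show ?thesis by simp
  qed
  show "[cx (f (nf i j k)) = i * cx (f A) + j * cx (f B)] (mod 2 * s)"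
    "[cy (f (nf i j k)) = i * cy (f A) + j * cy (f B)] (mod 2 * s)"
    by (rule gen; rule cx_mult; assumption)+
qed

lemma mod_s: "[x = y] (mod 2 * s) \<Longrightarrow> [x = y] (mod s)" for x y :: int
  by (erule cong_dvd_modulus) simp

lemma aut3_coords:
  assumes "f \<in> Aut_central 3 H"
  obtains a b d e where "cx (f A) = 1 + s * a" "cy (f A) = s * b" "cx (f B) = s * d" "cy (f B) = 1 + s * e"
proof -
  have co: "s dvd cx (f x) - cx x" "s dvd cy (f x) - cy x" if x: "x \<in> carrier H" for x
  proof -
    obtain z where z: "z \<in> upper_central H 3" "f x = z \<cdot> x"
      using assms x unfolding H.Aut_central_iff by blast
    obtain i j k where ijk: "z = nf i j k" using nf_surj[OF upper_central_closed[OF z(1)]] by blast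
    have d: "s dvd i" "s dvd j" using z(1) unfolding ijk upper_central_3_iff by auto
    have "[cx (f x) = i + cx x] (mod s)" "[cy (f x) = j + cy x] (mod s)"
      unfolding z(2) ijk
      by (rule mod_s, rule cong_trans[OF cx_mult(1) cong_add[OF cx_nf(1) cong_refl]], simp, rule x,
          rule mod_s, rule cong_trans[OF cx_mult(2) cong_add[OF cx_nf(2) cong_refl]], simp, rule x)
    then have "s dvd cx (f x) - (i + cx x)" "s dvd cy (f x) - (j + cy x)" by (simp_all add: cong_iff_dvd_diff)
    from dvd_add[OF this(1) d(1)] dvd_add[OF this(2) d(2)]
    show "s dvd cx (f x) - cx x" "s dvd cy (f x) - cy x" by (simp_all add: algebra_simps)
  qed
  have g: "s dvd cx A - 1" "s dvd cy A" "s dvd cx B" "s dvd cy B - 1"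
    using mod_s[OF cx_nf(1)[of 1 0 0]] mod_s[OF cx_nf(2)[of 1 0 0]]
      mod_s[OF cx_nf(1)[of 0 1 0]] mod_s[OF cx_nf(2)[of 0 1 0]]
    by (simp_all add: nf_A nf_B cong_iff_dvd_diff)
  have "s dvd cx (f A) - 1" using dvd_add[OF co(1)[of A] g(1)] by simp
  moreover have "s dvd cy (f A)" using dvd_add[OF co(2)[of A] g(2)] by simp
  moreover have "s dvd cx (f B)" using dvd_add[OF co(1)[of B] g(3)] by simp
  moreover have "s dvd cy (f B) - 1" using dvd_add[OF co(2)[of B] g(4)] by simp
  ultimately obtain a b d e where "cx (f A) - 1 = s * a" "cy (f A) = s * b" "cx (f B) = s * d" "cy (f B) - 1 = s * e"
    by (elim dvdE) blast
  then show thesis by (intro that[of a b d e]) simp_all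
qed

text \<open>
  The parities of \<open>a\<close> and \<open>b\<close> in the notation of \<open>aut3_coords\<close>.
\<close>

definition parity where
  "parity f = ((cx (f A) - 1) div s mod 2, cy (f A) div s mod 2)"

lemma parity_eq: "cx (f A) = 1 + s * a \<Longrightarrow> cy (f A) = s * b \<Longrightarrow> parity f = (a mod 2, b mod 2)"
  by (simp add: parity_def)

lemma scaled_parity: "[s * a = s * b] (mod 2 * s) \<longleftrightarrow> a mod 2 = b mod 2" for a b :: int
proof -
  have "[s * a = s * b] (mod 2 * s) \<longleftrightarrow> s * 2 dvd s * (a - b)"
    by (simp add: cong_iff_dvd_diff algebra_simps)
  also have "\<dots> \<longleftrightarrow> 2 dvd a - b" by (simp only: dvd_mult_cancel_left) simp
  finally show ?thesis by (simp add: mod_eq_dvd_iff)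
qed

text \<open>
  On the abelianization the two automorphisms act by matrices congruent to the identity modulo \<open>s\<close>,
  and \<open>s\<^sup>2\<close> vanishes modulo \<open>2 s\<close>, so that the deviations from the identity add up.
\<close>

lemma parity_mult:
  assumes f: "f \<in> Aut_central 3 H" and g: "g \<in> Aut_central 3 H"
  shows "parity (f \<otimes>\<^bsub>AutoGroup H\<^esub> g)
     = ((fst (parity f) + fst (parity g)) mod 2, (snd (parity f) + snd (parity g)) mod 2)"
proof -
  let ?p = "f \<otimes>\<^bsub>AutoGroup H\<^esub> g"
  interpret A: group "AutoGroup H" by (rule H.AutoGroup)
  interpret S: normal "Aut_central 3 H" "AutoGroup H" by (rule H.Aut_central_normal)
  have aut: "f \<in> auto H" "g \<in> auto H" using f g by (simp_all add: H.Aut_central_iff)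
  obtain a b d e where fc: "cx (f A) = 1 + s * a" "cy (f A) = s * b" "cx (f B) = s * d" "cy (f B) = 1 + s * e"
    by (rule aut3_coords[OF f]) (rule that)
  obtain a' b' d' e' where gc: "cx (g A) = 1 + s * a'" "cy (g A) = s * b'" "cx (g B) = s * d'" "cy (g B) = 1 + s * e'"
    by (rule aut3_coords[OF g]) (rule that)
  obtain a'' b'' d'' e'' where pc: "cx (?p A) = 1 + s * a''" "cy (?p A) = s * b''"
    "cx (?p B) = s * d''" "cy (?p B) = 1 + s * e''"
    by (rule aut3_coords[OF S.m_closed[OF f g]]) (rule that)
  have fh: "f \<in> hom H H" using aut by (simp add: H.auto_iff)
  obtain k where k: "g A = nf (1 + s * a') (s * b') k" using crd[of "g A"] aut gc by auto
  have p: "?p A = f (nf (1 + s * a') (s * b') k)" using aut k by (simp add: H.AutoGroup_mult_apply)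
  have ss: "2 * s dvd s * (s * x)" for x by (simp add: s_r)
  have "[1 + s * a'' = (1 + s * a') * (1 + s * a) + s * b' * (s * d)] (mod 2 * s)"
    using cx_hom(1)[OF fh, of "1 + s * a'" "s * b'" k] unfolding p[symmetric] pc fc .
  then have "[s * a'' = s * (a + a')] (mod 2 * s)"
    using dvd_add[OF _ ss[of "a' * a + b' * d"]] unfolding cong_iff_dvd_diff
    by (fastforce simp: algebra_simps)
  then have "a'' mod 2 = (a + a') mod 2" by (simp add: scaled_parity)
  moreover have "[s * b'' = (1 + s * a') * (s * b) + s * b' * (1 + s * e)] (mod 2 * s)"
    using cx_hom(2)[OF fh, of "1 + s * a'" "s * b'" k] unfolding p[symmetric] pc fc .
  then have "[s * b'' = s * (b + b')] (mod 2 * s)"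
    using dvd_add[OF _ ss[of "a' * b + b' * e"]] unfolding cong_iff_dvd_diff
    by (fastforce simp: algebra_simps)
  then have "b'' mod 2 = (b + b') mod 2" by (simp add: scaled_parity)
  ultimately show ?thesis
    unfolding parity_eq[of ?p a'' b'', OF pc(1,2)] parity_eq[of f a b, OF fc(1,2)] parity_eq[of g a' b', OF gc(1,2)] by (simp add: mod_add_eq)
qed

lemma conj_coords:
  assumes "inv\<^bsub>H\<^esub> (nf p q t) \<cdot> nf i j k \<cdot> nf p q t = nf I J K"
  shows "[I = i] (mod 2 * s)" "[J = j] (mod 2 * s)" "[K = k + i * q - j * p] (mod s)"
proof -
  have eq: "nf p q t \<cdot> nf I J K = nf i j k \<cdot> nf p q t"
    unfolding assms[symmetric] by (simp add: H.m_assoc)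
  obtain u v w where uvw: "nf i j k \<cdot> nf p q t = nf u v w"
    using nf_surj[of "nf i j k \<cdot> nf p q t"] by auto
  note 1 = mod_mult[OF eq[unfolded uvw]] and 2 = mod_mult[OF uvw]
  have "[p + I = i + p] (mod 2 * s)" using 1(1) 2(1) by (metis cong_sym cong_trans)
  then show I: "[I = i] (mod 2 * s)" by (simp add: cong_iff_dvd_diff)
  have "[q + J = j + q] (mod 2 * s)" using 1(2) 2(2) by (metis cong_sym cong_trans)
  then show "[J = j] (mod 2 * s)" by (simp add: cong_iff_dvd_diff)
  have "[t + K - I * q = k + t - p * j] (mod s)" using 1(3) 2(3) by (metis cong_sym cong_trans)
  moreover have "[I * q = i * q] (mod s)" using mod_s[OF I] by (rule cong_mult) simp
  ultimately have "[t + K - I * q + I * q - t = k + t - p * j + i * q - t] (mod s)"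
    by (rule cong_diff[OF cong_add cong_refl])
  then show "[K = k + i * q - j * p] (mod s)" by (simp add: algebra_simps)
qed

text \<open>
  In the Heisenberg group \<open>H / Z\<^sub>2\<close>, conjugation by \<open>A\<^sup>p B\<^sup>q\<close> changes the exponent of \<open>C\<close> by \<open>i q - j p\<close>.
  For the images of \<open>A\<close> and \<open>B\<close>, \<open>(i, j)\<close> is \<open>(1, 0)\<close> and \<open>(0, 1)\<close> modulo \<open>s\<close>, so that \<open>q = - k\<close> and
  \<open>p = k'\<close> remove both exponents.
\<close>

lemma normalise_by_inner:
  assumes "[i = 1] (mod 2 * s)" "[j = 0] (mod 2 * s)" "[i' = 0] (mod s)" "[j' = 1] (mod s)"
  obtains g I J K I' J' K' where "g \<in> carrier H"
    "H.inner g (nf i j k) = nf I J K" "[I = 1] (mod 2 * s)" "[J = 0] (mod 2 * s)" "[K = 0] (mod s)"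
    "H.inner g (nf i' j' k') = nf I' J' K'" "[I' = i'] (mod 2 * s)" "[J' = j'] (mod 2 * s)" "[K' = 0] (mod s)"
proof -
  define g where "g = nf k' (- k) 0"
  have g: "g \<in> carrier H" by (simp add: g_def)
  obtain I J K where 1: "H.inner g (nf i j k) = nf I J K"
    using nf_surj[of "H.inner g (nf i j k)"] H.inner_auto[OF g] by auto
  obtain I' J' K' where 2: "H.inner g (nf i' j' k') = nf I' J' K'"
    using nf_surj[of "H.inner g (nf i' j' k')"] H.inner_auto[OF g] by auto
  note c1 = conj_coords[OF 1[unfolded H.inner_apply[OF R.triple_closed] g_def]]
  note c2 = conj_coords[OF 2[unfolded H.inner_apply[OF R.triple_closed] g_def]]
  have "[k + i * - k - j * k' = k + 1 * - k - 0 * k'] (mod s)"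
    using mod_s[OF assms(1)] mod_s[OF assms(2)] by (intro cong_add cong_diff cong_mult cong_refl)
  from cong_trans[OF c1(3) this] have K: "[K = 0] (mod s)" by simp
  have "[k' + i' * - k - j' * k' = k' + 0 * - k - 1 * k'] (mod s)"
    using assms(3,4) by (intro cong_add cong_diff cong_mult cong_refl)
  from cong_trans[OF c2(3) this] have K': "[K' = 0] (mod s)" by simp
  show thesis
    by (rule that[OF g 1 _ _ K 2 _ _ K']) (use c1 c2 assms in \<open>auto intro: cong_trans\<close>)
qed

lemma hom_rel_pair: "f \<in> hom H H \<Longrightarrow> rel_pair H h N (f A) (f B) (f C)"
proof -
  assume "f \<in> hom H H"
  then interpret f: group_hom H H f by (rule hom_group_hom)
  show ?thesis
  proof (rule rel_pairI)
    show "f A \<cdot> f B = f B \<cdot> f A \<cdot> f C"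
      using arg_cong[OF R.ab, of f] by (simp only: f.hom_mult H.m_closed R.ac)
    show "f A \<cdot> f C = f C \<cdot> f A [^]\<^bsub>H\<^esub> (1 + 2 * h)"
      using arg_cong[OF R.a_c, of f] by (simp only: f.hom_mult f.hom_int_pow H.int_pow_closed R.ac)
    show "f C \<cdot> f B = f B [^]\<^bsub>H\<^esub> (1 + 2 * h) \<cdot> f C"
      using arg_cong[OF R.c_b, of f] by (simp only: f.hom_mult f.hom_int_pow H.int_pow_closed R.ac)
    show "f A [^]\<^bsub>H\<^esub> N = \<one>\<^bsub>H\<^esub>"
      using arg_cong[OF R.aN, of f] by (simp only: f.hom_one f.hom_int_pow R.ac)
    show "f B [^]\<^bsub>H\<^esub> N = \<one>\<^bsub>H\<^esub>"
      using arg_cong[OF R.bN, of f] by (simp only: f.hom_one f.hom_int_pow R.ac)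
  qed simp_all
qed

lemma cong_obtain:
  assumes "[x = y] (mod M)"
  obtains t where "x = y + M * (t::int)"
  using assms by (metis cong_iff_lin cong_sym)

text \<open>
  After an inner automorphism the images are as in \<open>pair_parity\<close>, which supplies the missing
  divisibility for the image of \<open>B\<close>.
\<close>

lemma even_parity_InnAut:
  assumes f: "f \<in> Aut_central 3 H" and par: "parity f = (0, 0)"
  shows "f \<in> InnAut 2 H"
proof -
  obtain a b d e where fc: "cx (f A) = 1 + s * a" "cy (f A) = s * b" "cx (f B) = s * d" "cy (f B) = 1 + s * e"
    by (rule aut3_coords[OF f]) (rule that)
  have f_auto: "f \<in> auto H" using f by (simp add: H.Aut_central_iff)
  have "even a" "even b" using par parity_eq[of f a b, OF fc(1,2)] by (simp_all add: even_iff_mod_2_eq_zero)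
  then have c: "[cx (f A) = 1] (mod 2 * s)" "[cy (f A) = 0] (mod 2 * s)" "[cx (f B) = 0] (mod s)" "[cy (f B) = 1] (mod s)"
    unfolding fc by (auto simp: cong_iff_dvd_diff)
  obtain k k' where k: "f A = nf (cx (f A)) (cy (f A)) k" "f B = nf (cx (f B)) (cy (f B)) k'"
    using crd f_auto by (metis AB_closed H.auto_closed)
  obtain g I J K I' J' K' where g: "g \<in> carrier H"
    and A: "H.inner g (f A) = nf I J K" and cA: "[I = 1] (mod 2 * s)" "[J = 0] (mod 2 * s)" "[K = 0] (mod s)"
    and B: "H.inner g (f B) = nf I' J' K'"
    and cB: "[I' = cx (f B)] (mod 2 * s)" "[J' = cy (f B)] (mod 2 * s)" "[K' = 0] (mod s)"
    by (rule normalise_by_inner[OF c, of k k', folded k]) (rule that)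
  define f' where "f' = H.inner g \<otimes>\<^bsub>AutoGroup H\<^esub> f"
  have f'_auto: "f' \<in> auto H" by (simp add: f'_def H.AutoGroup_mult_closed H.inner_auto g f_auto)
  have f': "f' A = nf I J K" "f' B = nf I' J' K'"
    using A B by (simp_all add: f'_def H.AutoGroup_mult_apply H.inner_auto g f_auto)
  obtain a1 where a1: "I = 1 + 2 * s * a1" by (rule cong_obtain[OF cA(1)])
  obtain b1 where b1: "J = 0 + 2 * s * b1" by (rule cong_obtain[OF cA(2)])
  obtain c1 where c1: "K = 0 + s * c1" by (rule cong_obtain[OF cA(3)])
  obtain d1 where d1: "I' = cx (f B) + 2 * s * d1" by (rule cong_obtain[OF cB(1)])
  obtain e1 where e1: "J' = cy (f B) + 2 * s * e1" by (rule cong_obtain[OF cB(2)])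
  obtain f1 where f1: "K' = 0 + s * f1" by (rule cong_obtain[OF cB(3)])
  have form: "f' A = nf (1 + 2 * (s * a1)) (2 * (s * b1)) (s * c1)"
    "f' B = nf (s * (d + 2 * d1)) (1 + s * (e + 2 * e1)) (s * f1)"
    unfolding f' by (simp_all add: a1 b1 c1 d1 e1 f1 fc algebra_simps)
  have "f' \<in> hom H H" using f'_auto by (simp add: H.auto_iff)
  note ev = pair_parity[OF hom_rel_pair[OF this, unfolded form]]
  then obtain d2 e2 where "d + 2 * d1 = 2 * d2" "e + 2 * e1 = 2 * e2" by (elim evenE) blast
  then have B': "f' B = nf (2 * (s * d2)) (1 + 2 * (s * e2)) (s * f1)"
    unfolding form(2) by (simp add: algebra_simps)
  have gen: "\<exists>z\<in>upper_central H 2. f' A = z \<cdot> A" "\<exists>z\<in>upper_central H 2. f' B = z \<cdot> B"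
    unfolding form(1) B' by (rule coset_2_gen; simp add: cong_iff_dvd_diff)+
  have "f' \<in> Aut_central 2 H"
    unfolding H.Aut_central_iff
    using f'_auto hom_coset[OF \<open>f' \<in> hom H H\<close> H.upper_central_normal gen] by blast
  then have "f' \<in> InnAut 2 H" by (rule H.Aut_central_InnAut)
  then show ?thesis using H.InnAut_cancel_inner[OF f_auto g] by (simp add: f'_def)
qed

lemma InnAut_coords:
  assumes f: "f \<in> InnAut 2 H"
  shows "[cx (f A) = 1] (mod 2 * s)" "[cy (f A) = 0] (mod 2 * s)"
    "[cx (f B) = 0] (mod 2 * s)" "[cy (f B) = 1] (mod 2 * s)"
proof -
  obtain g where g: "g \<in> carrier H"
    and fx: "\<And>x. x \<in> carrier H \<Longrightarrow> \<exists>z\<in>upper_central H 2. f x = z \<cdot> (inv\<^bsub>H\<^esub> g \<cdot> x \<cdot> g)"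
    using f unfolding H.InnAut_iff by blast
  obtain p q t where pqt: "g = nf p q t" using nf_surj[OF g] by blast
  have co: "[cx (f (nf i j k)) = i] (mod 2 * s)" "[cy (f (nf i j k)) = j] (mod 2 * s)" for i j k
  proof -
    obtain z where z: "z \<in> upper_central H 2" "f (nf i j k) = z \<cdot> (inv\<^bsub>H\<^esub> g \<cdot> nf i j k \<cdot> g)"
      using fx[OF R.triple_closed] by blast
    obtain u v w where uvw: "z = nf u v w" using nf_surj[OF upper_central_closed[OF z(1)]] by blast
    have d: "[u = 0] (mod 2 * s)" "[v = 0] (mod 2 * s)"
      using z(1) unfolding uvw upper_central_2_iff by (auto simp: cong_iff_dvd_diff)
    obtain I J K where IJK: "inv\<^bsub>H\<^esub> g \<cdot> nf i j k \<cdot> g = nf I J K"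
      using nf_surj[of "inv\<^bsub>H\<^esub> g \<cdot> nf i j k \<cdot> g"] g by auto
    note c = conj_coords[OF IJK[unfolded pqt]]
    have "[cx (nf u v w \<cdot> nf I J K) = 0 + i] (mod 2 * s)"
      by (rule cong_trans[OF cx_mult(1) cong_add[OF cong_trans[OF cx_nf(1) d(1)] cong_trans[OF cx_nf(1) c(1)]]]) simp_all
    moreover have "[cy (nf u v w \<cdot> nf I J K) = 0 + j] (mod 2 * s)"
      by (rule cong_trans[OF cx_mult(2) cong_add[OF cong_trans[OF cx_nf(2) d(2)] cong_trans[OF cx_nf(2) c(2)]]]) simp_all
    ultimately show "[cx (f (nf i j k)) = i] (mod 2 * s)" "[cy (f (nf i j k)) = j] (mod 2 * s)"
      unfolding z(2) IJK uvw by simp_all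
  qed
  show "[cx (f A) = 1] (mod 2 * s)" "[cy (f A) = 0] (mod 2 * s)"
    using co[of 1 0 0] unfolding nf_A by simp_all
  show "[cx (f B) = 0] (mod 2 * s)" "[cy (f B) = 1] (mod 2 * s)"
    using co[of 0 1 0] unfolding nf_B by simp_all
qed

lemma InnAut_subset: "InnAut 2 H \<subseteq> Aut_central 3 H"
proof
  fix f assume f: "f \<in> InnAut 2 H"
  then have auto: "f \<in> auto H" by (simp add: H.InnAut_iff)
  obtain k k' where k: "f A = nf (cx (f A)) (cy (f A)) k" "f B = nf (cx (f B)) (cy (f B)) k'"
    using crd auto by (metis AB_closed H.auto_closed)
  show "f \<in> Aut_central 3 H"
    by (rule auto_central_3I[OF auto k(1) _ _ k(2)])
       (use InnAut_coords[OF f, THEN mod_s] in \<open>simp_all add: cong_iff_dvd_diff\<close>)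
qed

lemma parity_InnAut:
  assumes "f \<in> InnAut 2 H"
  shows "parity f = (0, 0)"
proof -
  obtain a b d e where fc: "cx (f A) = 1 + s * a" "cy (f A) = s * b" "cx (f B) = s * d" "cy (f B) = 1 + s * e"
    by (rule aut3_coords[OF subsetD[OF InnAut_subset assms]]) (rule that)
  have "[s * a = s * 0] (mod 2 * s)" "[s * b = s * 0] (mod 2 * s)"
    using InnAut_coords(1,2)[OF assms] unfolding fc by (simp_all add: cong_iff_dvd_diff)
  then have "a mod 2 = 0" "b mod 2 = 0" unfolding scaled_parity by simp_all
  then show ?thesis using parity_eq[of f a b, OF fc(1,2)] by simp
qed

text \<open>
  The cosets of \<open>A\<close> and \<open>B\<close> modulo the derived subgroup \<open>\<langle>A\<^sup>2\<^sup>s, B\<^sup>2\<^sup>s, C\<rangle>\<close>, listed without repetition.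
\<close>

definition coset_A where
  "coset_A = (\<lambda>(a, b, k). nf (1 + 2 * (s * a)) (2 * (s * b)) k) ` ({0..<s} \<times> {0..<s} \<times> {0..<N})"

definition coset_B where
  "coset_B = (\<lambda>(a, b, k). nf (2 * (s * a)) (1 + 2 * (s * b)) k) ` ({0..<s} \<times> {0..<s} \<times> {0..<N})"

lemma scaled_N: "[2 * (s * a) = 2 * (s * b)] (mod N) \<longleftrightarrow> [a = b] (mod s)" for a b :: int
proof -
  have "[2 * (s * a) = 2 * (s * b)] (mod N) \<longleftrightarrow> (2 * s) * s dvd (2 * s) * (a - b)"
    by (simp add: cong_iff_dvd_diff N_def algebra_simps)
  also have "\<dots> \<longleftrightarrow> s dvd a - b" by (simp only: dvd_mult_cancel_left) simp
  finally show ?thesis by (simp add: cong_iff_dvd_diff)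
qed

lemma small_cong: "x \<in> {0..<M} \<Longrightarrow> y \<in> {0..<M} \<Longrightarrow> [x = y] (mod M) \<longleftrightarrow> x = y" for x y :: int
  by (simp add: cong_def)

lemma coset_A_iff: "nf i j k \<in> coset_A \<longleftrightarrow> [i = 1] (mod 2 * s) \<and> [j = 0] (mod 2 * s)"
proof
  assume "nf i j k \<in> coset_A"
  then obtain a b k' where "nf i j k = nf (1 + 2 * (s * a)) (2 * (s * b)) k'" by (auto simp: coset_A_def)
  then have "[i = 1 + 2 * (s * a)] (mod 2 * s)" "[j = 2 * (s * b)] (mod 2 * s)"
    unfolding nf_eq_iff using cong_dvd_modulus[OF _ two_s_N(1)] by blast+
  moreover have "[1 + 2 * (s * a) = 1] (mod 2 * s)" "[2 * (s * b) = 0] (mod 2 * s)"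
    by (simp_all add: cong_iff_dvd_diff)
  ultimately show "[i = 1] (mod 2 * s) \<and> [j = 0] (mod 2 * s)" using cong_trans by blast
next
  assume c: "[i = 1] (mod 2 * s) \<and> [j = 0] (mod 2 * s)"
  obtain a where a: "i = 1 + 2 * s * a" using c by (elim conjE cong_obtain) 
  obtain b where b: "j = 0 + 2 * s * b" using c by (elim conjE cong_obtain) 
  have "nf i j k = nf (1 + 2 * (s * (a mod s))) (2 * (s * (b mod s))) (k mod N)"
    unfolding nf_eq_iff
  proof (intro conjI)
    show "[i = 1 + 2 * (s * (a mod s))] (mod N)"
      unfolding a mult.assoc by (intro cong_add cong_refl) (simp add: scaled_N)
    show "[j = 2 * (s * (b mod s))] (mod N)"
      unfolding b mult.assoc add_0 by (simp add: scaled_N)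
  qed simp
  then show "nf i j k \<in> coset_A"
    unfolding coset_A_def using N_pos by (intro image_eqI[of _ _ "(a mod s, b mod s, k mod N)"]) auto
qed

lemma coset_B_iff: "nf i j k \<in> coset_B \<longleftrightarrow> [i = 0] (mod 2 * s) \<and> [j = 1] (mod 2 * s)"
proof
  assume "nf i j k \<in> coset_B"
  then obtain a b k' where "nf i j k = nf (2 * (s * a)) (1 + 2 * (s * b)) k'" by (auto simp: coset_B_def)
  then have "[i = 2 * (s * a)] (mod 2 * s)" "[j = 1 + 2 * (s * b)] (mod 2 * s)"
    unfolding nf_eq_iff using cong_dvd_modulus[OF _ two_s_N(1)] by blast+
  moreover have "[2 * (s * a) = 0] (mod 2 * s)" "[1 + 2 * (s * b) = 1] (mod 2 * s)"
    by (simp_all add: cong_iff_dvd_diff)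
  ultimately show "[i = 0] (mod 2 * s) \<and> [j = 1] (mod 2 * s)" using cong_trans by blast
next
  assume c: "[i = 0] (mod 2 * s) \<and> [j = 1] (mod 2 * s)"
  obtain a where a: "i = 0 + 2 * s * a" using c by (elim conjE cong_obtain) 
  obtain b where b: "j = 1 + 2 * s * b" using c by (elim conjE cong_obtain) 
  have "nf i j k = nf (2 * (s * (a mod s))) (1 + 2 * (s * (b mod s))) (k mod N)"
    unfolding nf_eq_iff
  proof (intro conjI)
    show "[i = 2 * (s * (a mod s))] (mod N)"
      unfolding a mult.assoc add_0 by (simp add: scaled_N)
    show "[j = 1 + 2 * (s * (b mod s))] (mod N)"
      unfolding b mult.assoc by (intro cong_add cong_refl) (simp add: scaled_N)
  qed simp
  then show "nf i j k \<in> coset_B"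
    unfolding coset_B_def using N_pos by (intro image_eqI[of _ _ "(a mod s, b mod s, k mod N)"]) auto
qed

lemma card_box: "card ({0..<s} \<times> {0..<s} \<times> {0..<N}) = 2 ^ (4 * m - 3)"
proof -
  have n: "nat s = 2 ^ (m - 1)" "nat N = 2 ^ (2 * m - 1)"
    by (simp_all add: s_def N_eq nat_power_eq)
  have "4 * m - 3 = (m - 1) + ((m - 1) + (2 * m - 1))" using m by simp
  then show ?thesis by (simp only: card_cartesian_product card_atLeastLessThan_int diff_zero n power_add)
qed

lemma card_cosets: "card coset_A = 2 ^ (4 * m - 3)" "card coset_B = 2 ^ (4 * m - 3)"
proof -
  have "inj_on (\<lambda>(a, b, k). nf (1 + 2 * (s * a)) (2 * (s * b)) k) ({0..<s} \<times> {0..<s} \<times> {0..<N})"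
    by (auto simp: inj_on_def nf_eq_iff scaled_N small_cong cong_add_lcancel)
  then show "card coset_A = 2 ^ (4 * m - 3)" by (simp only: coset_A_def card_image card_box)
  have "inj_on (\<lambda>(a, b, k). nf (2 * (s * a)) (1 + 2 * (s * b)) k) ({0..<s} \<times> {0..<s} \<times> {0..<N})"
    by (auto simp: inj_on_def nf_eq_iff scaled_N small_cong cong_add_lcancel)
  then show "card coset_B = 2 ^ (4 * m - 3)" by (simp only: coset_B_def card_image card_box)
qed

text \<open>
  An element of \<open>Inn(H) Aut\<^sub>2(H)\<close> is determined by the images of \<open>A\<close> and \<open>B\<close>, and these can be chosen
  freely in the two cosets: an inner automorphism moves a given pair into \<open>Z\<^sub>2 A\<close> and \<open>Z\<^sub>2 B\<close>, where
  \<open>deep_auto\<close> applies.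
\<close>

lemma card_InnAut: "card (InnAut 2 H) = 2 ^ (8 * m - 6)"
proof -
  have "bij_betw (\<lambda>f. (f A, f B)) (InnAut 2 H) (coset_A \<times> coset_B)"
    unfolding bij_betw_def
  proof (intro conjI subset_antisym subsetI)
    show "inj_on (\<lambda>f. (f A, f B)) (InnAut 2 H)"
      by (rule inj_onI) (auto intro: auto_eq simp: H.InnAut_iff)
    fix P assume "P \<in> (\<lambda>f. (f A, f B)) ` InnAut 2 H"
    then obtain f where f: "f \<in> InnAut 2 H" "P = (f A, f B)" by blast
    have auto: "f \<in> auto H" using f(1) by (simp add: H.InnAut_iff)
    obtain k k' where k: "f A = nf (cx (f A)) (cy (f A)) k" "f B = nf (cx (f B)) (cy (f B)) k'"
      using crd auto by (metis AB_closed H.auto_closed)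
    have "f A \<in> coset_A" by (subst k(1)) (simp add: coset_A_iff InnAut_coords[OF f(1)])
    moreover have "f B \<in> coset_B" by (subst k(2)) (simp add: coset_B_iff InnAut_coords[OF f(1)])
    ultimately show "P \<in> coset_A \<times> coset_B" by (simp add: f(2))
  next
    fix P assume "P \<in> coset_A \<times> coset_B"
    then obtain x y where P: "P = (x, y)" "x \<in> coset_A" "y \<in> coset_B" by blast
    then obtain i j k i' j' k' where xy: "x = nf i j k" "y = nf i' j' k'"
      by (auto simp: coset_A_def coset_B_def)
    have c: "[i = 1] (mod 2 * s)" "[j = 0] (mod 2 * s)" "[i' = 0] (mod 2 * s)" "[j' = 1] (mod 2 * s)"
      using P(2,3) unfolding xy coset_A_iff coset_B_iff by auto
    obtain g I J K I' J' K' where g: "g \<in> carrier H"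
      and A: "H.inner g x = nf I J K" and cA: "[I = 1] (mod 2 * s)" "[J = 0] (mod 2 * s)" "[K = 0] (mod s)"
      and B: "H.inner g y = nf I' J' K'"
      and cB: "[I' = i'] (mod 2 * s)" "[J' = j'] (mod 2 * s)" "[K' = 0] (mod s)"
      by (rule normalise_by_inner[OF c(1,2) mod_s[OF c(3)] mod_s[OF c(4)], of k k', folded xy]) (rule that)
    obtain a1 where a1: "I = 1 + 2 * s * a1" by (rule cong_obtain[OF cA(1)])
    obtain b1 where b1: "J = 0 + 2 * s * b1" by (rule cong_obtain[OF cA(2)])
    obtain c1 where c1: "K = 0 + s * c1" by (rule cong_obtain[OF cA(3)])
    obtain d1 where d1: "I' = 0 + 2 * s * d1" by (rule cong_obtain[OF cong_trans[OF cB(1) c(3)]])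
    obtain e1 where e1: "J' = 1 + 2 * s * e1" by (rule cong_obtain[OF cong_trans[OF cB(2) c(4)]])
    obtain f1 where f1: "K' = 0 + s * f1" by (rule cong_obtain[OF cB(3)])
    obtain t where t: "t \<in> Aut_central 2 H" "t A = nf (1 + 2 * (s * a1)) (2 * (s * b1)) (s * c1)"
      "t B = nf (2 * (s * d1)) (1 + 2 * (s * e1)) (s * f1)"
      by (rule deep_auto) (rule that)
    have tA: "t A = H.inner g x" and tB: "t B = H.inner g y"
      unfolding A B t by (simp_all add: a1 b1 c1 d1 e1 f1 mult.assoc)
    let ?i = "inv\<^bsub>AutoGroup H\<^esub> (H.inner g)"
    interpret G: group "AutoGroup H" by (rule H.AutoGroup)
    interpret I: normal "InnAut 2 H" "AutoGroup H" by (rule H.InnAut_normal)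
    have ta: "t \<in> auto H" using t(1) by (simp add: H.Aut_central_iff)
    have ia: "H.inner g \<in> auto H" "?i \<in> auto H" using g by (simp_all add: H.inner_auto H.AutoGroup_inv_closed)
    have "?i \<otimes>\<^bsub>AutoGroup H\<^esub> t \<in> InnAut 2 H"
      by (rule I.m_closed[OF I.m_inv_closed[OF H.inner_InnAut[OF g]] H.Aut_central_InnAut[OF t(1)]])
    moreover have "(?i \<otimes>\<^bsub>AutoGroup H\<^esub> t) A = x" "(?i \<otimes>\<^bsub>AutoGroup H\<^esub> t) B = y"
      using ta ia by (simp_all add: H.AutoGroup_mult_apply tA tB H.AutoGroup_inv_apply xy)
    ultimately show "P \<in> (\<lambda>f. (f A, f B)) ` InnAut 2 H"
      unfolding P(1) by (intro image_eqI[of _ _ "?i \<otimes>\<^bsub>AutoGroup H\<^esub> t"]) simp_all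
  qed
  then have "card (InnAut 2 H) = card (coset_A \<times> coset_B)" by (rule bij_betw_same_card)
  also have "\<dots> = 2 ^ (8 * m - 6)"
  proof -
    have "8 * m - 6 = (4 * m - 3) + (4 * m - 3)" using m by simp
    then show ?thesis by (simp only: card_cartesian_product card_cosets power_add)
  qed
  finally show ?thesis .
qed

lemma parity_range: "parity f \<in> carrier (integer_mod_group 2 \<times>\<times> integer_mod_group 2)"
  by (simp add: parity_def carrier_integer_mod_group)

lemma parity_Gamma: "parity (\<Gamma> m l) = (1, 0)" "parity (\<Gamma>\<nu> m l) = (0, 1)"
proof -
  have *: "parity f = (x mod 2, y mod 2)" if f: "f \<in> Aut_central 3 H" and A: "f A = nf (1 + s * x) (s * y) 0" for f x y
  proof -
    obtain a b d e where fc: "cx (f A) = 1 + s * a" "cy (f A) = s * b" "cx (f B) = s * d" "cy (f B) = 1 + s * e"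
      by (rule aut3_coords[OF f]) (rule that)
    have "[1 + s * a = 1 + s * x] (mod 2 * s)" "[s * b = s * y] (mod 2 * s)"
      using cx_nf[of "1 + s * x" "s * y" 0] unfolding A[symmetric] fc by simp_all
    then have "[s * a = s * x] (mod 2 * s)" "[s * b = s * y] (mod 2 * s)"
      by (simp_all add: cong_iff_dvd_diff)
    then have "a mod 2 = x mod 2" "b mod 2 = y mod 2" unfolding scaled_parity by simp_all
    then show ?thesis using parity_eq[of f a b, OF fc(1,2)] by simp
  qed
  show "parity (\<Gamma> m l) = (1, 0)" using *[OF Gamma_auto(1), of 1 0] Gamma_auto(2) by simp
  show "parity (\<Gamma>\<nu> m l) = (0, 1)" using *[OF Gamma_nu_auto(1), of 0 1] Gamma_nu_auto(2) by simp
qed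

lemma Lambda_hat_eq: "\<Lambda>_hat m l = (\<lambda>C. the_elem (H.quotient_class ` C))"
  unfolding \<Lambda>_hat_def[abs_def] \<Lambda>_def K_grp_def H.quotient_class_def[abs_def] ..

end

theorem theorem6p10:
  fixes m :: nat and l :: int
  assumes "m > 1" and "odd l"
  shows "\<Lambda>_hat m l ` carrier (OutQuot 2 (H_grp m l)) =
           \<Lambda>_hat m l ` generate (OutQuot 2 (H_grp m l)) {H_bar m l (\<Gamma> m l), H_bar m l (\<Gamma>\<nu> m l)} \<and>
         (OutQuot 1 (K_grp m l)) \<lparr>carrier := \<Lambda>_hat m l ` carrier (OutQuot 2 (H_grp m l))\<rparr>
           \<cong> integer_mod_group 2 \<times>\<times> integer_mod_group 2 \<and>
         card (Aut_central 3 (H_grp m l)) = 2 ^ (8 * m - 4) \<and>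
         Aut_central 3 (H_grp m l) =
           InnAut 2 (H_grp m l) <#>\<^bsub>AutoGroup (H_grp m l)\<^esub>
             generate (AutoGroup (H_grp m l)) {\<Gamma> m l, \<Gamma>\<nu> m l}"
proof -
  interpret H_group m l by (rule H_group.intro[OF assms])
  have mult: "parity (f \<otimes>\<^bsub>AutoGroup H\<^esub> g)
     = parity f \<otimes>\<^bsub>integer_mod_group 2 \<times>\<times> integer_mod_group 2\<^esub> parity g"
    if "f \<in> Aut_central 3 H" "g \<in> Aut_central 3 H" for f g
    using parity_mult[OF that] by (simp add: DirProd_def split: prod.splits)
  have kernel: "parity f = (0, 0) \<longleftrightarrow> f \<in> InnAut 2 H" if "f \<in> Aut_central 3 H" for f
    using even_parity_InnAut[OF that] parity_InnAut by blast
  note Klein = H.Aut3_Klein[of parity, OF parity_range mult kernel InnAut_subset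
      Gamma_auto(1) Gamma_nu_auto(1) parity_Gamma]
  have "8 * m - 4 = 2 + (8 * m - 6)" using assms(1) by simp
  then have "card (Aut_central 3 H) = 2 ^ (8 * m - 4)"
    using Klein(3) card_InnAut by (simp add: power_add)
  then show ?thesis
    using Klein(1,2,4) unfolding H_bar_def Lambda_hat_eq K_grp_def by simp
qed

end
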